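(* The multiple-unicast conjecture holds for all undirected networks if and only if, for every network instance and every non-negative edge-weight vector $\mathbf{w}$, every irreducible core is independent under $\mathbf{w}$.
   Context: Network model. $G=(V,E)$ is a finite undirected graph. A unicast session is an ordered pair $h_i=(s_i,t_i)$ of vertices (source, sink) with demand rate $r_i\ge 0$; $\mathcal{H}=\{h_1,\dots,h_k\}$. Each undirected edge $e=\{u,v\}$ is replaced by two opposing arcs $\vec{uv},\vec{vu}$. A network instance is a triple $(G,\mathcal{H},\mathbf{w})$ with $\mathbf{w}\in\mathbb{R}_{\ge 0}^{|E|}$ an edge-weight vector; $d_w(u,v)$ is the shortest-path distance in $G$ under $\mathbf{w}$. The sessions have mutually independent source messages $\mathcal{M}=\{M_1,\dots,M_k\}$; $M_i$ is generated at $s_i$ with rate $r_i$ and must be recovered at $t_i$. Coding and routing. A (network) coding solution is understood in the standard sense: the transmission on each arc is a sequence of random variables (symbols), each symbol sent by a node being a function of the messages generated at that node and the symbols it has already received, such that every $t_i$ can decode $M_i$. Its flow $f$ assigns to each arc the rate of transmission on it, and $f(e)=f(\vec{uv})+f(\vec{vu})$. A routing solution only forwards uncoded message symbols, i.e. it is a fractional multicommodity flow. Given edge capacities $\mathbf{c}$, a solution is feasible if $f(\vec{uv})+f(\vec{vu})\le c(e)$ for every $e=\{u,v\}\in E$; a rate vector is achievable with coding (routing) if a feasible coding (routing) solution satisfying these demands exists. Multiple-unicast conjecture. For undirected networks (every $G$, $\mathbf{c}$, $\mathcal{H}$), a demand rate vector $\mathbf{r}$ is achievable with network coding if and only if it is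 achievable with routing. By linear programming duality this is equivalent to: for every $\mathbf{w}\in\mathbb{R}_{\ge 0}^{|E|}$, every valid coding flow $f$ satisfying demand $\mathbf{r}$ obeys $\sum_{e=\{u,v\}\in E}w(e)(f(\vec{uv})+f(\vec{vu}))\ge\sum_{i=1}^k r_i\,d_w(s_i,t_i)$. Irreducible core. A pair of sessions $h_1=(s_1,t_1)$, $h_2=(s_2,t_2)$ is reducible (in $(G,\mathbf{w})$) if at least one of (1) $d_w(s_1,t_1)+d_w(s_2,t_2)\le d_w(s_1,t_2)+d_w(s_2,t_1)$, (2) $d_w(s_1,t_1)+d_w(s_2,t_2)\le d_w(s_1,s_2)+d_w(t_1,t_2)$ holds, and the pair is not symmetric, i.e. the two sessions are not merely reversals $(s,t),(t,s)$ of each other. An irreducible core is a session set (of an instance $(G,\mathcal{H},\mathbf{w})$) that admits no reducible pairs. Independence. A minimum-cost coding solution for $\mathcal{H}$ is a coding solution (no capacity constraints) satisfying the demands and minimizing $\sum_{e}w(e)f(e)$. $\mathcal{H}$ is independent under $\mathbf{w}$ if there exists a minimum-cost coding solution $\mathcal{C}^\star$ such that, for every pair of distinct sessions $h_i,h_j\in\mathcal{H}$, every edge $e\in E$, and every symbol $X$ transmitted on $e$ by $\mathcal{C}^\star$, $I(X;M_i\mid \mathbf{M}_{\setminus\{i\}})\cdot I(X;M_j\mid \mathbf{M}_{\setminus\{j\}})=0$, where $\mathbf{M}_{\setminus\{l\}}=\mathcal{M}\setminus\{M_l\}$. *)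

theory Defs
  imports "HOL-Probability.Probability" "Graph_Theory.Shortest_Path"
begin

section \<open>Networks\<close>

text \<open>Vertices are natural numbers: every finite graph is isomorphic to one of this form.
  An undirected edge is a two-element set of vertices, an arc and a session are ordered pairs.\<close>

type_synonym vertex = nat
type_synonym edge = "vertex set"
type_synonym arc = "vertex \<times> vertex"
type_synonym session = "vertex \<times> vertex"

abbreviation source :: "session \<Rightarrow> vertex" where "source \<equiv> fst"
abbreviation sink :: "session \<Rightarrow> vertex" where "sink \<equiv> snd"

definition finite_graph :: "vertex set \<Rightarrow> edge set \<Rightarrow> bool" where
  "finite_graph V E \<longleftrightarrow> finite V \<and> (\<forall>e\<in>E. e \<subseteq> V \<and> card e = 2)"

definition session_set :: "vertex set \<Rightarrow> session set \<Rightarrow> bool" where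
  "session_set V H \<longleftrightarrow> finite H \<and> H \<subseteq> V \<times> V"

definition network_instance :: "vertex set \<Rightarrow> edge set \<Rightarrow> session set \<Rightarrow> (edge \<Rightarrow> real) \<Rightarrow> bool" where
  "network_instance V E H w \<longleftrightarrow> finite_graph V E \<and> session_set V H \<and> (\<forall>e\<in>E. 0 \<le> w e)"

definition arcs_of :: "edge \<Rightarrow> arc set" where
  "arcs_of e = {(u, v). {u, v} = e}"

definition bidirected :: "vertex set \<Rightarrow> edge set \<Rightarrow> (vertex, arc) pre_digraph" where
  "bidirected V E = \<lparr>verts = V, arcs = (\<Union>e\<in>E. arcs_of e), tail = fst, head = snd\<rparr>"

text \<open>Shortest-path distance; it is \<open>\<infinity>\<close> between vertices in different components.\<close>

definition wdist :: "vertex set \<Rightarrow> edge set \<Rightarrow> (edge \<Rightarrow> real) \<Rightarrow> vertex \<Rightarrow> vertex \<Rightarrow> ereal" where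
  "wdist V E w u v = wf_digraph.\<mu> (bidirected V E) (\<lambda>(x, y). w {x, y}) u v"

definition edge_flow :: "(arc \<Rightarrow> real) \<Rightarrow> edge \<Rightarrow> real" where
  "edge_flow f e = (\<Sum>a\<in>arcs_of e. f a)"

lemma edge_flow_doubleton: "u \<noteq> v \<Longrightarrow> edge_flow f {u, v} = f (u, v) + f (v, u)"
proof -
  assume "u \<noteq> v"
  moreover have "arcs_of {u, v} = {(u, v), (v, u)}"
    by (auto simp: arcs_of_def doubleton_eq_iff)
  ultimately show ?thesis
    by (simp add: edge_flow_def)
qed

definition within_capacity :: "edge set \<Rightarrow> (edge \<Rightarrow> real) \<Rightarrow> (arc \<Rightarrow> real) \<Rightarrow> bool" where
  "within_capacity E c f \<longleftrightarrow> (\<forall>e\<in>E. edge_flow f e \<le> c e)"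

section \<open>Routing\<close>

text \<open>A fractional multicommodity flow \<open>g\<close>; \<open>g h a\<close> is the rate at which symbols of the message
  of session \<open>h\<close> are forwarded on arc \<open>a\<close>. The two indicators cancel when \<open>source h = sink h\<close>.\<close>

definition routing_solution ::
  "vertex set \<Rightarrow> edge set \<Rightarrow> session set \<Rightarrow> (session \<Rightarrow> real) \<Rightarrow> (session \<Rightarrow> arc \<Rightarrow> real) \<Rightarrow> bool" where
  "routing_solution V E H r g \<longleftrightarrow>
     (\<forall>h\<in>H. \<forall>a\<in>arcs (bidirected V E). 0 \<le> g h a) \<and>
     (\<forall>h\<in>H. \<forall>v\<in>V.
        (\<Sum>a | a \<in> arcs (bidirected V E) \<and> fst a = v. g h a)
      - (\<Sum>a | a \<in> arcs (bidirected V E) \<and> snd a = v. g h a)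
      = r h * (of_bool (v = source h) - of_bool (v = sink h)))"

definition routing_achievable ::
  "vertex set \<Rightarrow> edge set \<Rightarrow> session set \<Rightarrow> (edge \<Rightarrow> real) \<Rightarrow> (session \<Rightarrow> real) \<Rightarrow> bool" where
  "routing_achievable V E H c r \<longleftrightarrow>
     (\<exists>g. routing_solution V E H r g \<and> within_capacity E c (\<lambda>a. \<Sum>h\<in>H. g h a))"

section \<open>Network coding\<close>

text \<open>A block code. The only randomness is that of the messages, which are finite-valued, so a
  probability measure on the naturals and alphabets of naturals are no restriction.
  The messages cover \<open>blocklength\<close> units of time; on every arc one symbol is sent in each of the
  rounds \<open>0, \<dots>, rounds - 1\<close>. A symbol may be constant, which amounts to sending nothing.
  The number of rounds is independent of the block length, since successive blocks can be
  pipelined: latency does not influence the rate.\<close>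

record code =
  Pr :: "nat measure"
  blocklength :: nat
  rounds :: nat
  message :: "session \<Rightarrow> nat \<Rightarrow> nat"
  symbol :: "arc \<Rightarrow> nat \<Rightarrow> nat \<Rightarrow> nat"

text \<open>Shannon entropy and conditional mutual information, in bits, of finite-valued random
  variables: these are what \<open>\<H>(X)\<close> and \<open>\<I>(X ; Y | Z)\<close> abbreviate inside the locale
  \<^locale>\<open>information_space\<close> with base 2.\<close>

abbreviation ent :: "nat measure \<Rightarrow> (nat \<Rightarrow> 'x) \<Rightarrow> real" where
  "ent P X \<equiv> prob_space.entropy P 2 (count_space (X ` space P)) X"

abbreviation cond_mi ::
  "nat measure \<Rightarrow> (nat \<Rightarrow> 'x) \<Rightarrow> (nat \<Rightarrow> 'y) \<Rightarrow> (nat \<Rightarrow> 'z) \<Rightarrow> real" where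
  "cond_mi P X Y Z \<equiv> prob_space.conditional_mutual_information P 2
     (count_space (X ` space P)) (count_space (Y ` space P)) (count_space (Z ` space P)) X Y Z"

definition function_of :: "nat measure \<Rightarrow> (nat \<Rightarrow> 'x) \<Rightarrow> (nat \<Rightarrow> 'y) \<Rightarrow> bool" where
  "function_of P X Y \<longleftrightarrow> (\<exists>\<phi>. \<forall>\<omega>\<in>space P. X \<omega> = \<phi> (Y \<omega>))"

definition messages :: "code \<Rightarrow> session set \<Rightarrow> nat \<Rightarrow> (session \<Rightarrow> nat)" where
  "messages C S \<omega> = (\<lambda>h\<in>S. message C h \<omega>)"

text \<open>What node \<open>v\<close> knows at the beginning of round \<open>t\<close>: the messages generated at \<open>v\<close> and all
  symbols received in earlier rounds.\<close>

definition knowledge ::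
  "vertex set \<Rightarrow> edge set \<Rightarrow> session set \<Rightarrow> code \<Rightarrow> vertex \<Rightarrow> nat
    \<Rightarrow> nat \<Rightarrow> (session \<Rightarrow> nat) \<times> (arc \<times> nat \<Rightarrow> nat)" where
  "knowledge V E H C v t \<omega> =
     (messages C {h\<in>H. source h = v} \<omega>,
      \<lambda>(a, s) \<in> {a\<in>arcs (bidirected V E). snd a = v} \<times> {..<t}. symbol C a s \<omega>)"

text \<open>The rate of a message is its entropy per unit of time. Messages are not required to be
  uniformly distributed: otherwise demands whose rate is not the logarithm of an integer would be
  met only approximately, and minimum-cost solutions would fail to exist.\<close>

definition coding_solution ::
  "vertex set \<Rightarrow> edge set \<Rightarrow> session set \<Rightarrow> (session \<Rightarrow> real) \<Rightarrow> code \<Rightarrow> bool" where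
  "coding_solution V E H r C \<longleftrightarrow>
     prob_space (Pr C) \<and> 0 < blocklength C \<and>
     (\<forall>h\<in>H. simple_function (Pr C) (message C h)) \<and>
     prob_space.indep_vars (Pr C) (\<lambda>_. count_space UNIV) (message C) H \<and>
     (\<forall>h\<in>H. ent (Pr C) (message C h) / blocklength C = r h) \<and>
     (\<forall>a\<in>arcs (bidirected V E). \<forall>t<rounds C.
        function_of (Pr C) (symbol C a t) (knowledge V E H C (fst a) t)) \<and>
     (\<forall>h\<in>H. function_of (Pr C) (message C h) (knowledge V E H C (sink h) (rounds C)))"

text \<open>The rate of transmission on an arc is the joint entropy of the sequence of symbols sent on it,
  per unit of time.\<close>

definition transmission :: "code \<Rightarrow> arc \<Rightarrow> nat \<Rightarrow> nat list" where
  "transmission C a \<omega> = map (\<lambda>t. symbol C a t \<omega>) [0..<rounds C]"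

definition coding_flow :: "code \<Rightarrow> arc \<Rightarrow> real" where
  "coding_flow C a = ent (Pr C) (transmission C a) / blocklength C"

definition coding_achievable ::
  "vertex set \<Rightarrow> edge set \<Rightarrow> session set \<Rightarrow> (edge \<Rightarrow> real) \<Rightarrow> (session \<Rightarrow> real) \<Rightarrow> bool" where
  "coding_achievable V E H c r \<longleftrightarrow>
     (\<exists>C. coding_solution V E H r C \<and> within_capacity E c (coding_flow C))"

definition multiple_unicast_conjecture :: bool where
  "multiple_unicast_conjecture \<longleftrightarrow>
     (\<forall>V E H c r. finite_graph V E \<longrightarrow> session_set V H \<longrightarrow> (\<forall>e\<in>E. 0 \<le> c e) \<longrightarrow> (\<forall>h\<in>H. 0 \<le> r h) \<longrightarrow>
        (coding_achievable V E H c r \<longleftrightarrow> routing_achievable V E H c r))"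

section \<open>Irreducible cores and independence\<close>

definition reducible ::
  "vertex set \<Rightarrow> edge set \<Rightarrow> (edge \<Rightarrow> real) \<Rightarrow> session \<Rightarrow> session \<Rightarrow> bool" where
  "reducible V E w h1 h2 \<longleftrightarrow>
     (let d = wdist V E w; (s1, t1) = h1; (s2, t2) = h2 in
       (d s1 t1 + d s2 t2 \<le> d s1 t2 + d s2 t1 \<or>
        d s1 t1 + d s2 t2 \<le> d s1 s2 + d t1 t2) \<and>
       (s2, t2) \<noteq> (t1, s1))"

definition irreducible_core ::
  "vertex set \<Rightarrow> edge set \<Rightarrow> session set \<Rightarrow> (edge \<Rightarrow> real) \<Rightarrow> bool" where
  "irreducible_core V E H w \<longleftrightarrow>
     (\<forall>h1\<in>H. \<forall>h2\<in>H. h1 \<noteq> h2 \<longrightarrow> \<not> reducible V E w h1 h2)"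

definition coding_cost :: "edge set \<Rightarrow> (edge \<Rightarrow> real) \<Rightarrow> code \<Rightarrow> real" where
  "coding_cost E w C = (\<Sum>e\<in>E. w e * edge_flow (coding_flow C) e)"

definition min_cost_coding_solution ::
  "vertex set \<Rightarrow> edge set \<Rightarrow> session set \<Rightarrow> (session \<Rightarrow> real) \<Rightarrow> (edge \<Rightarrow> real) \<Rightarrow> code \<Rightarrow> bool" where
  "min_cost_coding_solution V E H r w C \<longleftrightarrow>
     coding_solution V E H r C \<and>
     (\<forall>C'. coding_solution V E H r C' \<longrightarrow> coding_cost E w C \<le> coding_cost E w C')"

definition independent_sessions ::
  "vertex set \<Rightarrow> edge set \<Rightarrow> session set \<Rightarrow> (session \<Rightarrow> real) \<Rightarrow> (edge \<Rightarrow> real) \<Rightarrow> bool" where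
  "independent_sessions V E H r w \<longleftrightarrow>
     (\<exists>C. min_cost_coding_solution V E H r w C \<and>
       (\<forall>i\<in>H. \<forall>j\<in>H. i \<noteq> j \<longrightarrow>
         (\<forall>e\<in>E. \<forall>a\<in>arcs_of e. \<forall>t<rounds C.
            cond_mi (Pr C) (symbol C a t) (message C i) (messages C (H - {i})) *
            cond_mi (Pr C) (symbol C a t) (message C j) (messages C (H - {j})) = 0)))"

text \<open>A positive demand between different components cannot be met by any coding solution, so
  that minimum-cost solutions only make sense for demands of the following kind.\<close>

definition connected_demands ::
  "vertex set \<Rightarrow> edge set \<Rightarrow> session set \<Rightarrow> (session \<Rightarrow> real) \<Rightarrow> bool" where
  "connected_demands V E H r \<longleftrightarrow>
     (\<forall>h\<in>H. 0 < r h \<longrightarrow> source h \<rightarrow>\<^sup>*\<^bsub>bidirected V E\<^esub> sink h)"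

end

(* Given weights, cutting a network at distance tau from the source and integrating over tau shows
   that the part of the traffic that depends on message i, given all other messages, costs at least
   r i * d(s i, t i). If no symbol mixes messages these parts add up to the total traffic, so an
   independent core satisfies the cost inequality dual to the multiple-unicast conjecture.

   An arbitrary instance is first embedded into the complete graph with its distances as weights.
   If two sessions satisfy d(s1,t1) + d(s2,t2) <= d(s1,t2) + d(s2,t1), then the metric extends by two
   points x, y such that both (s1,t1) and (s2,t2) lie on shortest paths from x to y. Extending the code
   along these paths costs no more than the distances of the sessions grow by, and merges the two
   sessions into (x,y); the other kind of reducibility is this one with (s2,t2) reversed. Induction on
   the number of unordered pairs of endpoints thus leads to an irreducible core. Linear programming
   duality turns the cost inequalities into a routing solution.

   Conversely, if coding does not help, routing all messages along shortest paths is a minimum-cost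
   coding solution, and it does not mix messages. *)

theory Submission
  imports Defs "HOL-Real_Asymp.Real_Asymp"
begin

text \<open>Independence is granted to one minimum-cost solution, while the cost inequality is
  needed for every solution; minimality carries the bound from the one to all others. It is also
  granted to irreducible cores only, and merging sessions changes the vertices, the distances, the
  sessions and the code at once. The inequality is therefore proved for all of these simultaneously,
  on complete graphs weighted by a finite pseudometric: there arc weights are already distances, so
  reducibility becomes an inequality between values of \<open>d\<close>, and new points can be
  attached freely. Distance zero between different vertices must be allowed because weights may
  vanish. Merging loses nothing because the joint message of the merged sessions has the sum of
  their entropies, by independence. In the other direction rates are arbitrary reals, so a code
  built from a path flow needs sources of every prescribed real entropy; the intermediate value
  theorem supplies them.\<close>

section \<open>Entropy of finite-valued variables\<close>

locale finite_source = prob_space P for P :: "nat measure"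
begin

sublocale information_space P 2
  by unfold_locales simp

abbreviation sf :: "(nat \<Rightarrow> 'x) \<Rightarrow> bool" where "sf X \<equiv> simple_function P X"

definition prb :: "(nat \<Rightarrow> 'x) \<Rightarrow> 'x \<Rightarrow> real" where
  "prb X x = prob (X -` {x} \<inter> space P)"

lemma function_of_refl: "function_of P X X"
  unfolding function_of_def by (rule exI[of _ id]) simp

lemma function_of_trans: "function_of P X Y \<Longrightarrow> function_of P Y Z \<Longrightarrow> function_of P X Z"
  unfolding function_of_def by (metis comp_apply)

lemma function_of_iff:
  "function_of P X Y \<longleftrightarrow> (\<forall>\<omega>\<in>space P. \<forall>\<omega>'\<in>space P. Y \<omega> = Y \<omega>' \<longrightarrow> X \<omega> = X \<omega>')"
proof
  assume "function_of P X Y"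
  then show "\<forall>\<omega>\<in>space P. \<forall>\<omega>'\<in>space P. Y \<omega> = Y \<omega>' \<longrightarrow> X \<omega> = X \<omega>'"
    unfolding function_of_def by (metis (no_types))
next
  assume *: "\<forall>\<omega>\<in>space P. \<forall>\<omega>'\<in>space P. Y \<omega> = Y \<omega>' \<longrightarrow> X \<omega> = X \<omega>'"
  show "function_of P X Y"
    unfolding function_of_def
  proof (intro exI ballI)
    fix \<omega> assume \<omega>: "\<omega> \<in> space P"
    then have "(SOME \<omega>'. \<omega>' \<in> space P \<and> Y \<omega>' = Y \<omega>) \<in> space P
        \<and> Y (SOME \<omega>'. \<omega>' \<in> space P \<and> Y \<omega>' = Y \<omega>) = Y \<omega>"
      by (intro someI[of "\<lambda>\<omega>'. \<omega>' \<in> space P \<and> Y \<omega>' = Y \<omega>" \<omega>]) simp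
    with * \<omega> show "X \<omega> = (\<lambda>y. X (SOME \<omega>'. \<omega>' \<in> space P \<and> Y \<omega>' = y)) (Y \<omega>)"
      by metis
  qed
qed

lemma sf_cong: "(\<And>\<omega>. \<omega> \<in> space P \<Longrightarrow> X \<omega> = Y \<omega>) \<Longrightarrow> sf X \<longleftrightarrow> sf Y"
  by (rule simple_function_cong)

lemma sf_function_of:
  assumes "sf Y" "function_of P X Y"
  shows "sf X"
proof -
  obtain \<phi> where \<phi>: "\<forall>\<omega>\<in>space P. X \<omega> = \<phi> (Y \<omega>)"
    using assms(2) by (auto simp: function_of_def)
  have "sf (\<phi> \<circ> Y)"
    using assms(1) by (rule simple_function_compose)
  then show ?thesis
    using \<phi> by (subst sf_cong[of X "\<phi> \<circ> Y"]) auto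
qed

lemma sf_pair: "sf X \<Longrightarrow> sf Y \<Longrightarrow> sf (\<lambda>\<omega>. (X \<omega>, Y \<omega>))"
  by (rule simple_function_Pair)

lemma sf_tuple:
  assumes "finite I" "\<And>i. i \<in> I \<Longrightarrow> sf (X i)"
  shows "sf (\<lambda>\<omega>. \<lambda>i\<in>I. X i \<omega>)"
  using assms
proof (induction I)
  case empty
  then show ?case by simp
next
  case (insert i I)
  have "sf (\<lambda>\<omega>. (X i \<omega>, \<lambda>i\<in>I. X i \<omega>))"
    by (intro sf_pair insert.IH insert.prems) simp_all
  then show ?case
  proof (rule sf_function_of)
    show "function_of P (\<lambda>\<omega>. \<lambda>i\<in>insert i I. X i \<omega>) (\<lambda>\<omega>. (X i \<omega>, \<lambda>i\<in>I. X i \<omega>))"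
      unfolding function_of_iff by (auto simp: fun_eq_iff restrict_def)
  qed
qed

text \<open>Supersets of the range are needed because the alphabet of a pair is a product, in
  general larger than the set of values of the pair. Outside the range \<open>prb X\<close>
  vanishes, so enlarging the alphabet is harmless.\<close>

lemma distributed_count_space_superset:
  assumes X: "sf X" and A: "finite A" "X ` space P \<subseteq> A"
  shows "distributed P (count_space A) X (\<lambda>x. ennreal (prb X x))"
proof -
  have "distributed P (count_space A) X (\<lambda>x. ennreal (if x \<in> X ` space P then prb X x else 0))"
    using assms by (intro distributed_simple_function_superset) (auto simp: prb_def)
  also have "(\<lambda>x. ennreal (if x \<in> X ` space P then prb X x else 0)) = (\<lambda>x. ennreal (prb X x))"
  proof
    fix x
    show "ennreal (if x \<in> X ` space P then prb X x else 0) = ennreal (prb X x)"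
    proof (cases "x \<in> X ` space P")
      case False
      then have "X -` {x} \<inter> space P = {}" by auto
      then show ?thesis using False by (simp add: prb_def)
    qed simp
  qed
  finally show ?thesis .
qed

text \<open>As an expectation over the sample space, the entropy no longer mentions the alphabet.
  Its independence of the alphabet and the additivity for independent variables are both read off
  from this form.\<close>

lemma entropy_superset_expectation:
  assumes X: "sf X" and A: "finite A" "X ` space P \<subseteq> A"
  shows "entropy 2 (count_space A) X = - expectation (\<lambda>\<omega>. log 2 (prb X (X \<omega>)))"
proof -
  note D = distributed_count_space_superset[OF assms]
  have "entropy 2 (count_space A) X = - (\<integral>x. prb X x * log 2 (prb X x) \<partial>count_space A)"
    by (rule entropy_distr[OF D]) (simp add: prb_def)
  also have "(\<integral>x. prb X x * log 2 (prb X x) \<partial>count_space A) = expectation (\<lambda>\<omega>. log 2 (prb X (X \<omega>)))"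
    by (rule distributed_integral[OF D]) (auto simp: prb_def)
  finally show ?thesis .
qed

lemma ent_expectation: "sf X \<Longrightarrow> ent P X = - expectation (\<lambda>\<omega>. log 2 (prb X (X \<omega>)))"
  by (intro entropy_superset_expectation) (auto dest: simple_functionD)

lemma entropy_superset:
  assumes "sf X" and "finite A" "X ` space P \<subseteq> A"
  shows "entropy 2 (count_space A) X = ent P X"
  using entropy_superset_expectation[OF assms] ent_expectation[OF assms(1)] by simp

lemma ent_mono:
  assumes Y: "sf Y" and XY: "function_of P X Y"
  shows "ent P X \<le> ent P Y"
proof -
  obtain \<phi> where \<phi>: "\<And>\<omega>. \<omega>\<in>space P \<Longrightarrow> X \<omega> = \<phi> (Y \<omega>)"
    using XY by (auto simp: function_of_def)
  have X: "sf X" using assms by (rule sf_function_of)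
  \<comment> \<open>The two variables agree only on \<open>space P\<close>, so the entropies are
    compared through the level sets inside that space.\<close>
  have "ent P X = ent P (\<phi> \<circ> Y)"
  proof -
    have "(\<phi> \<circ> Y) -` {x} \<inter> space P = X -` {x} \<inter> space P" for x
      using \<phi> by auto
    then have "prb X = prb (\<phi> \<circ> Y)"
      by (simp add: prb_def fun_eq_iff)
    moreover have "sf (\<phi> \<circ> Y)" using Y by (rule simple_function_compose)
    ultimately show ?thesis
      unfolding ent_expectation[OF X] ent_expectation[OF \<open>sf (\<phi> \<circ> Y)\<close>]
      using \<phi> by (simp cong: Bochner_Integration.integral_cong)
  qed
  also have "\<dots> \<le> ent P Y"
    using Y by (rule entropy_data_processing)
  finally show ?thesis .
qed

lemma ent_cong:
  "sf Y \<Longrightarrow> function_of P X Y \<Longrightarrow> function_of P Y X \<Longrightarrow> ent P X = ent P Y"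
  by (meson antisym ent_mono sf_function_of)

lemma ent_const:
  assumes "function_of P X (\<lambda>_. ())"
  shows "ent P X = 0"
proof -
  have X: "sf X" using assms by (rule sf_function_of[rotated]) simp
  have "prb X (X \<omega>) = 1" if "\<omega> \<in> space P" for \<omega>
  proof -
    have "X \<omega>' = X \<omega>" if "\<omega>' \<in> space P" for \<omega>'
      using assms that \<open>\<omega> \<in> space P\<close> unfolding function_of_iff by blast
    then have "X -` {X \<omega>} \<inter> space P = space P"
      by blast
    then show ?thesis by (simp add: prb_def prob_space)
  qed
  then show ?thesis
    by (simp add: ent_expectation[OF X] cong: Bochner_Integration.integral_cong)
qed

lemma ent_nonneg:
  assumes "sf X"
  shows "0 \<le> ent P X"
proof -
  have "ent P (\<lambda>_. ()) \<le> ent P X"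
    using assms by (rule ent_mono) (simp add: function_of_iff)
  moreover have "ent P (\<lambda>_. ()) = 0" by (rule ent_const) (rule function_of_refl)
  ultimately show ?thesis by linarith
qed

lemma mutual_information_count_space:
  assumes X: "sf X" and Y: "sf Y" and A: "finite A" "X ` space P \<subseteq> A"
    and B: "finite B" "Y ` space P \<subseteq> B"
  shows "mutual_information 2 (count_space A) (count_space B) X Y
    = ent P X + ent P Y - ent P (\<lambda>\<omega>. (X \<omega>, Y \<omega>))"
proof -
  have eq: "count_space A \<Otimes>\<^sub>M count_space B = count_space (A \<times> B)"
    using A B by (simp add: pair_measure_count_space)
  have XY: "distributed P (count_space (A \<times> B)) (\<lambda>\<omega>. (X \<omega>, Y \<omega>))
      (\<lambda>x. ennreal (prb (\<lambda>\<omega>. (X \<omega>, Y \<omega>)) x))"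
    using assms by (intro distributed_count_space_superset sf_pair) auto
  have "mutual_information 2 (count_space A) (count_space B) X Y
    = entropy 2 (count_space A) X + entropy 2 (count_space B) Y
      - entropy 2 (count_space A \<Otimes>\<^sub>M count_space B) (\<lambda>\<omega>. (X \<omega>, Y \<omega>))"
    by (rule mutual_information_eq_entropy_conditional_entropy_distr
        [OF _ _ distributed_count_space_superset[OF X A] _ distributed_count_space_superset[OF Y B] _
          XY[folded eq]])
      (use A B in \<open>auto simp: eq prb_def sigma_finite_measure_count_space_finite
          intro!: integrable_count_space\<close>)
  also have "entropy 2 (count_space A \<Otimes>\<^sub>M count_space B) (\<lambda>\<omega>. (X \<omega>, Y \<omega>)) = ent P (\<lambda>\<omega>. (X \<omega>, Y \<omega>))"
    unfolding eq using assms by (intro entropy_superset sf_pair) auto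
  finally show ?thesis
    using assms by (simp add: entropy_superset)
qed

lemma cond_mi_ent:
  assumes X: "sf X" and Y: "sf Y" and Z: "sf Z"
  shows "cond_mi P X Y Z = ent P (\<lambda>\<omega>. (X \<omega>, Z \<omega>)) + ent P (\<lambda>\<omega>. (Y \<omega>, Z \<omega>))
    - ent P Z - ent P (\<lambda>\<omega>. (X \<omega>, Y \<omega>, Z \<omega>))"
proof -
  note fin = simple_functionD(1)[OF X] simple_functionD(1)[OF Y] simple_functionD(1)[OF Z]
  have eq: "count_space (Y ` space P) \<Otimes>\<^sub>M count_space (Z ` space P) = count_space (Y ` space P \<times> Z ` space P)"
    using fin by (simp add: pair_measure_count_space)
  have "mutual_information 2 (count_space (X ` space P))
      (count_space (Y ` space P) \<Otimes>\<^sub>M count_space (Z ` space P)) X (\<lambda>\<omega>. (Y \<omega>, Z \<omega>))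
    = ent P X + ent P (\<lambda>\<omega>. (Y \<omega>, Z \<omega>)) - ent P (\<lambda>\<omega>. (X \<omega>, Y \<omega>, Z \<omega>))"
    unfolding eq using fin X Y Z by (intro mutual_information_count_space sf_pair) auto
  moreover have "mutual_information 2 (count_space (X ` space P)) (count_space (Z ` space P)) X Z
    = ent P X + ent P Z - ent P (\<lambda>\<omega>. (X \<omega>, Z \<omega>))"
    using fin X Z by (intro mutual_information_count_space) auto
  ultimately show ?thesis
    unfolding conditional_mutual_information_def by simp
qed

text \<open>Non-negativity of conditional mutual information, spelled out in joint entropies.
  Subadditivity and the estimates for conditional entropy are derived from it.\<close>

lemma ent_submodular:
  assumes "sf X" "sf Y" "sf Z"
  shows "ent P (\<lambda>\<omega>. (X \<omega>, Y \<omega>, Z \<omega>)) + ent P Z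
    \<le> ent P (\<lambda>\<omega>. (X \<omega>, Z \<omega>)) + ent P (\<lambda>\<omega>. (Y \<omega>, Z \<omega>))"
  using conditional_mutual_information_nonneg[OF assms] cond_mi_ent[OF assms] by simp

lemma ent_pair_le:
  assumes "sf X" "sf Y"
  shows "ent P (\<lambda>\<omega>. (X \<omega>, Y \<omega>)) \<le> ent P X + ent P Y"
proof -
  have "ent P (\<lambda>\<omega>. (X \<omega>, Y \<omega>, ())) + ent P (\<lambda>_. ()) \<le> ent P (\<lambda>\<omega>. (X \<omega>, ())) + ent P (\<lambda>\<omega>. (Y \<omega>, ()))"
    using assms by (intro ent_submodular) auto
  moreover have "ent P (\<lambda>\<omega>. (X \<omega>, Y \<omega>, ())) = ent P (\<lambda>\<omega>. (X \<omega>, Y \<omega>))"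
    using assms by (intro ent_cong sf_pair) (auto simp: function_of_iff)
  moreover have "ent P (\<lambda>\<omega>. (X \<omega>, ())) = ent P X" "ent P (\<lambda>\<omega>. (Y \<omega>, ())) = ent P Y"
    using assms by (auto intro!: ent_cong simp: function_of_iff)
  moreover have "ent P (\<lambda>_. ()) = 0" by (rule ent_const) (rule function_of_refl)
  ultimately show ?thesis by linarith
qed

lemma ent_tuple_le:
  assumes "finite I" "\<And>i. i \<in> I \<Longrightarrow> sf (X i)"
  shows "ent P (\<lambda>\<omega>. \<lambda>i\<in>I. X i \<omega>) \<le> (\<Sum>i\<in>I. ent P (X i))"
  using assms
proof (induction I)
  case empty
  show ?case by (subst ent_const) (simp_all add: function_of_iff restrict_def)
next
  case (insert i I)
  have sf: "sf (X i)" "sf (\<lambda>\<omega>. \<lambda>i\<in>I. X i \<omega>)"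
    using insert by (auto intro: sf_tuple)
  have "ent P (\<lambda>\<omega>. \<lambda>i\<in>insert i I. X i \<omega>) \<le> ent P (\<lambda>\<omega>. (X i \<omega>, \<lambda>i\<in>I. X i \<omega>))"
    using sf by (intro ent_mono sf_pair) (auto simp: function_of_iff fun_eq_iff restrict_def)
  also have "\<dots> \<le> ent P (X i) + ent P (\<lambda>\<omega>. \<lambda>i\<in>I. X i \<omega>)"
    using sf by (rule ent_pair_le)
  also have "\<dots> \<le> ent P (X i) + (\<Sum>i\<in>I. ent P (X i))"
    by (intro add_left_mono insert.IH insert.prems) simp
  also have "\<dots> = (\<Sum>i\<in>insert i I. ent P (X i))"
    by (rule sum.insert[OF insert.hyps, symmetric])
  finally show ?case .
qed

text \<open>The finitely many values of probability zero form a null event. This is what permits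
  splitting the logarithm of a product of probabilities below.\<close>

lemma AE_prb_pos:
  assumes X: "sf X"
  shows "AE \<omega> in P. 0 < prb X (X \<omega>)"
proof -
  have fin: "finite (X ` space P)" and meas: "\<And>x. X -` {x} \<inter> space P \<in> sets P"
    using X by (auto dest: simple_functionD)
  have "AE \<omega> in P. \<forall>x\<in>{x \<in> X ` space P. prb X x = 0}. \<omega> \<notin> X -` {x} \<inter> space P"
  proof (rule AE_finite_allI)
    fix x assume "x \<in> {x \<in> X ` space P. prb X x = 0}"
    then have "X -` {x} \<inter> space P \<in> null_sets P"
      using meas by (auto simp: prb_def null_sets_def emeasure_eq_measure)
    then show "AE \<omega> in P. \<omega> \<notin> X -` {x} \<inter> space P"
      by (rule AE_not_in)
  qed (use fin in auto)
  then show ?thesis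
    using AE_space
  proof eventually_elim
    case (elim \<omega>)
    then have "prb X (X \<omega>) \<noteq> 0" by auto
    then show ?case by (simp add: prb_def zero_less_measure_iff)
  qed
qed

lemma integrable_sf:
  assumes "sf X"
  shows "integrable P (\<lambda>\<omega>. g (X \<omega>) :: real)"
proof (rule integrable_simple_function)
  show "sf (\<lambda>\<omega>. g (X \<omega>))"
    using simple_function_compose[OF assms, of g] by (simp add: comp_def)
qed simp

lemma ent_tuple_indep:
  assumes fin: "finite I" and sf: "\<And>i. i \<in> I \<Longrightarrow> sf (X i)"
    and ind: "indep_vars (\<lambda>_. count_space UNIV) X I"
  shows "ent P (\<lambda>\<omega>. \<lambda>i\<in>I. X i \<omega>) = (\<Sum>i\<in>I. ent P (X i))"
proof (cases "I = {}")
  case True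
  show ?thesis unfolding True by (subst ent_const) (simp_all add: function_of_iff restrict_def)
next
  case False
  let ?T = "\<lambda>\<omega>. \<lambda>i\<in>I. X i \<omega>"
  have prod: "prb ?T (?T \<omega>) = (\<Prod>i\<in>I. prb (X i) (X i \<omega>))" for \<omega>
  proof -
    have "?T -` {?T \<omega>} \<inter> space P = (\<Inter>i\<in>I. X i -` {X i \<omega>} \<inter> space P)"
      using False by (auto simp: fun_eq_iff restrict_def) metis
    then show ?thesis
      unfolding prb_def
      using indep_varsD_finite[OF ind False fin, of "\<lambda>i. {X i \<omega>}"] by simp
  qed
  have "AE \<omega> in P. \<forall>i\<in>I. 0 < prb (X i) (X i \<omega>)"
    using fin sf by (intro AE_finite_allI AE_prb_pos)
  then have "AE \<omega> in P. log 2 (prb ?T (?T \<omega>)) = (\<Sum>i\<in>I. log 2 (prb (X i) (X i \<omega>)))"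
  proof eventually_elim
    case (elim \<omega>)
    have "ln (\<Prod>i\<in>I. prb (X i) (X i \<omega>)) = (\<Sum>i\<in>I. ln (prb (X i) (X i \<omega>)))"
      using elim fin by (intro ln_prod) auto
    then show ?case
      by (simp add: prod log_def sum_divide_distrib)
  qed
  then have "expectation (\<lambda>\<omega>. log 2 (prb ?T (?T \<omega>)))
      = expectation (\<lambda>\<omega>. \<Sum>i\<in>I. log 2 (prb (X i) (X i \<omega>)))"
    by (rule integral_cong_AE[rotated 2])
      (rule borel_measurable_integrable,
        rule integrable_sf[OF sf_tuple[OF fin sf], where g = "\<lambda>x. log 2 (prb ?T x)"],
       assumption, rule borel_measurable_integrable,
       intro Bochner_Integration.integrable_sum integrable_sf sf)
  also have "\<dots> = (\<Sum>i\<in>I. expectation (\<lambda>\<omega>. log 2 (prb (X i) (X i \<omega>))))"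
    using sf by (intro Bochner_Integration.integral_sum integrable_sf)
  finally show ?thesis
    by (simp only: ent_expectation[OF sf_tuple[OF fin sf]] sum_negf[symmetric]
        ent_expectation[OF sf] cong: sum.cong)
qed

end

section \<open>Networks and codes\<close>

abbreviation arcset :: "edge set \<Rightarrow> arc set" where
  "arcset E \<equiv> {(u, v). {u, v} \<in> E}"

lemma arcs_bidirected [simp]: "arcs (bidirected V E) = arcset E"
  by (auto simp: bidirected_def arcs_of_def)

lemma arcs_of_subset: "e \<in> E \<Longrightarrow> arcs_of e \<subseteq> arcset E"
  by (auto simp: arcs_of_def)

lemma finite_graph_edges: "finite_graph V E \<Longrightarrow> finite E"
  unfolding finite_graph_def by (rule finite_subset[of E "Pow V"]) auto

lemma arcset_in_verts:
  assumes "finite_graph V E" "(u, v) \<in> arcset E"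
  shows "u \<in> V" "v \<in> V" "u \<noteq> v"
  using assms by (auto simp: finite_graph_def)

lemma finite_arcset: "finite_graph V E \<Longrightarrow> finite (arcset E)"
  by (rule finite_subset[of _ "V \<times> V"]) (auto dest: arcset_in_verts simp: finite_graph_def)

lemma sum_edge_flow:
  assumes "finite_graph V E"
  shows "(\<Sum>e\<in>E. w e * edge_flow f e) = (\<Sum>(u, v)\<in>arcset E. w {u, v} * f (u, v))"
proof -
  have "(\<Sum>e\<in>E. w e * edge_flow f e) = (\<Sum>e\<in>E. \<Sum>a\<in>arcs_of e. w {fst a, snd a} * f a)"
    by (intro sum.cong refl) (auto simp: edge_flow_def sum_distrib_left arcs_of_def intro!: sum.cong)
  also have "\<dots> = sum (\<lambda>a. w {fst a, snd a} * f a) (\<Union>e\<in>E. arcs_of e)"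
  proof (rule sum.UNION_disjoint[symmetric])
    show "finite E" using assms by (rule finite_graph_edges)
    show "\<forall>e\<in>E. finite (arcs_of e)"
      using assms finite_arcset arcs_of_subset by (meson finite_subset)
    show "\<forall>i\<in>E. \<forall>j\<in>E. i \<noteq> j \<longrightarrow> arcs_of i \<inter> arcs_of j = {}"
      by (auto simp: arcs_of_def)
  qed
  also have "(\<Union>e\<in>E. arcs_of e) = arcset E"
    by (auto simp: arcs_of_def)
  finally show ?thesis
    by (simp add: case_prod_unfold)
qed

text \<open>An arc crosses the cut at level \<open>\<tau>\<close> exactly when \<open>\<tau>\<close>
  lies in the half-open interval between the potentials of its tail and head. Exchanging the
  integral over \<open>\<tau>\<close> with the sum over arcs replaces each indicator by the length
  of its interval, the positive part of the potential difference.\<close>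

lemma layer_cake:
  fixes F :: "arc \<Rightarrow> real" and \<pi> :: "vertex \<Rightarrow> real"
  assumes "finite A" and F: "\<And>a. a \<in> A \<Longrightarrow> 0 \<le> F a" and st: "\<pi> s \<le> \<pi> t"
    and cut: "\<And>\<tau>. \<pi> s \<le> \<tau> \<Longrightarrow> \<tau> < \<pi> t \<Longrightarrow> Q \<le> (\<Sum>a | a \<in> A \<and> \<pi> (fst a) \<le> \<tau> \<and> \<tau> < \<pi> (snd a). F a)"
  shows "Q * (\<pi> t - \<pi> s) \<le> (\<Sum>a\<in>A. F a * max 0 (\<pi> (snd a) - \<pi> (fst a)))"
proof -
  have int: "integrable lborel (indicator {x..<y} :: real \<Rightarrow> real)" for x y :: real
    by (cases "x \<le> y") (auto intro!: integrable_real_indicator)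
  have val: "(\<integral>\<tau>. indicator {x..<y} \<tau> \<partial>lborel) = max 0 (y - x)" for x y :: real
    by (cases "x \<le> y") auto
  have "Q * (\<pi> t - \<pi> s) = (\<integral>\<tau>. Q * indicator {\<pi> s..<\<pi> t} \<tau> \<partial>lborel)"
    using st by (simp add: val)
  also have "\<dots> \<le> (\<integral>\<tau>. (\<Sum>a\<in>A. F a * indicator {\<pi> (fst a)..<\<pi> (snd a)} \<tau>) \<partial>lborel)"
  proof (rule integral_mono)
    fix \<tau> :: real
    have eq: "(\<Sum>a\<in>A. F a * indicator {\<pi> (fst a)..<\<pi> (snd a)} \<tau>)
      = (\<Sum>a | a \<in> A \<and> \<pi> (fst a) \<le> \<tau> \<and> \<tau> < \<pi> (snd a). F a)"
      using \<open>finite A\<close> by (intro sum.mono_neutral_cong_right) (auto simp: indicator_def)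
    show "Q * indicator {\<pi> s..<\<pi> t} \<tau> \<le> (\<Sum>a\<in>A. F a * indicator {\<pi> (fst a)..<\<pi> (snd a)} \<tau>)"
    proof (cases "\<tau> \<in> {\<pi> s..<\<pi> t}")
      case True
      then show ?thesis unfolding eq using cut[of \<tau>] by simp
    next
      case False
      then show ?thesis unfolding eq using F by (auto intro!: sum_nonneg)
    qed
  qed (intro integrable_mult_right int Bochner_Integration.integrable_sum)+
  also have "\<dots> = (\<Sum>a\<in>A. F a * max 0 (\<pi> (snd a) - \<pi> (fst a)))"
    by (subst Bochner_Integration.integral_sum) (intro integrable_mult_right int, simp only: integral_mult_right_zero val)
  finally show ?thesis .
qed

text \<open>A pseudometric on \<open>V\<close>; nothing is said about vertices outside
  \<open>V\<close>, so that points can be added later.\<close>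

definition pmetric :: "vertex set \<Rightarrow> (vertex \<Rightarrow> vertex \<Rightarrow> real) \<Rightarrow> bool" where
  "pmetric V d \<longleftrightarrow> (\<forall>u\<in>V. d u u = 0) \<and> (\<forall>u\<in>V. \<forall>v\<in>V. d u v = d v u) \<and>
     (\<forall>u\<in>V. \<forall>v\<in>V. \<forall>w\<in>V. d u w \<le> d u v + d v w)"

lemma pmetricD:
  assumes "pmetric V d"
  shows pmetric_refl: "u \<in> V \<Longrightarrow> d u u = 0"
    and pmetric_sym: "u \<in> V \<Longrightarrow> v \<in> V \<Longrightarrow> d u v = d v u"
    and pmetric_triangle: "u \<in> V \<Longrightarrow> v \<in> V \<Longrightarrow> w \<in> V \<Longrightarrow> d u w \<le> d u v + d v w"
  using assms by (auto simp: pmetric_def)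

lemma pmetric_nonneg:
  assumes "pmetric V d" "u \<in> V" "v \<in> V"
  shows "0 \<le> d u v"
  using pmetric_triangle[OF assms(1), of u v u] pmetric_refl[OF assms(1), of u]
    pmetric_sym[OF assms(1), of u v] assms by simp

section \<open>Conditional entropy\<close>

context finite_source
begin

text \<open>The conditional entropy H(X | Z), defined through the chain rule so that only
  unconditional entropies have to be handled.\<close>

definition cent :: "(nat \<Rightarrow> 'x) \<Rightarrow> (nat \<Rightarrow> 'z) \<Rightarrow> real" where
  "cent X Z = ent P (\<lambda>\<omega>. (X \<omega>, Z \<omega>)) - ent P Z"

lemma cent_nonneg: "sf X \<Longrightarrow> sf Z \<Longrightarrow> 0 \<le> cent X Z"
  unfolding cent_def diff_ge_0_iff_ge by (intro ent_mono sf_pair) (auto simp: function_of_iff)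

lemma cent_pair_le:
  assumes "sf X" "sf Y" "sf Z"
  shows "cent (\<lambda>\<omega>. (X \<omega>, Y \<omega>)) Z \<le> cent X Z + cent Y Z"
proof -
  have "ent P (\<lambda>\<omega>. ((X \<omega>, Y \<omega>), Z \<omega>)) = ent P (\<lambda>\<omega>. (X \<omega>, Y \<omega>, Z \<omega>))"
    using assms by (intro ent_cong sf_pair) (auto simp: function_of_iff)
  then show ?thesis
    using ent_submodular[OF assms] unfolding cent_def by linarith
qed

lemma cent_mono:
  assumes "sf Y" "sf Z" "function_of P X (\<lambda>\<omega>. (Y \<omega>, Z \<omega>))"
  shows "cent X Z \<le> cent Y Z"
proof -
  have "function_of P (\<lambda>\<omega>. (X \<omega>, Z \<omega>)) (\<lambda>\<omega>. (Y \<omega>, Z \<omega>))"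
    using assms(3) unfolding function_of_iff prod.inject by blast
  then have "ent P (\<lambda>\<omega>. (X \<omega>, Z \<omega>)) \<le> ent P (\<lambda>\<omega>. (Y \<omega>, Z \<omega>))"
    using assms(1,2) by (intro ent_mono sf_pair)
  then show ?thesis by (simp add: cent_def)
qed

lemma cent_tuple_le:
  assumes "finite I" "\<And>i. i \<in> I \<Longrightarrow> sf (X i)" and Z: "sf Z"
  shows "cent (\<lambda>\<omega>. \<lambda>i\<in>I. X i \<omega>) Z \<le> (\<Sum>i\<in>I. cent (X i) Z)"
  using assms(1,2)
proof (induction I)
  case empty
  have "cent (\<lambda>\<omega>. \<lambda>i\<in>{}. X i \<omega>) Z = (\<Sum>i\<in>{}. cent (X i) Z)"
    unfolding cent_def sum.empty using Z
    by (subst ent_cong[of Z "\<lambda>\<omega>. (\<lambda>i\<in>{}. X i \<omega>, Z \<omega>)"]) (auto simp: function_of_iff restrict_def)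
  then show ?case by (rule eq_refl)
next
  case (insert i I)
  have sf: "sf (X i)" "sf (\<lambda>\<omega>. \<lambda>i\<in>I. X i \<omega>)"
    using insert by (auto intro: sf_tuple)
  have "cent (\<lambda>\<omega>. \<lambda>i\<in>insert i I. X i \<omega>) Z \<le> cent (\<lambda>\<omega>. (X i \<omega>, \<lambda>i\<in>I. X i \<omega>)) Z"
    using sf Z by (intro cent_mono sf_pair) (auto simp: function_of_iff fun_eq_iff restrict_def)
  also have "\<dots> \<le> cent (X i) Z + cent (\<lambda>\<omega>. \<lambda>i\<in>I. X i \<omega>) Z"
    using sf Z by (rule cent_pair_le)
  also have "\<dots> \<le> cent (X i) Z + (\<Sum>i\<in>I. cent (X i) Z)"
    by (intro add_left_mono insert.IH insert.prems) simp
  also have "\<dots> = (\<Sum>i\<in>insert i I. cent (X i) Z)"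
    by (rule sum.insert[OF insert.hyps, symmetric])
  finally show ?case .
qed

text \<open>The right-hand side is H(X | Y). Since H(Y | Z) = 0, \<open>Z\<close> knows at least as
  much as \<open>Y\<close>, and conditioning on more lowers the entropy.\<close>

lemma cent_le_ent_diff:
  assumes "sf X" "sf Y" "sf Z" and "cent Y Z = 0"
  shows "cent X Z \<le> ent P (\<lambda>\<omega>. (X \<omega>, Y \<omega>)) - ent P Y"
proof -
  have "ent P (\<lambda>\<omega>. (X \<omega>, Z \<omega>, Y \<omega>)) + ent P Y \<le> ent P (\<lambda>\<omega>. (X \<omega>, Y \<omega>)) + ent P (\<lambda>\<omega>. (Z \<omega>, Y \<omega>))"
    using assms by (intro ent_submodular)
  moreover have "ent P (\<lambda>\<omega>. (X \<omega>, Z \<omega>)) \<le> ent P (\<lambda>\<omega>. (X \<omega>, Z \<omega>, Y \<omega>))"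
    using assms by (intro ent_mono sf_pair) (auto simp: function_of_iff)
  moreover have "ent P (\<lambda>\<omega>. (Z \<omega>, Y \<omega>)) = ent P (\<lambda>\<omega>. (Y \<omega>, Z \<omega>))"
    using assms by (intro ent_cong sf_pair) (auto simp: function_of_iff)
  ultimately show ?thesis
    using assms(4) unfolding cent_def by linarith
qed

end

section \<open>Cuts, and the traffic caused by a single message\<close>

locale coded_network =
  fixes V :: "vertex set" and E :: "edge set" and H :: "session set" and r :: "session \<Rightarrow> real"
    and C :: code
  assumes graph: "finite_graph V E" and sessions: "session_set V H"
    and solution: "coding_solution V E H r C"
begin

sublocale finite_source "Pr C"
  using solution by (simp add: coding_solution_def finite_source_def)

lemma finite_sessions: "finite H"
  using sessions by (simp add: session_set_def)

lemma blocklength_pos: "0 < real (blocklength C)"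
  using solution by (simp add: coding_solution_def)

lemma ent_message: "h \<in> H \<Longrightarrow> ent (Pr C) (message C h) = r h * blocklength C"
  using solution blocklength_pos unfolding coding_solution_def
  by (metis nonzero_divide_eq_eq less_irrefl)

lemma sf_message: "h \<in> H \<Longrightarrow> sf (message C h)"
  using solution by (simp add: coding_solution_def)

lemma sf_messages: "S \<subseteq> H \<Longrightarrow> sf (messages C S)"
  unfolding messages_def
  using sf_message finite_sessions by (intro sf_tuple) (auto dest: finite_subset)

lemma rate_nonneg: "h \<in> H \<Longrightarrow> 0 \<le> r h"
  using ent_message[of h] ent_nonneg[OF sf_message, of h] blocklength_pos
  by (metis mult_less_0_iff not_less)

lemma symbol_function_of_knowledge:
  "a \<in> arcset E \<Longrightarrow> t < rounds C \<Longrightarrow> function_of (Pr C) (symbol C a t) (knowledge V E H C (fst a) t)"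
  using solution by (cases a) (simp add: coding_solution_def)

lemma message_function_of_knowledge:
  "h \<in> H \<Longrightarrow> function_of (Pr C) (message C h) (knowledge V E H C (sink h) (rounds C))"
  using solution by (simp add: coding_solution_def)

lemma knowledge_eqI:
  assumes "\<And>h. h \<in> H \<Longrightarrow> source h = v \<Longrightarrow> message C h \<omega> = message C h \<omega>'"
    and "\<And>u s. (u, v) \<in> arcset E \<Longrightarrow> s < t \<Longrightarrow> symbol C (u, v) s \<omega> = symbol C (u, v) s \<omega>'"
  shows "knowledge V E H C v t \<omega> = knowledge V E H C v t \<omega>'"
  using assms by (auto simp: knowledge_def messages_def fun_eq_iff restrict_def)

text \<open>Causality, by induction on the round: a vertex of \<open>W\<close> knows messages
  generated in \<open>W\<close>, symbols that entered \<open>W\<close>, and earlier symbols sent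
  inside \<open>W\<close>. What enters \<open>W\<close> together with the messages born there thus
  determines everything sent from \<open>W\<close>.\<close>

lemma symbol_eq_if_cut_eq:
  assumes \<omega>: "\<omega> \<in> space (Pr C)" "\<omega>' \<in> space (Pr C)"
    and msg: "\<And>h. h \<in> H \<Longrightarrow> source h \<in> W \<Longrightarrow> message C h \<omega> = message C h \<omega>'"
    and cut: "\<And>u v s. (u, v) \<in> arcset E \<Longrightarrow> u \<notin> W \<Longrightarrow> v \<in> W \<Longrightarrow> s < rounds C \<Longrightarrow>
      symbol C (u, v) s \<omega> = symbol C (u, v) s \<omega>'"
  shows "a \<in> arcset E \<Longrightarrow> fst a \<in> W \<Longrightarrow> t < rounds C \<Longrightarrow> symbol C a t \<omega> = symbol C a t \<omega>'"
proof (induction t arbitrary: a rule: less_induct)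
  case (less t)
  have "knowledge V E H C (fst a) t \<omega> = knowledge V E H C (fst a) t \<omega>'"
  proof (rule knowledge_eqI)
    fix u s assume "(u, fst a) \<in> arcset E" "s < t"
    then show "symbol C (u, fst a) s \<omega> = symbol C (u, fst a) s \<omega>'"
      using less by (cases "u \<in> W") (auto intro!: cut)
  qed (use less msg in auto)
  then show ?case
    using symbol_function_of_knowledge[of a t] less \<omega> unfolding function_of_iff by blast
qed

lemma message_eq_if_cut_eq:
  assumes \<omega>: "\<omega> \<in> space (Pr C)" "\<omega>' \<in> space (Pr C)"
    and msg: "\<And>h. h \<in> H \<Longrightarrow> source h \<in> W \<Longrightarrow> message C h \<omega> = message C h \<omega>'"
    and cut: "\<And>u v s. (u, v) \<in> arcset E \<Longrightarrow> u \<notin> W \<Longrightarrow> v \<in> W \<Longrightarrow> s < rounds C \<Longrightarrow>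
      symbol C (u, v) s \<omega> = symbol C (u, v) s \<omega>'"
    and h: "h \<in> H" "sink h \<in> W"
  shows "message C h \<omega> = message C h \<omega>'"
proof -
  have "knowledge V E H C (sink h) (rounds C) \<omega> = knowledge V E H C (sink h) (rounds C) \<omega>'"
  proof (rule knowledge_eqI)
    fix u s assume "(u, sink h) \<in> arcset E" "s < rounds C"
    then show "symbol C (u, sink h) s \<omega> = symbol C (u, sink h) s \<omega>'"
      using h cut symbol_eq_if_cut_eq[OF \<omega> msg cut, where a = "(u, sink h)" and t = s] by (cases "u \<in> W") auto
  qed (use h msg in auto)
  then show ?thesis
    using message_function_of_knowledge[OF h(1)] \<omega> unfolding function_of_iff by blast
qed

lemma symbol_function_of_messages:
  assumes "a \<in> arcset E" "t < rounds C"
  shows "function_of (Pr C) (symbol C a t) (messages C H)"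
  unfolding function_of_iff
proof (intro ballI impI)
  fix \<omega> \<omega>' assume \<omega>: "\<omega> \<in> space (Pr C)" "\<omega>' \<in> space (Pr C)" and eq: "messages C H \<omega> = messages C H \<omega>'"
  have "message C h \<omega> = message C h \<omega>'" if "h \<in> H" for h
    using fun_cong[OF eq, of h] that by (simp add: messages_def)
  \<comment> \<open>No arc enters \<open>UNIV\<close>, so the messages alone determine all
    symbols.\<close>
  then show "symbol C a t \<omega> = symbol C a t \<omega>'"
    using symbol_eq_if_cut_eq[OF \<omega>, of UNIV a t] assms by auto
qed

lemma sf_symbol: "a \<in> arcset E \<Longrightarrow> t < rounds C \<Longrightarrow> sf (symbol C a t)"
  using sf_messages[OF order_refl] symbol_function_of_messages by (rule sf_function_of)

lemma transmission_eq_iff: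
  "transmission C a \<omega> = transmission C a \<omega>' \<longleftrightarrow> (\<forall>t<rounds C. symbol C a t \<omega> = symbol C a t \<omega>')"
  by (auto simp: transmission_def)

lemma sf_transmission:
  assumes "a \<in> arcset E"
  shows "sf (transmission C a)"
proof (rule sf_function_of)
  show "sf (\<lambda>\<omega>. \<lambda>t\<in>{..<rounds C}. symbol C a t \<omega>)"
    using assms sf_symbol by (intro sf_tuple) auto
  show "function_of (Pr C) (transmission C a) (\<lambda>\<omega>. \<lambda>t\<in>{..<rounds C}. symbol C a t \<omega>)"
    by (auto simp: function_of_iff transmission_eq_iff fun_eq_iff restrict_def)
qed

lemma coding_flow_nonneg: "a \<in> arcset E \<Longrightarrow> 0 \<le> coding_flow C a"
  unfolding coding_flow_def using ent_nonneg[OF sf_transmission] by simp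

lemma indep_messages: "indep_vars (\<lambda>_. count_space UNIV) (message C) H"
  using solution by (simp add: coding_solution_def)

lemma ent_messages: "S \<subseteq> H \<Longrightarrow> ent (Pr C) (messages C S) = (\<Sum>h\<in>S. ent (Pr C) (message C h))"
  unfolding messages_def[abs_def] using sf_message finite_sessions indep_messages
  by (intro ent_tuple_indep) (auto dest: finite_subset indep_vars_subset)

text \<open>The uncertainty left on arc \<open>a\<close> when all messages but that of
  \<open>h\<close> are known. Since the messages determine every symbol, this is the information
  that \<open>a\<close> carries about message \<open>h\<close>. It is measured per block, not per
  unit of time.\<close>

definition load :: "session \<Rightarrow> arc \<Rightarrow> real" where
  "load h a = cent (transmission C a) (messages C (H - {h}))"

lemma load_nonneg: "a \<in> arcset E \<Longrightarrow> 0 \<le> load h a"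
  unfolding load_def by (intro cent_nonneg sf_transmission sf_messages) auto

text \<open>The symbols crossing into \<open>W\<close> and the other messages together determine
  message \<open>h\<close>, hence all messages. As the messages are independent, the entropy of the
  other ones can be subtracted from both sides, and what remains is subadditive over the arcs of the
  cut.\<close>

lemma cut_bound:
  assumes h: "h \<in> H" and W: "source h \<notin> W" "sink h \<in> W"
  shows "ent (Pr C) (message C h) \<le> (\<Sum>a | a \<in> arcset E \<and> fst a \<notin> W \<and> snd a \<in> W. load h a)"
proof -
  define D where "D = {a. a \<in> arcset E \<and> fst a \<notin> W \<and> snd a \<in> W}"
  have D: "finite D" "D \<subseteq> arcset E"
    using finite_subset[OF _ finite_arcset[OF graph]] by (auto simp: D_def)
  let ?T = "\<lambda>\<omega>. \<lambda>a\<in>D. transmission C a \<omega>" and ?Z = "messages C (H - {h})"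
  have sfT: "sf ?T" and sfZ: "sf ?Z"
    using D by (auto intro!: sf_tuple sf_transmission sf_messages)
  have "function_of (Pr C) (messages C H) (\<lambda>\<omega>. (?T \<omega>, ?Z \<omega>))"
    unfolding function_of_iff
  proof (intro ballI impI)
    fix \<omega> \<omega>' assume \<omega>: "\<omega> \<in> space (Pr C)" "\<omega>' \<in> space (Pr C)" and eq: "(?T \<omega>, ?Z \<omega>) = (?T \<omega>', ?Z \<omega>')"
    have T: "transmission C a \<omega> = transmission C a \<omega>'" if "a \<in> D" for a
      using eq that unfolding prod.inject by (metis restrict_apply')
    have Z: "message C j \<omega> = message C j \<omega>'" if "j \<in> H" "j \<noteq> h" for j
      using eq that unfolding prod.inject messages_def by (metis restrict_apply' Diff_iff singletonD)
    have "message C h \<omega> = message C h \<omega>'"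
    proof (rule message_eq_if_cut_eq[OF \<omega>, of W])
      fix u v s assume "(u, v) \<in> arcset E" "u \<notin> W" "v \<in> W" "s < rounds C"
      then show "symbol C (u, v) s \<omega> = symbol C (u, v) s \<omega>'"
        using T[of "(u, v)"] by (auto simp: D_def transmission_eq_iff)
    qed (use Z h W in auto)
    then show "messages C H \<omega> = messages C H \<omega>'"
      using Z by (auto simp: messages_def fun_eq_iff restrict_def)
  qed
  then have "ent (Pr C) (messages C H) \<le> ent (Pr C) (\<lambda>\<omega>. (?T \<omega>, ?Z \<omega>))"
    using sfT sfZ by (intro ent_mono sf_pair)
  moreover have "ent (Pr C) (messages C H) = ent (Pr C) (message C h) + ent (Pr C) ?Z"
    using h finite_sessions by (simp add: ent_messages sum.remove)
  ultimately have "ent (Pr C) (message C h) \<le> cent ?T ?Z"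
    by (simp add: cent_def)
  also have "\<dots> \<le> (\<Sum>a\<in>D. load h a)"
    unfolding load_def using D sfZ by (intro cent_tuple_le sf_transmission) auto
  finally show ?thesis by (simp add: D_def)
qed

lemma load_cost_bound:
  assumes d: "pmetric V d" and h: "h \<in> H"
  shows "ent (Pr C) (message C h) * d (source h) (sink h) \<le> (\<Sum>(u, v)\<in>arcset E. d u v * load h (u, v))"
proof -
  let ?s = "source h" and ?t = "sink h"
  have st: "?s \<in> V" "?t \<in> V"
    using sessions h by (auto simp: session_set_def)
  have "ent (Pr C) (message C h) * (d ?s ?t - d ?s ?s)
    \<le> (\<Sum>a\<in>arcset E. load h a * max 0 (d ?s (snd a) - d ?s (fst a)))"
  proof (rule layer_cake)
    fix \<tau> assume "d ?s ?s \<le> \<tau>" "\<tau> < d ?s ?t"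
    then show "ent (Pr C) (message C h)
        \<le> (\<Sum>a | a \<in> arcset E \<and> d ?s (fst a) \<le> \<tau> \<and> \<tau> < d ?s (snd a). load h a)"
      using cut_bound[OF h, of "{v. \<tau> < d ?s v}"] by (simp add: not_less)
  qed (use finite_arcset[OF graph] load_nonneg pmetric_nonneg[OF d] pmetric_refl[OF d] st in auto)
  also have "\<dots> \<le> (\<Sum>a\<in>arcset E. load h a * d (fst a) (snd a))"
  proof (intro sum_mono mult_left_mono)
    fix a assume "a \<in> arcset E"
    then have "fst a \<in> V" "snd a \<in> V"
      using arcset_in_verts[OF graph, of "fst a" "snd a"] by auto
    then show "max 0 (d ?s (snd a) - d ?s (fst a)) \<le> d (fst a) (snd a)"
      using pmetric_triangle[OF d st(1), of "fst a" "snd a"] pmetric_nonneg[OF d] by auto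
  qed (rule load_nonneg)
  finally show ?thesis
    using pmetric_refl[OF d st(1)] by (simp add: case_prod_unfold mult.commute)
qed

text \<open>No arc enters the set of vertices unreachable from the source, so the cut bound leaves
  entropy zero. Hence the side condition \<open>connected_demands\<close> holds as soon as some
  coding solution exists.\<close>

lemma rate_pos_reachable:
  assumes h: "h \<in> H" "0 < r h"
  shows "source h \<rightarrow>\<^sup>*\<^bsub>bidirected V E\<^esub> sink h"
proof (rule ccontr)
  assume contr: "\<not> ?thesis"
  interpret wf_digraph "bidirected V E"
    by unfold_locales (use arcset_in_verts[OF graph] in \<open>auto simp: bidirected_def arcs_of_def\<close>)
  define W where "W = {v. \<not> source h \<rightarrow>\<^sup>*\<^bsub>bidirected V E\<^esub> v}"
  have "source h \<in> V" using sessions h by (auto simp: session_set_def)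
  then have "source h \<in> verts (bidirected V E)" by (simp add: bidirected_def)
  then have s: "source h \<notin> W" by (simp add: W_def)
  have t: "sink h \<in> W" using contr by (simp add: W_def)
  have empty: "{a. a \<in> arcset E \<and> fst a \<notin> W \<and> snd a \<in> W} = {}"
  proof -
    have "source h \<rightarrow>\<^sup>*\<^bsub>bidirected V E\<^esub> v"
      if "{u, v} \<in> E" "source h \<rightarrow>\<^sup>*\<^bsub>bidirected V E\<^esub> u" for u v
    proof -
      have "(u, v) \<in> arcs (bidirected V E)" using that by simp
      then have "u \<rightarrow>\<^bsub>bidirected V E\<^esub> v"
        by (metis (no_types, lifting) bidirected_def fst_conv in_arcs_imp_in_arcs_ends pre_digraph.select_convs(3,4) snd_conv)
      then show ?thesis using that(2) by (rule reachable_adj_trans[rotated])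
    qed
    then show ?thesis by (auto simp: W_def)
  qed
  have "ent (Pr C) (message C h) \<le> 0"
    using cut_bound[OF h(1) s t] unfolding empty by simp
  then show False
    using ent_message[OF h(1)] h(2) blocklength_pos by (simp add: mult_le_0_iff)
qed

lemma connected_demands: "connected_demands V E H r"
  unfolding connected_demands_def using rate_pos_reachable by blast

text \<open>Mutual information is the drop from H(X | Z) to H(X | M, Z), and the second term is zero
  because all messages together determine the symbol.\<close>

lemma cond_mi_symbol:
  assumes "h \<in> H" "a \<in> arcset E" "t < rounds C"
  shows "cond_mi (Pr C) (symbol C a t) (message C h) (messages C (H - {h}))
    = cent (symbol C a t) (messages C (H - {h}))"
proof -
  let ?X = "symbol C a t" and ?M = "message C h" and ?Z = "messages C (H - {h})"
  have sf: "sf ?X" "sf ?M" "sf ?Z"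
    using assms by (auto intro: sf_symbol sf_message sf_messages)
  have "function_of (Pr C) (messages C H) (\<lambda>\<omega>. (?M \<omega>, ?Z \<omega>))"
    unfolding function_of_iff messages_def
    by (auto simp: fun_eq_iff restrict_def)
  then have "function_of (Pr C) ?X (\<lambda>\<omega>. (?M \<omega>, ?Z \<omega>))"
    using assms symbol_function_of_messages function_of_trans by blast
  then have "function_of (Pr C) (\<lambda>\<omega>. (?X \<omega>, ?M \<omega>, ?Z \<omega>)) (\<lambda>\<omega>. (?M \<omega>, ?Z \<omega>))"
    unfolding function_of_iff prod.inject by blast
  moreover have "function_of (Pr C) (\<lambda>\<omega>. (?M \<omega>, ?Z \<omega>)) (\<lambda>\<omega>. (?X \<omega>, ?M \<omega>, ?Z \<omega>))"
    by (simp add: function_of_iff)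
  ultimately have "ent (Pr C) (\<lambda>\<omega>. (?X \<omega>, ?M \<omega>, ?Z \<omega>)) = ent (Pr C) (\<lambda>\<omega>. (?M \<omega>, ?Z \<omega>))"
    using sf by (intro ent_cong sf_pair)
  then show ?thesis
    using sf by (simp add: cond_mi_ent cent_def)
qed

lemma sum_load_le:
  assumes a: "a \<in> arcset E"
    and ind: "\<And>i j t. i \<in> H \<Longrightarrow> j \<in> H \<Longrightarrow> i \<noteq> j \<Longrightarrow> t < rounds C \<Longrightarrow>
      cent (symbol C a t) (messages C (H - {i})) * cent (symbol C a t) (messages C (H - {j})) = 0"
  shows "(\<Sum>h\<in>H. load h a) \<le> ent (Pr C) (transmission C a)"
proof -
  define c where "c h t = cent (symbol C a t) (messages C (H - {h}))" for h t
  \<comment> \<open>The rounds whose symbol depends on message \<open>h\<close>. By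
    \<open>ind\<close>, a round belongs to \<open>N h\<close> for at most one session, so the loads
    of different sessions are charged to different rounds.\<close>
  define N where "N h = {t. t < rounds C \<and> c h t \<noteq> 0}" for h
  define T where "T I \<omega> = (\<lambda>t\<in>I. symbol C a t \<omega>)" for I \<omega>
  have T_eq_iff: "T I \<omega> = T I \<omega>' \<longleftrightarrow> (\<forall>t\<in>I. symbol C a t \<omega> = symbol C a t \<omega>')" for I \<omega> \<omega>'
    by (auto simp: T_def fun_eq_iff restrict_def)
  have sfT: "sf (T I)" if "I \<subseteq> {..<rounds C}" for I
    unfolding T_def[abs_def] using that a by (intro sf_tuple sf_symbol) (auto dest: finite_subset)
  have zero: "cent (T I) (messages C (H - {h})) = 0"
    if "I \<subseteq> {..<rounds C}" "\<And>t. t \<in> I \<Longrightarrow> c h t = 0" for I h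
  proof (rule antisym)
    have "cent (T I) (messages C (H - {h})) \<le> (\<Sum>t\<in>I. c h t)"
      unfolding T_def[abs_def] c_def using that(1) a
      by (intro cent_tuple_le sf_symbol sf_messages) (auto dest: finite_subset)
    then show "cent (T I) (messages C (H - {h})) \<le> 0"
      using that(2) by simp
  qed (use that sfT in \<open>auto intro!: cent_nonneg sf_messages\<close>)
  \<comment> \<open>Chain rule over the groups \<open>N h\<close>: the groups of the other sessions are determined by the
    messages other than \<open>h\<close>, so that conditioning on these lowers the entropy of group \<open>h\<close> at most
    to \<open>load h a\<close>.\<close>
  have "(\<Sum>h\<in>J. load h a) \<le> ent (Pr C) (T (\<Union>h\<in>J. N h))" if "J \<subseteq> H" for J
    using finite_subset[OF that finite_sessions] that
  proof (induction J)
    case empty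
    show ?case by (simp add: ent_nonneg sfT)
  next
    case (insert h J)
    let ?Z = "messages C (H - {h})"
    let ?A = "T (N h)" and ?B = "T (\<Union>h\<in>J. N h)" and ?R = "T ({..<rounds C} - N h)"
    have sub: "N h \<subseteq> {..<rounds C}" "(\<Union>h\<in>J. N h) \<subseteq> {..<rounds C}" "{..<rounds C} - N h \<subseteq> {..<rounds C}"
      by (auto simp: N_def)
    have sf: "sf ?A" "sf ?B" "sf ?R" "sf ?Z"
      using sub by (auto intro: sfT sf_messages)
    have "load h a \<le> cent (\<lambda>\<omega>. (?A \<omega>, ?R \<omega>)) ?Z"
      unfolding load_def using sf
      by (intro cent_mono sf_pair) (auto simp: function_of_iff transmission_eq_iff T_eq_iff)
    also have "\<dots> \<le> cent ?A ?Z + cent ?R ?Z"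
      using sf by (intro cent_pair_le)
    also have "cent ?R ?Z = 0"
      by (rule zero) (auto simp: N_def)
    also have "cent ?A ?Z + 0 \<le> ent (Pr C) (\<lambda>\<omega>. (?A \<omega>, ?B \<omega>)) - ent (Pr C) ?B"
    proof -
      have "cent ?B ?Z = 0"
      proof (rule zero)
        fix t assume "t \<in> (\<Union>h\<in>J. N h)"
        then obtain j where "j \<in> J" "t < rounds C" "c j t \<noteq> 0" by (auto simp: N_def)
        then show "c h t = 0"
          using ind[of j h t] insert.hyps insert.prems by (auto simp: c_def)
      qed (use sub in auto)
      then show ?thesis using sf by (simp add: cent_le_ent_diff)
    qed
    also have "ent (Pr C) (\<lambda>\<omega>. (?A \<omega>, ?B \<omega>)) \<le> ent (Pr C) (T (\<Union>h\<in>insert h J. N h))"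
      using sub by (intro ent_mono sfT) (auto simp: function_of_iff T_eq_iff)
    finally have "load h a \<le> ent (Pr C) (T (\<Union>h\<in>insert h J. N h)) - ent (Pr C) ?B"
      by simp
    moreover have "(\<Sum>h\<in>J. load h a) \<le> ent (Pr C) ?B"
      using insert by simp
    moreover have "(\<Sum>h\<in>insert h J. load h a) = load h a + (\<Sum>h\<in>J. load h a)"
      using insert.hyps by (rule sum.insert)
    ultimately show ?case by linarith
  qed
  then have "(\<Sum>h\<in>H. load h a) \<le> ent (Pr C) (T (\<Union>h\<in>H. N h))"
    by simp
  also have "\<dots> \<le> ent (Pr C) (transmission C a)"
    using a by (intro ent_mono sf_transmission) (auto simp: function_of_iff T_eq_iff transmission_eq_iff N_def)
  finally show ?thesis .
qed

lemma independent_cost_bound: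
  assumes d: "pmetric V d"
    and ind: "\<And>i j e a t. i \<in> H \<Longrightarrow> j \<in> H \<Longrightarrow> i \<noteq> j \<Longrightarrow> e \<in> E \<Longrightarrow> a \<in> arcs_of e \<Longrightarrow> t < rounds C \<Longrightarrow>
      cond_mi (Pr C) (symbol C a t) (message C i) (messages C (H - {i})) *
      cond_mi (Pr C) (symbol C a t) (message C j) (messages C (H - {j})) = 0"
  shows "(\<Sum>h\<in>H. r h * d (source h) (sink h)) \<le> (\<Sum>(u, v)\<in>arcset E. d u v * coding_flow C (u, v))"
proof -
  have "blocklength C * (\<Sum>h\<in>H. r h * d (source h) (sink h))
    = (\<Sum>h\<in>H. ent (Pr C) (message C h) * d (source h) (sink h))"
    by (simp add: sum_distrib_left ent_message mult_ac)
  also have "\<dots> \<le> (\<Sum>h\<in>H. \<Sum>(u, v)\<in>arcset E. d u v * load h (u, v))"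
    using load_cost_bound[OF d] by (rule sum_mono)
  also have "\<dots> = (\<Sum>(u, v)\<in>arcset E. d u v * (\<Sum>h\<in>H. load h (u, v)))"
    by (subst sum.swap) (simp add: sum_distrib_left case_prod_unfold)
  also have "\<dots> \<le> (\<Sum>(u, v)\<in>arcset E. d u v * ent (Pr C) (transmission C (u, v)))"
  proof (rule sum_mono, clarify)
    fix u v assume uv: "{u, v} \<in> E"
    then have "(u, v) \<in> arcset E" by simp
    have "(\<Sum>h\<in>H. load h (u, v)) \<le> ent (Pr C) (transmission C (u, v))"
    proof (rule sum_load_le)
      fix i j t assume "i \<in> H" "j \<in> H" "i \<noteq> j" "t < rounds C"
      then show "cent (symbol C (u, v) t) (messages C (H - {i})) *
        cent (symbol C (u, v) t) (messages C (H - {j})) = 0"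
        using ind[of i j "{u, v}" "(u, v)" t] uv by (simp add: cond_mi_symbol arcs_of_def)
    qed (use uv in simp)
    then show "d u v * (\<Sum>h\<in>H. load h (u, v)) \<le> d u v * ent (Pr C) (transmission C (u, v))"
      using pmetric_nonneg[OF d] arcset_in_verts[OF graph \<open>(u, v) \<in> arcset E\<close>]
      by (intro mult_left_mono) auto
  qed
  also have "\<dots> = blocklength C * (\<Sum>(u, v)\<in>arcset E. d u v * coding_flow C (u, v))"
    using blocklength_pos by (simp add: coding_flow_def sum_distrib_left case_prod_unfold)
  finally show ?thesis
    using blocklength_pos by (simp add: mult_le_cancel_left)
qed

end

section \<open>Extending codes\<close>

text \<open>Messages and symbols are single naturals, so a tuple has to be encoded. Positions
  outside \<open>S\<close> hold the constant 0, which carries no information; thus one list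
  \<open>js\<close> serves all subsets \<open>S\<close>.\<close>

definition pack :: "'j list \<Rightarrow> ('j \<Rightarrow> nat \<Rightarrow> nat) \<Rightarrow> 'j set \<Rightarrow> nat \<Rightarrow> nat" where
  "pack js Y S \<omega> = to_nat (map (\<lambda>j. if j \<in> S then Y j \<omega> else 0) js)"

lemma pack_eq_iff: "pack js Y S \<omega> = pack js Y S \<omega>' \<longleftrightarrow> (\<forall>j\<in>set js \<inter> S. Y j \<omega> = Y j \<omega>')"
  by (auto simp: pack_def)

text \<open>Needed to derive independence of packed variables: it makes packing a measurable
  function on the product space. The list is built up one entry at a time, and each entry takes only
  countably many values.\<close>

lemma measurable_pack:
  "(\<lambda>f. to_nat (map (\<lambda>j. if j \<in> S then f j else (0::nat)) js))
    \<in> measurable (PiM S (\<lambda>_. count_space UNIV)) (count_space UNIV)"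
proof -
  have "(\<lambda>f. map (\<lambda>j. if j \<in> S then f j else (0::nat)) js)
      \<in> measurable (PiM S (\<lambda>_. count_space UNIV)) (count_space UNIV)" (is "?g js \<in> ?N")
  proof (induction js)
    case Nil
    show ?case by simp
  next
    case (Cons j js)
    have 1: "(\<lambda>f. if j \<in> S then f j else (0::nat)) \<in> measurable (PiM S (\<lambda>_. count_space UNIV)) (count_space UNIV)"
      by (cases "j \<in> S") (auto intro: measurable_component_singleton)
    have "(\<lambda>f. (\<lambda>x f. x # ?g js f) (if j \<in> S then f j else (0::nat)) f) \<in> ?N"
    proof (rule measurable_compose_countable[OF _ 1])
      fix x :: nat
      show "(\<lambda>f. x # ?g js f) \<in> ?N"
        by (rule measurable_compose[OF Cons.IH]) simp
    qed
    then show ?case by simp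
  qed
  then show ?thesis
    by (rule measurable_compose) simp
qed

context finite_source
begin

lemma function_of_pack:
  "set js \<inter> S \<subseteq> I \<Longrightarrow> function_of P (pack js Y S) (\<lambda>\<omega>. \<lambda>j\<in>I. Y j \<omega>)"
  unfolding function_of_iff pack_eq_iff by (metis restrict_apply' subsetD)

lemma sf_pack:
  assumes "\<And>j. j \<in> S \<Longrightarrow> sf (Y j)"
  shows "sf (pack js Y S)"
proof (rule sf_function_of)
  show "sf (\<lambda>\<omega>. \<lambda>j\<in>set js \<inter> S. Y j \<omega>)"
    using assms by (intro sf_tuple) auto
qed (rule function_of_pack, simp)

lemma ent_pack:
  assumes sf: "\<And>j. j \<in> S \<Longrightarrow> sf (Y j)" and S: "S \<subseteq> set js"
    and ind: "indep_vars (\<lambda>_. count_space UNIV) Y S"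
  shows "ent P (pack js Y S) = (\<Sum>j\<in>S. ent P (Y j))"
proof -
  have fin: "finite S" using S finite_subset by blast
  have "ent P (pack js Y S) = ent P (\<lambda>\<omega>. \<lambda>j\<in>S. Y j \<omega>)"
  proof (rule ent_cong)
    show "sf (\<lambda>\<omega>. \<lambda>j\<in>S. Y j \<omega>)" using fin sf by (rule sf_tuple)
    show "function_of P (pack js Y S) (\<lambda>\<omega>. \<lambda>j\<in>S. Y j \<omega>)"
      by (rule function_of_pack) simp
    have "set js \<inter> S = S" using S by blast
    then show "function_of P (\<lambda>\<omega>. \<lambda>j\<in>S. Y j \<omega>) (pack js Y S)"
      unfolding function_of_iff pack_eq_iff by (metis restrict_ext)
  qed
  also have "\<dots> = (\<Sum>j\<in>S. ent P (Y j))"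
    using fin sf ind by (rule ent_tuple_indep)
  finally show ?thesis .
qed

text \<open>Functions of disjoint groups of independent variables are independent. The groups are
  the sessions merged into one session here, and the walks of one session in
  \<open>path_code\<close>.\<close>

lemma indep_vars_pack:
  assumes ind: "indep_vars (\<lambda>_. count_space UNIV) Y J"
    and K: "\<And>l. l \<in> L \<Longrightarrow> K l \<subseteq> J" and disj: "disjoint_family_on K L"
  shows "indep_vars (\<lambda>_. count_space UNIV) (\<lambda>l. pack js Y (K l)) L"
proof -
  have "indep_vars (\<lambda>_. count_space UNIV)
      (\<lambda>l \<omega>. to_nat (map (\<lambda>j. if j \<in> K l then (\<lambda>j\<in>K l. Y j \<omega>) j else 0) js)) L"
    using indep_vars_compose2[OF indep_vars_restrict[OF ind K disj] measurable_pack] .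
  moreover have "to_nat (map (\<lambda>j. if j \<in> K l then (\<lambda>j\<in>K l. Y j \<omega>) j else 0) js) = pack js Y (K l) \<omega>" for l \<omega>
    by (auto simp: pack_def intro!: arg_cong[where f = to_nat])
  ultimately show ?thesis by simp
qed

end

lemma knowledgeD:
  assumes "knowledge V E H C v t \<omega> = knowledge V E H C v t \<omega>'"
  shows knowledge_message: "h \<in> H \<Longrightarrow> source h = v \<Longrightarrow> message C h \<omega> = message C h \<omega>'"
    and knowledge_symbol: "(u, v) \<in> arcset E \<Longrightarrow> s < t \<Longrightarrow> symbol C (u, v) s \<omega> = symbol C (u, v) s \<omega>'"
proof -
  let ?I = "{a \<in> arcset E. snd a = v} \<times> {..<t}"
  have m: "messages C {h \<in> H. source h = v} \<omega> = messages C {h \<in> H. source h = v} \<omega>'"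
    and s: "(\<lambda>(a, s)\<in>?I. symbol C a s \<omega>) = (\<lambda>(a, s)\<in>?I. symbol C a s \<omega>')"
    using assms by (simp_all add: knowledge_def)
  show "message C h \<omega> = message C h \<omega>'" if "h \<in> H" "source h = v"
    using fun_cong[OF m, of h] that by (simp add: messages_def)
  show "symbol C (u, v) s \<omega> = symbol C (u, v) s \<omega>'" if "(u, v) \<in> arcset E" "s < t"
    using fun_cong[OF s, of "((u, v), s)"] that by simp
qed

definition complete_edges :: "vertex set \<Rightarrow> edge set" where
  "complete_edges V = {e. e \<subseteq> V \<and> card e = 2}"

lemma finite_graph_complete: "finite V \<Longrightarrow> finite_graph V (complete_edges V)"
  by (auto simp: finite_graph_def complete_edges_def)

lemma arcset_complete: "(u, v) \<in> arcset (complete_edges V) \<longleftrightarrow> u \<in> V \<and> v \<in> V \<and> u \<noteq> v"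
  by (auto simp: complete_edges_def card_2_iff doubleton_eq_iff)

text \<open>\<open>\<phi>\<close> relocates sessions and need not be injective: sessions with the
  same image are merged into one that carries all their messages.\<close>

locale code_extension = coded_network +
  fixes V' :: "vertex set" and \<phi> :: "session \<Rightarrow> session"
  assumes V': "finite V'" "V \<subseteq> V'" and \<phi>: "\<phi> ` H \<subseteq> V' \<times> V'"
begin

definition session_list :: "session list" where
  "session_list = (SOME hs. set hs = H)"

lemma set_session_list: "set session_list = H"
  unfolding session_list_def using finite_list[OF finite_sessions] by (rule someI_ex)

abbreviation msgs :: "session set \<Rightarrow> nat \<Rightarrow> nat" where
  "msgs \<equiv> pack session_list (message C)"

text \<open>Round \<open>0\<close> carries the messages from their new sources to the old ones, the last round
  carries them from the old sinks to the new ones.\<close>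

definition extended :: code where
  "extended = \<lparr>Pr = Pr C, blocklength = blocklength C, rounds = rounds C + 2,
     message = (\<lambda>k. msgs {h \<in> H. \<phi> h = k}),
     symbol = (\<lambda>(u, v) t \<omega>.
       if t = 0 then msgs {h \<in> H. source (\<phi> h) = u \<and> source h = v} \<omega>
       else if t \<le> rounds C then (if (u, v) \<in> arcset E then symbol C (u, v) (t - 1) \<omega> else 0)
       else msgs {h \<in> H. sink h = u \<and> sink (\<phi> h) = v} \<omega>)\<rparr>"

abbreviation E' :: "edge set" where "E' \<equiv> complete_edges V'"

definition extended_rate :: "session \<Rightarrow> real" where
  "extended_rate k = (\<Sum>h | h \<in> H \<and> \<phi> h = k. r h)"

lemma msgs_eq_iff: "S \<subseteq> H \<Longrightarrow> msgs S \<omega> = msgs S \<omega>' \<longleftrightarrow> (\<forall>h\<in>S. message C h \<omega> = message C h \<omega>')"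
  unfolding pack_eq_iff set_session_list by blast

lemma ent_msgs:
  assumes "S \<subseteq> H"
  shows "ent (Pr C) (msgs S) = blocklength C * (\<Sum>h\<in>S. r h)"
proof -
  have "ent (Pr C) (msgs S) = (\<Sum>h\<in>S. ent (Pr C) (message C h))"
    using assms indep_messages
    by (intro ent_pack) (auto simp: set_session_list intro: sf_message indep_vars_subset)
  also have "\<dots> = blocklength C * (\<Sum>h\<in>S. r h)"
    using assms by (auto simp: sum_distrib_left ent_message subset_iff intro!: sum.cong)
  finally show ?thesis .
qed

lemma sf_msgs: "S \<subseteq> H \<Longrightarrow> sf (msgs S)"
  by (intro sf_pack sf_message) auto

lemma arc_E': "(u, v) \<in> arcset E \<Longrightarrow> (u, v) \<in> arcset E'"
  using arcset_in_verts[OF graph] V' unfolding arcset_complete by blast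

lemma endpoints_V':
  assumes "h \<in> H"
  shows "source h \<in> V'" "sink h \<in> V'" "source (\<phi> h) \<in> V'" "sink (\<phi> h) \<in> V'"
proof -
  have "h \<in> V \<times> V" "\<phi> h \<in> V' \<times> V'"
    using assms sessions \<phi> by (auto simp: session_set_def)
  then show "source h \<in> V'" "sink h \<in> V'" "source (\<phi> h) \<in> V'" "sink (\<phi> h) \<in> V'"
    using V' by (auto simp: mem_Times_iff)
qed

lemma extended_knowledge_message:
  assumes eq: "knowledge V' E' (\<phi> ` H) extended v t \<omega> = knowledge V' E' (\<phi> ` H) extended v t \<omega>'"
    and h: "h \<in> H" "source (\<phi> h) = v"
  shows "message C h \<omega> = message C h \<omega>'"
  using knowledge_message[OF eq, of "\<phi> h"] h
  by (auto simp: extended_def msgs_eq_iff simp del: split_paired_All)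

text \<open>Old round \<open>s\<close> is replayed as round \<open>Suc s\<close>, because round
  \<open>0\<close> is spent on delivering messages to their old sources. A session whose source
  stays in place needs no delivery, which is the case distinction below: the complete graph has no
  loops.\<close>

lemma extended_knowledge:
  assumes eq: "knowledge V' E' (\<phi> ` H) extended v t \<omega> = knowledge V' E' (\<phi> ` H) extended v t \<omega>'"
    and t: "s < t" "s \<le> rounds C"
  shows "knowledge V E H C v s \<omega> = knowledge V E H C v s \<omega>'"
proof (rule knowledge_eqI)
  fix h assume h: "h \<in> H" "source h = v"
  show "message C h \<omega> = message C h \<omega>'"
  proof (cases "source (\<phi> h) = v")
    case True
    then show ?thesis using extended_knowledge_message[OF eq] h by blast
  next
    case False
    then have "(source (\<phi> h), v) \<in> arcset E'"
      unfolding arcset_complete using h endpoints_V'[OF h(1)] by auto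
    then have "symbol extended (source (\<phi> h), v) 0 \<omega> = symbol extended (source (\<phi> h), v) 0 \<omega>'"
      using t by (intro knowledge_symbol[OF eq]) auto
    then show ?thesis
      using h by (auto simp: extended_def msgs_eq_iff simp del: split_paired_All)
  qed
next
  fix u s' assume uv: "(u, v) \<in> arcset E" and s': "s' < s"
  have "symbol extended (u, v) (Suc s') \<omega> = symbol extended (u, v) (Suc s') \<omega>'"
    using t s' by (intro knowledge_symbol[OF eq arc_E'[OF uv]]) auto
  then show "symbol C (u, v) s' \<omega> = symbol C (u, v) s' \<omega>'"
    using uv s' t by (simp add: extended_def)
qed

lemma extended_coding_solution: "coding_solution V' E' (\<phi> ` H) extended_rate extended"
  unfolding coding_solution_def
proof (intro conjI ballI allI impI)
  show "prob_space (Pr extended)" "0 < blocklength extended"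
    using solution by (simp_all add: extended_def coding_solution_def)
  show "simple_function (Pr extended) (message extended k)" for k
    unfolding extended_def code.simps by (intro sf_msgs) auto
  show "prob_space.indep_vars (Pr extended) (\<lambda>_. count_space UNIV) (message extended) (\<phi> ` H)"
    unfolding extended_def code.simps using indep_messages
    by (rule indep_vars_pack) (auto simp: disjoint_family_on_def)
  show "ent (Pr extended) (message extended k) / blocklength extended = extended_rate k" for k
    using blocklength_pos by (simp add: extended_def ent_msgs extended_rate_def)
next
  fix k assume k: "k \<in> \<phi> ` H"
  show "function_of (Pr extended) (message extended k)
      (knowledge V' E' (\<phi> ` H) extended (sink k) (rounds extended))"
    unfolding extended_def[THEN arg_cong, of Pr] code.simps function_of_iff
  proof (intro ballI impI)
    fix \<omega> \<omega>' assume \<omega>: "\<omega> \<in> space (Pr C)" "\<omega>' \<in> space (Pr C)"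
      and eq: "knowledge V' E' (\<phi> ` H) extended (sink k) (rounds extended) \<omega>
        = knowledge V' E' (\<phi> ` H) extended (sink k) (rounds extended) \<omega>'"
    have "message C h \<omega> = message C h \<omega>'" if h: "h \<in> H" "\<phi> h = k" for h
    proof (cases "sink h = sink k")
      case True
      have "knowledge V E H C (sink h) (rounds C) \<omega> = knowledge V E H C (sink h) (rounds C) \<omega>'"
        unfolding True by (rule extended_knowledge[OF eq]) (auto simp: extended_def)
      then show ?thesis
        using message_function_of_knowledge[OF h(1)] \<omega> unfolding function_of_iff by blast
    next
      case False
      then have "(sink h, sink k) \<in> arcset E'"
        unfolding arcset_complete using endpoints_V'[OF h(1)] h by auto
      then have "symbol extended (sink h, sink k) (Suc (rounds C)) \<omega>
          = symbol extended (sink h, sink k) (Suc (rounds C)) \<omega>'"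
        by (rule knowledge_symbol[OF eq]) (simp add: extended_def)
      then show ?thesis
        using h by (auto simp: extended_def msgs_eq_iff simp del: split_paired_All)
    qed
    then show "message extended k \<omega> = message extended k \<omega>'"
      by (auto simp: extended_def msgs_eq_iff)
  qed
next
  fix a t assume "a \<in> arcs (bidirected V' E')" and t: "t < rounds extended"
  then obtain u v where a: "a = (u, v)" and uv: "(u, v) \<in> arcset E'"
    by (cases a) auto
  show "function_of (Pr extended) (symbol extended a t) (knowledge V' E' (\<phi> ` H) extended (fst a) t)"
    unfolding extended_def[THEN arg_cong, of Pr] code.simps function_of_iff
  proof (intro ballI impI)
    fix \<omega> \<omega>' assume \<omega>: "\<omega> \<in> space (Pr C)" "\<omega>' \<in> space (Pr C)"
      and eq': "knowledge V' E' (\<phi> ` H) extended (fst a) t \<omega> = knowledge V' E' (\<phi> ` H) extended (fst a) t \<omega>'"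
    then have eq: "knowledge V' E' (\<phi> ` H) extended u t \<omega> = knowledge V' E' (\<phi> ` H) extended u t \<omega>'"
      by (simp add: a)
    consider "t = 0" | s where "t = Suc s" "s < rounds C" | "t = Suc (rounds C)"
      using t by (cases t) (force simp: extended_def)+
    then show "symbol extended a t \<omega> = symbol extended a t \<omega>'"
    proof cases
      case 1
      then show ?thesis
        using extended_knowledge_message[OF eq] by (auto simp: a extended_def msgs_eq_iff)
    next
      case 2
      have "symbol C (u, v) s \<omega> = symbol C (u, v) s \<omega>'" if "(u, v) \<in> arcset E"
      proof -
        have "knowledge V E H C u s \<omega> = knowledge V E H C u s \<omega>'"
          using 2 by (intro extended_knowledge[OF eq]) auto
        then show ?thesis
          using symbol_function_of_knowledge[OF that, of s] 2 \<omega> unfolding function_of_iff fst_conv by blast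
      qed
      then show ?thesis using 2 by (simp add: a extended_def)
    next
      case 3
      have "knowledge V E H C u (rounds C) \<omega> = knowledge V E H C u (rounds C) \<omega>'"
        using 3 by (intro extended_knowledge[OF eq]) auto
      then have "message C h \<omega> = message C h \<omega>'" if "h \<in> H" "sink h = u" for h
        using message_function_of_knowledge[OF that(1)] \<omega> that(2) unfolding function_of_iff by blast
      then show ?thesis using 3 by (auto simp: a extended_def msgs_eq_iff)
    qed
  qed
qed

lemma extended_coding_flow:
  "coding_flow extended (u, v) \<le> of_bool ((u, v) \<in> arcset E) * coding_flow C (u, v)
    + (\<Sum>h\<in>H. of_bool (source (\<phi> h) = u \<and> source h = v) * r h)
    + (\<Sum>h\<in>H. of_bool (sink h = u \<and> sink (\<phi> h) = v) * r h)"
proof -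
  let ?S = "{h \<in> H. source (\<phi> h) = u \<and> source h = v}"
  let ?T = "{h \<in> H. sink h = u \<and> sink (\<phi> h) = v}"
  \<comment> \<open>A coding solution leaves the symbols on arcs outside \<open>E\<close>
    unconstrained, so there \<open>X\<close> is constant instead.\<close>
  define X where "X = (if (u, v) \<in> arcset E then transmission C (u, v) else (\<lambda>_. []))"
  have sfX: "sf X"
    unfolding X_def using sf_transmission by simp
  have sf: "sf (\<lambda>\<omega>. (X \<omega>, msgs ?S \<omega>))" "sf (msgs ?S)" "sf (msgs ?T)"
    using sfX by (auto intro!: sf_pair sf_msgs)
  have fn: "function_of (Pr C) (transmission extended (u, v)) (\<lambda>\<omega>. ((X \<omega>, msgs ?S \<omega>), msgs ?T \<omega>))"
    unfolding function_of_iff prod.inject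
  proof (intro ballI impI, elim conjE)
    fix \<omega> \<omega>' assume eq: "X \<omega> = X \<omega>'" "msgs ?S \<omega> = msgs ?S \<omega>'" "msgs ?T \<omega> = msgs ?T \<omega>'"
    have "symbol C (u, v) s \<omega> = symbol C (u, v) s \<omega>'" if "(u, v) \<in> arcset E" "s < rounds C" for s
      using eq(1) that by (simp add: X_def transmission_eq_iff)
    then have "symbol extended (u, v) t \<omega> = symbol extended (u, v) t \<omega>'" for t
      using eq(2,3) by (cases t) (auto simp: extended_def)
    then show "transmission extended (u, v) \<omega> = transmission extended (u, v) \<omega>'"
      by (simp add: transmission_def)
  qed
  have "ent (Pr C) (transmission extended (u, v)) \<le> ent (Pr C) (\<lambda>\<omega>. ((X \<omega>, msgs ?S \<omega>), msgs ?T \<omega>))"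
    by (rule ent_mono[OF sf_pair[OF sf(1,3)] fn])
  also have "\<dots> \<le> ent (Pr C) (\<lambda>\<omega>. (X \<omega>, msgs ?S \<omega>)) + ent (Pr C) (msgs ?T)"
    by (rule ent_pair_le[OF sf(1,3)])
  also have "ent (Pr C) (\<lambda>\<omega>. (X \<omega>, msgs ?S \<omega>)) \<le> ent (Pr C) X + ent (Pr C) (msgs ?S)"
    by (rule ent_pair_le[OF sfX sf(2)])
  also have "ent (Pr C) X = blocklength C * (of_bool ((u, v) \<in> arcset E) * coding_flow C (u, v))"
  proof (cases "(u, v) \<in> arcset E")
    case True
    then show ?thesis using blocklength_pos by (simp add: X_def coding_flow_def)
  next
    case False
    then have "ent (Pr C) X = 0" by (intro ent_const) (simp add: X_def function_of_iff)
    then show ?thesis using False by simp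
  qed
  also have "ent (Pr C) (msgs ?S) = blocklength C * (\<Sum>h\<in>H. of_bool (source (\<phi> h) = u \<and> source h = v) * r h)"
    using finite_sessions by (subst ent_msgs) (auto intro!: sum.mono_neutral_cong_left)
  also have "ent (Pr C) (msgs ?T) = blocklength C * (\<Sum>h\<in>H. of_bool (sink h = u \<and> sink (\<phi> h) = v) * r h)"
    using finite_sessions by (subst ent_msgs) (auto intro!: sum.mono_neutral_cong_left)
  finally have "ent (Pr C) (transmission extended (u, v)) \<le> blocklength C *
     (of_bool ((u, v) \<in> arcset E) * coding_flow C (u, v)
    + (\<Sum>h\<in>H. of_bool (source (\<phi> h) = u \<and> source h = v) * r h)
    + (\<Sum>h\<in>H. of_bool (sink h = u \<and> sink (\<phi> h) = v) * r h))"
    by (simp add: ring_distribs)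
  moreover have "coding_flow extended (u, v) = ent (Pr C) (transmission extended (u, v)) / blocklength C"
    by (simp add: coding_flow_def extended_def)
  ultimately show ?thesis
    using blocklength_pos by (simp add: pos_divide_le_eq mult.commute)
qed

lemma extended_cost:
  assumes d: "pmetric V' d"
  shows "(\<Sum>(u, v)\<in>arcset E'. d u v * coding_flow extended (u, v))
    \<le> (\<Sum>(u, v)\<in>arcset E. d u v * coding_flow C (u, v))
      + (\<Sum>h\<in>H. r h * (d (source (\<phi> h)) (source h) + d (sink h) (sink (\<phi> h))))"
proof -
  have fin: "finite (arcset E')"
    using V' finite_arcset finite_graph_complete by blast
  \<comment> \<open>For \<open>x = y\<close> there is no such arc and the sum is empty, in agreement
    with \<open>d x x = 0\<close>: an endpoint that stays in place costs nothing.\<close>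
  have one: "(\<Sum>a\<in>arcset E'. d (fst a) (snd a) * of_bool (x = fst a \<and> y = snd a)) = d x y"
    if "x \<in> V'" "y \<in> V'" for x y
  proof (cases "x = y")
    case True
    then show ?thesis
      using that pmetric_refl[OF d] arcset_complete[of x x V'] by (intro trans[OF sum.neutral]) auto
  next
    case False
    then have "(x, y) \<in> arcset E'" using that unfolding arcset_complete by simp
    have "(\<Sum>a\<in>arcset E'. d (fst a) (snd a) * of_bool (x = fst a \<and> y = snd a))
        = (\<Sum>a\<in>arcset E'. if a = (x, y) then d x y else 0)"
      by (intro sum.cong) auto
    also have "\<dots> = d x y"
      using fin \<open>(x, y) \<in> arcset E'\<close> by (simp only: sum.delta) simp
    finally show ?thesis .
  qed
  have swap: "(\<Sum>a\<in>arcset E'. d (fst a) (snd a) * (\<Sum>h\<in>H. of_bool (f h = fst a \<and> g h = snd a) * r h))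
      = (\<Sum>h\<in>H. r h * d (f h) (g h))" if "\<And>h. h \<in> H \<Longrightarrow> f h \<in> V' \<and> g h \<in> V'" for f g :: "session \<Rightarrow> vertex"
  proof -
    have "(\<Sum>a\<in>arcset E'. d (fst a) (snd a) * (\<Sum>h\<in>H. of_bool (f h = fst a \<and> g h = snd a) * r h))
      = (\<Sum>h\<in>H. r h * (\<Sum>a\<in>arcset E'. d (fst a) (snd a) * of_bool (f h = fst a \<and> g h = snd a)))"
      by (simp only: sum_distrib_left, subst sum.swap) (simp only: mult_ac)
    also have "\<dots> = (\<Sum>h\<in>H. r h * d (f h) (g h))"
      using one that by (intro sum.cong) auto
    finally show ?thesis .
  qed
  have "(\<Sum>a\<in>arcset E'. d (fst a) (snd a) * coding_flow extended a)
    \<le> (\<Sum>a\<in>arcset E'. d (fst a) (snd a) * (of_bool (a \<in> arcset E) * coding_flow C a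
      + (\<Sum>h\<in>H. of_bool (source (\<phi> h) = fst a \<and> source h = snd a) * r h)
      + (\<Sum>h\<in>H. of_bool (sink h = fst a \<and> sink (\<phi> h) = snd a) * r h)))"
  proof (intro sum_mono mult_left_mono)
    fix a assume a: "a \<in> arcset E'"
    show "coding_flow extended a \<le> of_bool (a \<in> arcset E) * coding_flow C a
      + (\<Sum>h\<in>H. of_bool (source (\<phi> h) = fst a \<and> source h = snd a) * r h)
      + (\<Sum>h\<in>H. of_bool (sink h = fst a \<and> sink (\<phi> h) = snd a) * r h)"
      using extended_coding_flow[of "fst a" "snd a"] by (simp only: prod.collapse)
    have "fst a \<in> V'" "snd a \<in> V'"
      using a arcset_complete[of "fst a" "snd a" V'] unfolding prod.collapse by blast+
    then show "0 \<le> d (fst a) (snd a)"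
      using pmetric_nonneg[OF d] by blast
  qed
  also have "\<dots> = (\<Sum>a\<in>arcset E'. d (fst a) (snd a) * (of_bool (a \<in> arcset E) * coding_flow C a))
      + (\<Sum>h\<in>H. r h * d (source (\<phi> h)) (source h)) + (\<Sum>h\<in>H. r h * d (sink h) (sink (\<phi> h)))"
    using swap[of "\<lambda>h. source (\<phi> h)" source] swap[of sink "\<lambda>h. sink (\<phi> h)"] endpoints_V'
    by (simp only: distrib_left sum.distrib)
  also have "(\<Sum>a\<in>arcset E'. d (fst a) (snd a) * (of_bool (a \<in> arcset E) * coding_flow C a))
      = (\<Sum>a\<in>arcset E. d (fst a) (snd a) * coding_flow C a)"
    using arc_E' by (intro sum.mono_neutral_cong_right fin) auto
  finally show ?thesis
    by (simp add: case_prod_unfold distrib_left sum.distrib)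
qed

end

section \<open>Routing as coding\<close>

lemma continuous_on_xlogx: "continuous_on {0..} (\<lambda>t::real. t * log 2 t)"
  unfolding continuous_on_eq_continuous_within
proof
  fix t :: real assume t: "t \<in> {0..}"
  show "continuous (at t within {0..}) (\<lambda>t. t * log 2 t)"
  proof (cases "t = 0")
    case True
    have "((\<lambda>t::real. t * log 2 t) \<longlongrightarrow> 0) (at_right 0)"
      by real_asymp
    then show ?thesis
      unfolding True continuous_within by (simp add: at_within_Ici_at_right)
  next
    case False
    then have "isCont (\<lambda>t. t * log 2 t) t"
      using t by (intro continuous_intros) auto
    then show ?thesis by (rule continuous_at_imp_continuous_at_within)
  qed
qed

text \<open>Mixing a point mass with the uniform distribution on \<open>2 ^ m\<close> points moves
  the entropy continuously from 0 to \<open>m\<close>; the intermediate value theorem hits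
  \<open>x\<close>. Continuity at a vanishing probability rests on the limit of t log t at
  0.\<close>

lemma exists_pmf_entropy:
  assumes "0 \<le> x"
  obtains q :: "nat pmf" and n where "set_pmf q \<subseteq> {..<n}" "- (\<Sum>k<n. pmf q k * log 2 (pmf q k)) = x"
proof -
  obtain m :: nat where m: "x \<le> real m" using real_arch_simple by blast
  define n :: nat where "n = 2 ^ m"
  have n: "0 < n" by (simp add: n_def)
  define p :: "real \<Rightarrow> nat \<Rightarrow> real" where "p \<theta> k = \<theta> / n + (1 - \<theta>) * of_bool (k = 0)" for \<theta> k
  define f where "f \<theta> = - (\<Sum>k<n. p \<theta> k * log 2 (p \<theta> k))" for \<theta>
  have "f 0 = 0"
    unfolding f_def p_def by simp
  moreover have "f 1 = m"
    using n by (simp add: f_def p_def n_def log_divide log_nat_power)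
  moreover have "continuous_on {0..1} f"
    unfolding f_def
  proof (intro continuous_on_minus continuous_on_sum)
    fix k
    have "continuous_on {0..1} (\<lambda>\<theta>. p \<theta> k)"
      unfolding p_def by (intro continuous_intros) (use n in auto)
    then show "continuous_on {0..1} (\<lambda>\<theta>. p \<theta> k * log 2 (p \<theta> k))"
      by (rule continuous_on_compose2[OF continuous_on_xlogx]) (auto simp: p_def)
  qed
  ultimately obtain \<theta> where \<theta>: "0 \<le> \<theta>" "\<theta> \<le> 1" "f \<theta> = x"
    using IVT'[of f 0 x 1] assms m by auto
  define q where "q = bind_pmf (bernoulli_pmf \<theta>) (\<lambda>b. if b then pmf_of_set {..<n} else return_pmf 0)"
  have ne: "{..<n} \<noteq> {}" using n by auto
  have "pmf q k = p \<theta> k" if "k < n" for k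
    using \<theta> that ne unfolding q_def p_def
    by (simp add: pmf_bind pmf_of_set indicator_def)
  then have "- (\<Sum>k<n. pmf q k * log 2 (pmf q k)) = x"
    using \<theta> by (simp add: f_def)
  moreover have "set_pmf q \<subseteq> {..<n}"
  proof
    fix k assume "k \<in> set_pmf q"
    then obtain b where "k \<in> set_pmf (if b then pmf_of_set {..<n} else return_pmf 0)"
      unfolding q_def set_bind_pmf by blast
    then show "k \<in> {..<n}"
      using n set_pmf_of_set[OF ne finite_lessThan] by (cases b) simp_all
  qed
  ultimately show thesis using that by blast
qed

lemma (in finite_source) ent_sum_superset:
  assumes X: "sf X" and A: "finite A" "X ` space P \<subseteq> A"
  shows "ent P X = - (\<Sum>x\<in>A. prb X x * log 2 (prb X x))"
proof -
  have "ent P X = entropy 2 (count_space A) X"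
    using assms by (simp add: entropy_superset)
  also have "\<dots> = - (\<integral>x. prb X x * log 2 (prb X x) \<partial>count_space A)"
    by (rule entropy_distr[OF distributed_count_space_superset[OF assms]]) (simp add: prb_def)
  finally show ?thesis
    using A by (simp add: lebesgue_integral_count_space_finite)
qed

text \<open>The product of the distributions from \<open>exists_pmf_entropy\<close> lives on
  functions, while a code needs a measure on the naturals. Its support \<open>S\<close> is finite,
  so it is transported along an enumeration of \<open>S\<close>.\<close>

lemma independent_variables:
  fixes x :: "'j \<Rightarrow> real"
  assumes J: "finite J" and x: "\<forall>j\<in>J. 0 \<le> x j"
  shows "\<exists>(P :: nat measure) (Y :: 'j \<Rightarrow> nat \<Rightarrow> nat). finite_source P \<and>
    (\<forall>j\<in>J. simple_function P (Y j)) \<and>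
    prob_space.indep_vars P (\<lambda>_. count_space UNIV) Y J \<and>
    (\<forall>j\<in>J. ent P (Y j) = x j)"
proof -
  have "\<forall>j\<in>J. \<exists>q n. set_pmf q \<subseteq> {..<n::nat} \<and> - (\<Sum>k<n. pmf q k * log 2 (pmf q k)) = x j"
    using exists_pmf_entropy x by metis
  then obtain q n where q: "\<And>j. j \<in> J \<Longrightarrow> set_pmf (q j) \<subseteq> {..<n j::nat}"
    and ent: "\<And>j. j \<in> J \<Longrightarrow> - (\<Sum>k<n j. pmf (q j) k * log 2 (pmf (q j) k)) = x j"
    by metis
  define M where "M = Pi_pmf J 0 q"
  define S where "S = set_pmf M"
  have S: "countable S" "S \<noteq> {}"
    by (auto simp: S_def set_pmf_not_empty)
  have finS: "finite S"
  proof (rule finite_subset)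
    show "S \<subseteq> PiE_dflt J 0 (\<lambda>j. {..<n j})"
      unfolding S_def M_def using set_Pi_pmf_subset'[OF J, of 0 q] q
      by (auto simp: PiE_dflt_def)
    show "finite (PiE_dflt J 0 (\<lambda>j. {..<n j}))"
      using J by (intro finite_PiE_dflt) auto
  qed
  define P where "P = measure_pmf (map_pmf (to_nat_on S) M)"
  define Y where "Y j \<omega> = from_nat_into S \<omega> j" for j \<omega>
  interpret finite_source P
    unfolding P_def finite_source_def by (rule prob_space_measure_pmf)
  have space: "space P = UNIV" "sets P = UNIV" by (simp_all add: P_def)
  have meas: "prob (from_nat_into S -` X) = measure M X" for X
  proof -
    have "map_pmf (from_nat_into S) (map_pmf (to_nat_on S) M) = M"
      unfolding map_pmf_comp
      using S by (intro map_pmf_idI from_nat_into_to_nat_on) (auto simp: S_def)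
    then show ?thesis
      unfolding P_def measure_map_pmf by (metis measure_map_pmf)
  qed
  have sf: "sf (Y j)" for j
    unfolding simple_function_def space
  proof
    have "Y j ` UNIV \<subseteq> (\<lambda>f. f j) ` S"
      using from_nat_into[OF S(2)] by (auto simp: Y_def)
    then show "finite (Y j ` UNIV)" using finS finite_surj by blast
  qed simp
  have ind: "indep_vars (\<lambda>_. count_space UNIV) Y J"
    unfolding indep_vars_def2
  proof (intro conjI ballI)
    show "random_variable (count_space UNIV) (Y j)" for j
      by (simp add: P_def)
    show "indep_sets (\<lambda>i. {Y i -` A \<inter> space P |A. A \<in> sets (count_space UNIV)}) J"
    proof (rule indep_setsI)
      fix A K assume K: "K \<noteq> {}" "K \<subseteq> J" "finite K"
        and A: "\<forall>j\<in>K. A j \<in> {Y j -` A \<inter> space P |A. A \<in> sets (count_space UNIV)}"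
      then have "\<forall>j\<in>K. \<exists>B. A j = Y j -` B" by (auto simp: space)
      then obtain B where B: "\<And>j. j \<in> K \<Longrightarrow> A j = Y j -` B j" by metis
      have Aj: "A j = from_nat_into S -` ((\<lambda>f. f j) -` B j)" if "j \<in> K" for j
        unfolding B[OF that] by (auto simp: Y_def)
      have "(\<Inter>j\<in>K. A j) = from_nat_into S -` (\<Inter>j\<in>K. (\<lambda>f. f j) -` B j)"
        using Aj by auto
      then have "prob (\<Inter>j\<in>K. A j) = measure M (\<Inter>j\<in>K. (\<lambda>f. f j) -` B j)"
        by (simp only: meas)
      also have "\<dots> = (\<Prod>j\<in>K. measure M ((\<lambda>f. f j) -` B j))"
        using prob_space.indep_varsD[OF prob_space_measure_pmf indep_vars_Pi_pmf[OF J, of 0 q] K(1,3,2), of B]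
        by (simp add: M_def)
      also have "\<dots> = (\<Prod>j\<in>K. prob (A j))"
        using Aj meas by (intro prod.cong) auto
      finally show "prob (\<Inter>j\<in>K. A j) = (\<Prod>j\<in>K. prob (A j))" .
    qed (auto simp: space)
  qed
  have "ent P (Y j) = x j" if j: "j \<in> J" for j
  proof -
    have prb: "prb (Y j) k = pmf (q j) k" for k
    proof -
      have "prb (Y j) k = prob (from_nat_into S -` ((\<lambda>f. f j) -` {k}))"
        unfolding prb_def space by (rule arg_cong[where f = prob]) (auto simp: Y_def)
      also have "\<dots> = measure (map_pmf (\<lambda>f. f j) M) {k}"
        by (simp add: meas measure_map_pmf)
      also have "map_pmf (\<lambda>f. f j) M = q j"
        unfolding M_def using J j by (simp add: Pi_pmf_component)
      finally show ?thesis by (simp add: measure_pmf_single)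
    qed
    have "Y j ` space P \<subseteq> {..<n j}"
    proof
      fix k assume "k \<in> Y j ` space P"
      then obtain f where "f \<in> S" "k = f j"
        using from_nat_into[OF S(2)] by (auto simp: Y_def)
      then have "k \<in> set_pmf (map_pmf (\<lambda>f. f j) M)" by (simp add: S_def)
      also have "map_pmf (\<lambda>f. f j) M = q j"
        unfolding M_def using J j by (simp add: Pi_pmf_component)
      finally show "k \<in> {..<n j}" using q[OF j] by blast
    qed
    then have "ent P (Y j) = - (\<Sum>k<n j. prb (Y j) k * log 2 (prb (Y j) k))"
      using sf by (intro ent_sum_superset) auto
    then show ?thesis using ent[OF j] by (simp add: prb)
  qed
  then show ?thesis
    using sf ind finite_source_axioms by blast
qed

section \<open>Walks, and codes that forward along them\<close>

primrec walk :: "edge set \<Rightarrow> vertex \<Rightarrow> arc list \<Rightarrow> vertex \<Rightarrow> bool" where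
  "walk E u [] v \<longleftrightarrow> u = v"
| "walk E u (a # p) v \<longleftrightarrow> a \<in> arcset E \<and> fst a = u \<and> walk E (snd a) p v"

lemma walk_arcs: "walk E u p v \<Longrightarrow> set p \<subseteq> arcset E"
  by (induction p arbitrary: u) auto

lemma walk_nth_arc: "walk E u p v \<Longrightarrow> i < length p \<Longrightarrow> p ! i \<in> arcset E"
  by (rule subsetD[OF walk_arcs nth_mem])

lemma walk_nth_0: "walk E u p v \<Longrightarrow> p \<noteq> [] \<Longrightarrow> fst (p ! 0) = u"
  by (cases p) auto

lemma walk_nth_Suc: "walk E u p v \<Longrightarrow> Suc i < length p \<Longrightarrow> fst (p ! Suc i) = snd (p ! i)"
proof (induction p arbitrary: u i)
  case (Cons a p)
  then show ?case
    using walk_nth_0[of E "snd a" p v] by (cases i) auto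
qed simp

lemma walk_last: "walk E u p v \<Longrightarrow> p \<noteq> [] \<Longrightarrow> snd (p ! (length p - 1)) = v"
proof (induction p arbitrary: u)
  case (Cons a p)
  then show ?case by (cases "p = []") auto
qed simp

text \<open>A fractional flow in path form: \<open>x (h, p)\<close> is the amount that session
  \<open>h\<close> sends along \<open>p\<close>. A session may use several walks, and one of rate
  zero may have none.\<close>

locale path_family =
  fixes V :: "vertex set" and E :: "edge set" and H :: "session set" and r :: "session \<Rightarrow> real"
    and J :: "(session \<times> arc list) set" and x :: "session \<times> arc list \<Rightarrow> real"
  assumes graph: "finite_graph V E" and sessions: "session_set V H" and finJ: "finite J"
    and J: "\<And>h p. (h, p) \<in> J \<Longrightarrow> h \<in> H \<and> walk E (source h) p (sink h)"
    and x: "\<And>j. j \<in> J \<Longrightarrow> 0 \<le> x j"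
    and rate: "\<And>h. h \<in> H \<Longrightarrow> r h = (\<Sum>j | j \<in> J \<and> fst j = h. x j)"
begin

text \<open>Every pair \<open>j\<close> in \<open>J\<close> gets its own independent variable
  \<open>Y j\<close> of entropy \<open>x j\<close>, and a message is the tuple of the variables of
  its walks. Each symbol is a single \<open>Y j\<close> or the constant 0, so it depends on at most
  one message.\<close>

theorem path_code:
  shows "\<exists>C. coding_solution V E H r C \<and>
    (\<forall>a. coding_flow C a \<le> (\<Sum>j | j \<in> J \<and> a \<in> set (snd j). x j)) \<and>
    (\<forall>i\<in>H. \<forall>j\<in>H. i \<noteq> j \<longrightarrow> (\<forall>e\<in>E. \<forall>a\<in>arcs_of e. \<forall>t<rounds C.
      cond_mi (Pr C) (symbol C a t) (message C i) (messages C (H - {i})) *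
      cond_mi (Pr C) (symbol C a t) (message C j) (messages C (H - {j})) = 0))"
proof -
  obtain js where js: "set js = J" "distinct js" using finJ finite_distinct_list by blast
  have "\<forall>j\<in>J. 0 \<le> x j" using x by blast
  from independent_variables[OF finJ this] obtain P and Y :: "session \<times> arc list \<Rightarrow> nat \<Rightarrow> nat"
    where P: "finite_source P"
    and Y: "\<forall>j\<in>J. simple_function P (Y j)" and indY: "prob_space.indep_vars P (\<lambda>_. count_space UNIV) Y J"
    and entY: "\<forall>j\<in>J. ent P (Y j) = x j"
    by metis
  have sfY: "simple_function P (Y j)" if "j \<in> J" for j
    using Y that by blast
  interpret P: finite_source P by fact
  \<comment> \<open>A common strict bound on all lengths, so that every walk fits into its own slot
    of \<open>L\<close> rounds; \<open>Suc\<close> keeps \<open>L\<close> positive for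
    \<open>div\<close> and \<open>mod\<close>.\<close>
  define L where "L = Suc (\<Sum>j\<in>J. length (snd j))"
  have L: "length p < L" if "(h, p) \<in> J" for h p
    using member_le_sum[OF that, of "\<lambda>j. length (snd j)"] finJ by (simp add: L_def)
  \<comment> \<open>Round \<open>k * L + i\<close> is reserved for the \<open>i\<close>-th arc of the \<open>k\<close>-th path.\<close>
  define C where "C = \<lparr>Pr = P, blocklength = 1, rounds = length js * L,
     message = (\<lambda>h. pack js Y {j \<in> J. fst j = h}),
     symbol = (\<lambda>a t \<omega>.
       if t mod L < length (snd (js ! (t div L))) \<and> snd (js ! (t div L)) ! (t mod L) = a
       then Y (js ! (t div L)) \<omega> else 0)\<rparr>"
  have Pr [simp]: "Pr C = P" and rounds [simp]: "rounds C = length js * L" by (simp_all add: C_def)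
  have js_nth: "js ! (t div L) \<in> J" if "t < length js * L" for t
  proof -
    have "t div L < length js" using that by (simp add: less_mult_imp_div_less)
    then show ?thesis using js nth_mem by blast
  qed
  have message_eq_iff: "message C h \<omega> = message C h \<omega>' \<longleftrightarrow> (\<forall>p. (h, p) \<in> J \<longrightarrow> Y (h, p) \<omega> = Y (h, p) \<omega>')"
    for h \<omega> \<omega>'
    by (auto simp: C_def pack_eq_iff js)
  have step: "i < length p \<Longrightarrow> (h, p) = js ! k \<Longrightarrow> k < length js \<Longrightarrow>
      symbol C (p ! i) (k * L + i) \<omega> = Y (h, p) \<omega> \<and> k * L + i < length js * L" for h p i k \<omega>
  proof -
    assume i: "i < length p" and k: "(h, p) = js ! k" "k < length js"
    then have "(h, p) \<in> J" using js by (metis nth_mem)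
    then have "i < L" using L[of h p] i by simp
    moreover from this k have "k * L + i < length js * L"
      using mult_le_mono1[of "Suc k" "length js" L] by simp
    ultimately show "symbol C (p ! i) (k * L + i) \<omega> = Y (h, p) \<omega> \<and> k * L + i < length js * L"
      using i k(1)[symmetric] by (simp add: C_def)
  qed
  have solution: "coding_solution V E H r C"
    unfolding coding_solution_def
  proof (intro conjI ballI allI impI)
    show "prob_space (Pr C)" "0 < blocklength C"
      by (simp_all add: C_def P.prob_space_axioms)
    show "simple_function (Pr C) (message C h)" for h
      unfolding C_def code.simps using sfY by (intro P.sf_pack) auto
    show "prob_space.indep_vars (Pr C) (\<lambda>_. count_space UNIV) (message C) H"
      unfolding C_def code.simps using indY
      by (rule P.indep_vars_pack) (auto simp: disjoint_family_on_def)
    show "ent (Pr C) (message C h) / blocklength C = r h" if "h \<in> H" for h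
    proof -
      have "ent P (pack js Y {j \<in> J. fst j = h}) = (\<Sum>j | j \<in> J \<and> fst j = h. ent P (Y j))"
        using sfY indY js by (intro P.ent_pack) (auto intro: P.indep_vars_subset)
      then show ?thesis
        using entY rate[OF that] by (simp add: C_def)
    qed
  next
    fix h assume h: "h \<in> H"
    show "function_of (Pr C) (message C h) (knowledge V E H C (sink h) (rounds C))"
      unfolding Pr P.function_of_iff message_eq_iff
    proof (intro ballI allI impI)
      fix \<omega> \<omega>' p assume eq: "knowledge V E H C (sink h) (rounds C) \<omega> = knowledge V E H C (sink h) (rounds C) \<omega>'"
        and p: "(h, p) \<in> J"
      then have walk: "walk E (source h) p (sink h)" using J by blast
      show "Y (h, p) \<omega> = Y (h, p) \<omega>'"
      proof (cases "p = []")
        \<comment> \<open>An empty walk means that the sink is the source and generates the message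
          itself.\<close>
        case True
        then show ?thesis
          using knowledge_message[OF eq h] walk p by (simp add: message_eq_iff)
      next
        case False
        obtain k where k: "k < length js" "(h, p) = js ! k"
          using p js by (metis in_set_conv_nth)
        let ?i = "length p - 1"
        obtain u where u: "p ! ?i = (u, sink h)"
          using walk_last[OF walk False] by (metis prod.collapse)
        have arc: "(u, sink h) \<in> arcset E"
          using walk_nth_arc[OF walk, of ?i] False unfolding u by fastforce
        have Y: "symbol C (u, sink h) (k * L + ?i) \<omega> = Y (h, p) \<omega> \<and> k * L + ?i < rounds C" for \<omega>
          using step[of ?i p h k \<omega>] False k unfolding u rounds by fastforce
        then show ?thesis
          using knowledge_symbol[OF eq arc, of "k * L + ?i"] by metis
      qed
    qed
  next
    fix a t assume t: "t < rounds C"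
    obtain h p i k where hpik: "(h, p) = js ! (t div L)" "i = t mod L" "k = t div L"
      by (metis surj_pair)
    have hp: "(h, p) \<in> J" using js_nth t hpik by simp
    then have walk: "walk E (source h) p (sink h)" and h: "h \<in> H" using J by auto
    have k: "k < length js" using t by (simp add: hpik less_mult_imp_div_less)
    show "function_of (Pr C) (symbol C a t) (knowledge V E H C (fst a) t)"
    proof (cases "i < length p \<and> p ! i = a")
      case False
      then have "symbol C a t \<omega> = 0" for \<omega>
        using hpik(1)[symmetric] hpik(2) by (auto simp: C_def)
      then show ?thesis by (simp add: P.function_of_iff)
    next
      case True
      have Y_eq: "Y (h, p) \<omega> = Y (h, p) \<omega>'"
        if eq: "knowledge V E H C (fst a) t \<omega> = knowledge V E H C (fst a) t \<omega>'" for \<omega> \<omega>'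
      proof (cases i)
        case 0
        then have "fst a = source h" using walk_nth_0[OF walk] True by auto
        then show ?thesis
          using knowledge_message[OF eq h] hp by (simp add: message_eq_iff)
      next
        case (Suc i')
        have i': "i' < length p" using True Suc by simp
        obtain u where u: "p ! i' = (u, fst a)"
          using walk_nth_Suc[OF walk, of i'] True Suc by (metis prod.collapse)
        have arc: "(u, fst a) \<in> arcset E"
          using walk_nth_arc[OF walk i'] unfolding u by fastforce
        \<comment> \<open>The preceding arc of the walk is served one round earlier in the same
          slot, so its symbol has already arrived.\<close>
        have less: "k * L + i' < t"
          using div_mult_mod_eq[of t L] unfolding hpik(2,3)[symmetric] Suc by linarith
        have Y: "symbol C (u, fst a) (k * L + i') \<omega> = Y (h, p) \<omega>" for \<omega>
          using step[of i' p h k \<omega>] i' k hpik(1,3) unfolding u by fastforce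
        show ?thesis
          using knowledge_symbol[OF eq arc less] unfolding Y .
      qed
      have "symbol C a t \<omega> = Y (h, p) \<omega>" for \<omega>
        using True hpik(1)[symmetric] hpik(2) by (auto simp: C_def)
      then have sym: "symbol C a t = Y (h, p)" by (rule ext)
      show ?thesis
        unfolding Pr P.function_of_iff sym by (intro ballI impI Y_eq)
    qed
  qed
  interpret coded_network V E H r C
    using graph sessions solution by unfold_locales
  have symbol_cases: "(\<forall>\<omega>. symbol C a t \<omega> = 0) \<or> (\<exists>j\<in>J. a \<in> set (snd j) \<and> (\<forall>\<omega>. symbol C a t \<omega> = Y j \<omega>))"
    if "t < rounds C" for a t
  proof (cases "t mod L < length (snd (js ! (t div L))) \<and> snd (js ! (t div L)) ! (t mod L) = a")
    case True
    then show ?thesis using js_nth[of t] that by (auto simp: C_def intro!: bexI[of _ "js ! (t div L)"])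
  next
    case False
    then show ?thesis by (auto simp: C_def)
  qed
  have flow: "coding_flow C a \<le> (\<Sum>j | j \<in> J \<and> a \<in> set (snd j). x j)" for a
  proof -
    let ?J = "{j \<in> J. a \<in> set (snd j)}"
    have fin: "finite ?J" using finJ by simp
    have "function_of P (transmission C a) (\<lambda>\<omega>. \<lambda>j\<in>?J. Y j \<omega>)"
      unfolding P.function_of_iff transmission_eq_iff
    proof (intro ballI impI allI)
      fix \<omega> \<omega>' t assume eq: "(\<lambda>j\<in>?J. Y j \<omega>) = (\<lambda>j\<in>?J. Y j \<omega>')" and t: "t < rounds C"
      have "Y j \<omega> = Y j \<omega>'" if "j \<in> ?J" for j
        using fun_cong[OF eq, of j] that by simp
      then show "symbol C a t \<omega> = symbol C a t \<omega>'"
        using symbol_cases[OF t, of a] by auto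
    qed
    then have "ent P (transmission C a) \<le> ent P (\<lambda>\<omega>. \<lambda>j\<in>?J. Y j \<omega>)"
      using fin sfY by (intro P.ent_mono P.sf_tuple) auto
    also have "\<dots> \<le> (\<Sum>j\<in>?J. ent P (Y j))"
      using fin sfY by (intro P.ent_tuple_le) auto
    also have "\<dots> = (\<Sum>j\<in>?J. x j)" using entY by simp
    finally show ?thesis by (simp add: coding_flow_def) (simp add: C_def)
  qed
  have zero: "cent (symbol C a t) (messages C (H - {i})) = 0"
    if "t < rounds C" "\<And>\<omega>. symbol C a t \<omega> = 0 \<or> (\<exists>j\<in>J. fst j \<noteq> i \<and> symbol C a t = Y j)" for a t i
  proof -
    have "function_of (Pr C) (symbol C a t) (messages C (H - {i}))"
      unfolding function_of_iff
    proof (intro ballI impI)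
      fix \<omega> \<omega>' assume eq: "messages C (H - {i}) \<omega> = messages C (H - {i}) \<omega>'"
      show "symbol C a t \<omega> = symbol C a t \<omega>'"
      proof (cases "\<exists>j\<in>J. fst j \<noteq> i \<and> symbol C a t = Y j")
        case True
        then obtain h p where j: "(h, p) \<in> J" "h \<noteq> i" "symbol C a t = Y (h, p)" by auto
        then have "message C h \<omega> = message C h \<omega>'"
          using fun_cong[OF eq, of h] J by (simp add: messages_def)
        then show ?thesis using j by (simp add: message_eq_iff)
      next
        case False
        then show ?thesis using that(2)[of \<omega>] that(2)[of \<omega>'] by metis
      qed
    qed
    then have "function_of (Pr C) (\<lambda>\<omega>. (symbol C a t \<omega>, messages C (H - {i}) \<omega>)) (messages C (H - {i}))"
      unfolding function_of_iff prod.inject by blast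
    moreover have "function_of (Pr C) (messages C (H - {i})) (\<lambda>\<omega>. (symbol C a t \<omega>, messages C (H - {i}) \<omega>))"
      unfolding function_of_iff prod.inject by blast
    ultimately have "ent (Pr C) (\<lambda>\<omega>. (symbol C a t \<omega>, messages C (H - {i}) \<omega>)) = ent (Pr C) (messages C (H - {i}))"
      using sf_messages by (intro ent_cong) auto
    then show ?thesis unfolding cent_def by simp
  qed
  have ind: "cond_mi (Pr C) (symbol C a t) (message C i) (messages C (H - {i})) *
      cond_mi (Pr C) (symbol C a t) (message C j) (messages C (H - {j})) = 0"
    if ij: "i \<in> H" "j \<in> H" "i \<noteq> j" and a: "e \<in> E" "a \<in> arcs_of e" and t: "t < rounds C" for i j e a t
  proof -
    have a': "a \<in> arcset E" using arcs_of_subset[OF a(1)] a(2) by blast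
    have "cent (symbol C a t) (messages C (H - {i})) = 0 \<or> cent (symbol C a t) (messages C (H - {j})) = 0"
      using symbol_cases[OF t, of a]
    proof
      assume "\<forall>\<omega>. symbol C a t \<omega> = 0"
      then show ?thesis using zero[OF t] by blast
    next
      assume "\<exists>j\<in>J. a \<in> set (snd j) \<and> (\<forall>\<omega>. symbol C a t \<omega> = Y j \<omega>)"
      then obtain l where l: "l \<in> J" "symbol C a t = Y l" by blast
      then have "fst l \<noteq> i \<or> fst l \<noteq> j" using ij by blast
      then show ?thesis using zero[OF t, of a] l by blast
    qed
    then show ?thesis
      unfolding cond_mi_symbol[OF ij(1) a' t] cond_mi_symbol[OF ij(2) a' t] mult_eq_0_iff .
  qed
  show ?thesis
    by (intro exI[of _ C] conjI allI ballI impI solution flow ind)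
qed

end

section \<open>Finite metric spaces and reducible pairs\<close>

definition one_point :: "(vertex \<Rightarrow> vertex \<Rightarrow> real) \<Rightarrow> vertex \<Rightarrow> (vertex \<Rightarrow> real) \<Rightarrow> vertex \<Rightarrow> vertex \<Rightarrow> real" where
  "one_point d x p u v = (if u = x then if v = x then 0 else p v else if v = x then p u else d u v)"

text \<open>The two conditions on \<open>p\<close> are those of a Katetov function: exactly the
  triangle inequalities that involve the new point, with \<open>p\<close> as the distances to
  it.\<close>

lemma pmetric_one_point:
  assumes d: "pmetric V d" and x: "x \<notin> V"
    and p1: "\<And>u v. u \<in> V \<Longrightarrow> v \<in> V \<Longrightarrow> p u \<le> d u v + p v"
    and p2: "\<And>u v. u \<in> V \<Longrightarrow> v \<in> V \<Longrightarrow> d u v \<le> p u + p v"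
  shows "pmetric (insert x V) (one_point d x p)"
proof -
  have p0: "0 \<le> p v" if "v \<in> V" for v
    using p2[OF that that] pmetric_refl[OF d that] by simp
  have p3: "p v \<le> p u + d u v" if "u \<in> V" "v \<in> V" for u v
    using p1[OF that(2,1)] pmetric_sym[OF d that] by simp
  have "one_point d x p u w \<le> one_point d x p u v + one_point d x p v w"
    if "u \<in> insert x V" "v \<in> insert x V" "w \<in> insert x V" for u v w
    using that x p0 p1 p2 p3 pmetric_triangle[OF d] pmetric_refl[OF d]
    by (auto simp: one_point_def)
  moreover have "one_point d x p u v = one_point d x p v u"
    if "u \<in> insert x V" "v \<in> insert x V" for u v
    using that pmetric_sym[OF d] by (auto simp: one_point_def)
  moreover have "one_point d x p u u = 0" if "u \<in> insert x V" for u
    using that pmetric_refl[OF d] by (auto simp: one_point_def)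
  ultimately show ?thesis
    unfolding pmetric_def by blast
qed

text \<open>The new point is joined to \<open>p1\<close> and \<open>p2\<close> by edges of lengths \<open>a\<close> and \<open>b\<close>; by the inequality
  there is a difference \<open>b - a\<close> for which \<open>q1\<close> is best reached through \<open>p1\<close> and \<open>q2\<close> through \<open>p2\<close>.\<close>

lemma common_extension:
  assumes d: "pmetric V d" and x: "x \<notin> V" and V: "p1 \<in> V" "p2 \<in> V" "q1 \<in> V" "q2 \<in> V"
    and le: "d p1 q1 + d p2 q2 \<le> d p1 q2 + d p2 q1"
  obtains d' where "pmetric (insert x V) d'" "\<And>u v. u \<in> V \<Longrightarrow> v \<in> V \<Longrightarrow> d' u v = d u v"
    "d' x q1 = d' x p1 + d p1 q1" "d' x q2 = d' x p2 + d p2 q2"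
proof -
  \<comment> \<open>\<open>b\<close> is chosen so that \<open>q1\<close> is equally far from
    \<open>x\<close> through \<open>p1\<close> and through \<open>p2\<close>; \<open>le\<close> then
    says that the route through \<open>p2\<close> is at least as good for \<open>q2\<close>. The
    choice of \<open>a\<close> makes both edges at least \<open>d p1 p2\<close> long, so that a
    detour through \<open>x\<close> never shortens a distance.\<close>
  define a where "a = 2 * d p1 p2"
  define b where "b = a + d p1 q1 - d p2 q1"
  define p where "p v = min (a + d p1 v) (b + d p2 v)" for v
  note tri = pmetric_triangle[OF d] and sym = pmetric_sym[OF d] and nn = pmetric_nonneg[OF d]
    and refl = pmetric_refl[OF d]
  have b: "d p1 p2 \<le> b" "b \<le> a + d p1 p2" "a \<le> b + d p1 p2"
    using tri[of p2 p1 q1] tri[of p1 p2 q1] sym[of p1 p2] V by (auto simp: a_def b_def)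
  have "pmetric (insert x V) (one_point d x p)"
  proof (rule pmetric_one_point[OF d x])
    fix u v assume uv: "u \<in> V" "v \<in> V"
    show "p u \<le> d u v + p v"
      using tri[of p1 v u] tri[of p2 v u] sym[of u v] uv V by (auto simp: p_def min_def)
    have "d u v \<le> d p1 u + d p1 v" "d u v \<le> d p2 u + d p2 v"
      using tri[of u p1 v] tri[of u p2 v] sym[of u p1] sym[of u p2] uv V by auto
    moreover have "d u v \<le> d p1 u + d p1 p2 + d p2 v" "d u v \<le> d p2 u + d p1 p2 + d p1 v"
      using tri[of u p1 v] tri[of p1 p2 v] tri[of u p2 v] tri[of p2 p1 v]
        sym[of u p1] sym[of u p2] sym[of p1 p2] uv V by auto
    ultimately show "d u v \<le> p u + p v"
      using b nn[of p1 p2] V by (auto simp: p_def a_def min_def)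
  qed
  moreover have "one_point d x p u v = d u v" if "u \<in> V" "v \<in> V" for u v
    using that x by (auto simp: one_point_def)
  moreover have "p p1 = a" "p p2 = b"
    using b refl sym[of p1 p2] V by (auto simp: p_def)
  moreover have "p q1 = a + d p1 q1" "p q2 = b + d p2 q2"
    using le by (auto simp: p_def b_def)
  moreover have "one_point d x p x v = p v" if "v \<in> V" for v
    using that x by (auto simp: one_point_def)
  ultimately show thesis
    using that[of "one_point d x p"] V by metis
qed

text \<open>Two applications of \<open>common_extension\<close>. First \<open>x\<close> is attached
  at \<open>s1\<close> and \<open>s2\<close>, towards \<open>t1\<close> and \<open>t2\<close>. Then
  \<open>y\<close> is attached at \<open>t1\<close> and \<open>t2\<close>, both towards the same
  target \<open>x\<close>, for which the required inequality is an equality.\<close>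

lemma merging_extension:
  assumes d: "pmetric V d" and V: "finite V" "s1 \<in> V" "s2 \<in> V" "t1 \<in> V" "t2 \<in> V"
    and le: "d s1 t1 + d s2 t2 \<le> d s1 t2 + d s2 t1"
  obtains x y d' where "x \<notin> V" "y \<notin> V" "x \<noteq> y" "pmetric (insert y (insert x V)) d'"
    "\<And>u v. u \<in> V \<Longrightarrow> v \<in> V \<Longrightarrow> d' u v = d u v"
    "d' x y = d' x s1 + d s1 t1 + d' t1 y" "d' x y = d' x s2 + d s2 t2 + d' t2 y"
proof -
  obtain x where x: "x \<notin> V"
    using ex_new_if_finite[OF infinite_UNIV_nat V(1)] by blast
  obtain y where y: "y \<notin> insert x V"
    using ex_new_if_finite[OF infinite_UNIV_nat, of "insert x V"] V(1) by blast
  obtain d1 where d1: "pmetric (insert x V) d1" "\<And>u v. u \<in> V \<Longrightarrow> v \<in> V \<Longrightarrow> d1 u v = d u v"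
    "d1 x t1 = d1 x s1 + d s1 t1" "d1 x t2 = d1 x s2 + d s2 t2"
    using common_extension[OF d x V(2-5) le] by blast
  obtain d2 where d2: "pmetric (insert y (insert x V)) d2"
    "\<And>u v. u \<in> insert x V \<Longrightarrow> v \<in> insert x V \<Longrightarrow> d2 u v = d1 u v"
    "d2 y x = d2 y t1 + d1 t1 x" "d2 y x = d2 y t2 + d1 t2 x"
    using common_extension[OF d1(1) y, of t1 t2 x x] V by auto
  have "d2 u v = d u v" if "u \<in> V" "v \<in> V" for u v
    using d1(2) d2(2) that by simp
  moreover have "d2 x y = d2 y x" "d2 t1 y = d2 y t1" "d2 t2 y = d2 y t2"
    using V by (auto intro: pmetric_sym[OF d2(1)])
  moreover have "d1 t1 x = d1 x t1" "d1 t2 x = d1 x t2"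
    using V by (auto intro: pmetric_sym[OF d1(1)])
  moreover have "d2 x s1 = d1 x s1" "d2 x s2 = d1 x s2"
    using V d2(2) by auto
  ultimately show thesis
    using that[of x y d2] x y d1(3,4) d2(1,3,4) by auto
qed

section \<open>A pseudometric as the shortest-path distance of a complete graph\<close>

lemma wf_bidirected: "finite_graph V E \<Longrightarrow> wf_digraph (bidirected V E)"
  by unfold_locales (auto simp: bidirected_def arcs_of_def finite_graph_def)

lemma awalk_iff_walk:
  assumes "finite_graph V E"
  shows "pre_digraph.awalk (bidirected V E) u p v \<longleftrightarrow> u \<in> V \<and> walk E u p v"
proof -
  have "set p \<subseteq> arcset E \<and> pre_digraph.cas (bidirected V E) u p v \<longleftrightarrow> walk E u p v"
    by (induction p arbitrary: u)
      (auto simp: pre_digraph.cas.simps bidirected_def)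
  then show ?thesis
    unfolding pre_digraph.awalk_def arcs_bidirected by (simp add: bidirected_def)
qed

text \<open>Weights are indexed by unordered edges. \<open>Min\<close> and \<open>Max\<close>
  recover the endpoints, whose order is irrelevant by symmetry.\<close>

definition metric_weight :: "(vertex \<Rightarrow> vertex \<Rightarrow> real) \<Rightarrow> edge \<Rightarrow> real" where
  "metric_weight d e = d (Min e) (Max e)"

lemma metric_weight_doubleton:
  "pmetric V d \<Longrightarrow> u \<in> V \<Longrightarrow> v \<in> V \<Longrightarrow> metric_weight d {u, v} = d u v"
  using pmetric_sym[of V d u v] by (auto simp: metric_weight_def min_def max_def)

text \<open>By the triangle inequality no walk is shorter than the direct arc. The conditions of
  \<open>reducible\<close> thereby turn into inequalities between real numbers.\<close>

lemma wdist_metric: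
  assumes V: "finite V" and d: "pmetric V d" and uv: "u \<in> V" "v \<in> V"
  shows "wdist V (complete_edges V) (metric_weight d) u v = ereal (d u v)"
proof -
  let ?E = "complete_edges V"
  let ?c = "\<lambda>(x, y). metric_weight d {x, y}"
  note graph = finite_graph_complete[OF V]
  interpret wf_digraph "bidirected V ?E"
    using graph by (rule wf_bidirected)
  have "d u v \<le> awalk_cost ?c p" if "walk ?E u p v" "u \<in> V" "v \<in> V" for u p v
    using that
  proof (induction p arbitrary: u)
    case Nil
    then show ?case using pmetric_refl[OF d] by simp
  next
    case (Cons a p)
    obtain w where a: "a = (u, w)" using Cons.prems(1) by (cases a) auto
    then have w: "(u, w) \<in> arcset ?E" "walk ?E w p v" using Cons.prems(1) by auto
    then have "w \<in> V" unfolding arcset_complete by simp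
    then have "d u v \<le> d u w + d w v"
      using pmetric_triangle[OF d] Cons.prems by simp
    then show ?case
      using Cons.IH[OF w(2) \<open>w \<in> V\<close> Cons.prems(3)] metric_weight_doubleton[OF d] \<open>w \<in> V\<close> Cons.prems(2)
      by (simp add: a)
  qed
  then have le: "ereal (d u v) \<le> \<mu> ?c u v"
    unfolding \<mu>_def using uv by (auto simp: awalk_iff_walk[OF graph] intro!: INF_greatest)
  have "\<mu> ?c u v \<le> ereal (d u v)"
  proof (cases "u = v")
    case True
    have "awalk u [] v" using uv True by (simp add: awalk_iff_walk[OF graph])
    then show ?thesis
      using min_cost_le_walk_cost[of u "[]" v ?c] pmetric_refl[OF d] uv True by simp
  next
    case False
    have "awalk u [(u, v)] v"
      using uv False arcset_complete[of u v V] by (simp add: awalk_iff_walk[OF graph])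
    then show ?thesis
      using min_cost_le_walk_cost[of u "[(u, v)]" v ?c] metric_weight_doubleton[OF d] uv by simp
  qed
  then show ?thesis
    unfolding wdist_def using le by (rule antisym)
qed

section \<open>Reduction to irreducible cores by merging\<close>

definition independent_cores :: bool where
  "independent_cores \<longleftrightarrow> (\<forall>V E H w r.
       network_instance V E H w \<longrightarrow> (\<forall>h\<in>H. 0 \<le> r h) \<longrightarrow> connected_demands V E H r \<longrightarrow>
       irreducible_core V E H w \<longrightarrow> independent_sessions V E H r w)"

text \<open>A session and its reversal are exempt from reducibility and may both survive, so the
  induction counts unordered pairs. Distinct sessions that form a reducible pair have different
  \<open>endpoints\<close>.\<close>

definition endpoints :: "session \<Rightarrow> vertex set" where
  "endpoints h = {source h, sink h}"

lemma endpoints_eq_iff: "endpoints h = endpoints h' \<longleftrightarrow> h' = h \<or> h' = prod.swap h"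
  by (cases h; cases h') (auto simp: endpoints_def doubleton_eq_iff)

text \<open>The sessions over \<open>{s1, t1}\<close> and \<open>{s2, t2}\<close>, in both directions, are replaced by sessions
  over a new pair \<open>{x, y}\<close> such that shortest paths from \<open>x\<close> to \<open>y\<close> may pass through either old
  pair; the code extends along these paths.\<close>

lemma merge_pairs:
  assumes V: "finite V" and d: "pmetric V d"
    and sol: "coding_solution V (complete_edges V) H r C" and H: "session_set V H"
    and h: "h1 \<in> H" "h2 \<in> H" "endpoints h1 \<noteq> endpoints h2"
    and ends: "endpoints h1 = {s1, t1}" "endpoints h2 = {s2, t2}"
    and le: "d s1 t1 + d s2 t2 \<le> d s1 t2 + d s2 t1"
    and IH: "\<And>V' d' H' r' C'. finite V' \<Longrightarrow> pmetric V' d' \<Longrightarrow> session_set V' H' \<Longrightarrow>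
      coding_solution V' (complete_edges V') H' r' C' \<Longrightarrow>
      card (endpoints ` H') < card (endpoints ` H) \<Longrightarrow>
      (\<Sum>h\<in>H'. r' h * d' (source h) (sink h))
        \<le> (\<Sum>(u, v)\<in>arcset (complete_edges V'). d' u v * coding_flow C' (u, v))"
  shows "(\<Sum>h\<in>H. r h * d (source h) (sink h))
    \<le> (\<Sum>(u, v)\<in>arcset (complete_edges V). d u v * coding_flow C (u, v))"
proof -
  have HV: "source h \<in> V" "sink h \<in> V" if "h \<in> H" for h
    using H that by (auto simp: session_set_def)
  have st: "s1 \<in> V" "t1 \<in> V" "s2 \<in> V" "t2 \<in> V"
    using HV[OF h(1)] HV[OF h(2)] ends unfolding endpoints_def by (metis doubleton_eq_iff)+
  obtain x y d' where xy: "x \<notin> V" "y \<notin> V" "x \<noteq> y" and d': "pmetric (insert y (insert x V)) d'"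
    and d'_eq: "\<And>u v. u \<in> V \<Longrightarrow> v \<in> V \<Longrightarrow> d' u v = d u v"
    and dxy: "d' x y = d' x s1 + d s1 t1 + d' t1 y" "d' x y = d' x s2 + d s2 t2 + d' t2 y"
    using merging_extension[OF d V st(1,3,2,4) le] by blast
  define V' where "V' = insert y (insert x V)"
  define \<phi> where "\<phi> h = (if h = (s1, t1) \<or> h = (s2, t2) then (x, y)
    else if h = (t1, s1) \<or> h = (t2, s2) then (y, x) else h)" for h
  have \<phi>V': "\<phi> h \<in> V' \<times> V'" if "h \<in> H" for h
    using HV[OF that] by (simp add: \<phi>_def V'_def mem_Times_iff)
  interpret code_extension V "complete_edges V" H r C V' \<phi>
  proof
    show "finite_graph V (complete_edges V)" using V by (rule finite_graph_complete)
    show "\<phi> ` H \<subseteq> V' \<times> V'" using \<phi>V' by blast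
    show "finite V'" "V \<subseteq> V'" using V by (auto simp: V'_def)
  qed (rule H sol)+
  have d'V: "pmetric V' d'" using d' by (simp add: V'_def)
  have geodesic: "d' (source (\<phi> h)) (sink (\<phi> h))
      = d' (source (\<phi> h)) (source h) + d (source h) (sink h) + d' (sink h) (sink (\<phi> h))" if "h \<in> H" for h
  proof -
    have sym: "d' u v = d' v u" if "u \<in> V'" "v \<in> V'" for u v
      using pmetric_sym[OF d'V] that by blast
    have "x \<in> V'" "y \<in> V'" "s1 \<in> V'" "s2 \<in> V'" "t1 \<in> V'" "t2 \<in> V'"
      using st by (auto simp: V'_def)
    then have "d' y x = d' y t1 + d t1 s1 + d' s1 x" "d' y x = d' y t2 + d t2 s2 + d' s2 x"
      using dxy sym[of y x] sym[of y t1] sym[of s1 x] sym[of y t2] sym[of s2 x]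
        pmetric_sym[OF d st(1,2)] pmetric_sym[OF d st(3,4)] by linarith+
    moreover have "d' (source h) (source h) = 0" "d' (sink h) (sink h) = 0"
      "d' (source h) (sink h) = d (source h) (sink h)"
      using HV[OF that] d'_eq pmetric_refl[OF d] by auto
    ultimately show ?thesis
      using dxy by (auto simp: \<phi>_def)
  qed
  \<comment> \<open>Two unordered pairs disappear and only \<open>{x, y}\<close> is added. For the
    old ones to disappear, \<open>\<phi>\<close> has to move the reversals along, to
    \<open>(y, x)\<close>.\<close>
  have "card (endpoints ` \<phi> ` H) < card (endpoints ` H)"
  proof -
    let ?U = "endpoints ` H"
    have fin: "finite ?U" using finite_sessions by simp
    have two: "2 \<le> card ?U"
      using card_mono[OF fin, of "{endpoints h1, endpoints h2}"] h by simp
    have "endpoints (\<phi> h) \<in> insert {x, y} (?U - {{s1, t1}, {s2, t2}})" if "h \<in> H" for h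
    proof (cases "endpoints h \<in> {{s1, t1}, {s2, t2}}")
      case True
      then show ?thesis
        by (cases h) (auto simp: \<phi>_def endpoints_def doubleton_eq_iff)
    next
      case False
      have "endpoints (s1, t1) = {s1, t1}" "endpoints (s2, t2) = {s2, t2}"
        "endpoints (t1, s1) = {s1, t1}" "endpoints (t2, s2) = {s2, t2}"
        by (simp_all add: endpoints_def insert_commute)
      then have "h \<noteq> (s1, t1)" "h \<noteq> (s2, t2)" "h \<noteq> (t1, s1)" "h \<noteq> (t2, s2)"
        using False by blast+
      then have "\<phi> h = h"
        by (simp add: \<phi>_def)
      then show ?thesis using False that by simp
    qed
    then have "endpoints ` \<phi> ` H \<subseteq> insert {x, y} (?U - {{s1, t1}, {s2, t2}})"
      unfolding image_image by (rule image_subsetI)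
    then have "card (endpoints ` \<phi> ` H) \<le> card (insert {x, y} (?U - {{s1, t1}, {s2, t2}}))"
      using fin by (intro card_mono finite.insertI finite_Diff)
    also have "\<dots> \<le> Suc (card (?U - {{s1, t1}, {s2, t2}}))"
      using fin by (simp add: card_insert_if)
    also have "card (?U - {{s1, t1}, {s2, t2}}) = card ?U - 2"
      unfolding ends[symmetric] using h by (subst card_Diff_subset) auto
    also have "Suc (card ?U - 2) < card ?U" using two by simp
    finally show ?thesis .
  qed
  moreover have "session_set V' (\<phi> ` H)"
    using \<phi> finite_sessions by (simp add: session_set_def)
  ultimately have "(\<Sum>k\<in>\<phi> ` H. extended_rate k * d' (source k) (sink k))
      \<le> (\<Sum>(u, v)\<in>arcset E'. d' u v * coding_flow extended (u, v))"
    using IH[OF V'(1) d'V _ extended_coding_solution] by blast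
  also have "\<dots> \<le> (\<Sum>(u, v)\<in>arcset (complete_edges V). d' u v * coding_flow C (u, v))
      + (\<Sum>h\<in>H. r h * (d' (source (\<phi> h)) (source h) + d' (sink h) (sink (\<phi> h))))"
    by (rule extended_cost[OF d'V])
  also have "(\<Sum>(u, v)\<in>arcset (complete_edges V). d' u v * coding_flow C (u, v))
      = (\<Sum>(u, v)\<in>arcset (complete_edges V). d u v * coding_flow C (u, v))"
  proof (intro sum.cong refl, clarify)
    fix u v assume "{u, v} \<in> complete_edges V"
    then show "d' u v * coding_flow C (u, v) = d u v * coding_flow C (u, v)"
      using arcset_complete[of u v V] d'_eq by simp
  qed
  also have "(\<Sum>k\<in>\<phi> ` H. extended_rate k * d' (source k) (sink k))
      = (\<Sum>h\<in>H. r h * d' (source (\<phi> h)) (sink (\<phi> h)))"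
  proof -
    have "(\<Sum>k\<in>\<phi> ` H. extended_rate k * d' (source k) (sink k))
        = (\<Sum>k\<in>\<phi> ` H. \<Sum>h | h \<in> H \<and> \<phi> h = k. r h * d' (source (\<phi> h)) (sink (\<phi> h)))"
      by (auto simp: extended_rate_def sum_distrib_right intro!: sum.cong)
    also have "\<dots> = (\<Sum>h\<in>H. r h * d' (source (\<phi> h)) (sink (\<phi> h)))"
      using finite_sessions by (intro sum.group) auto
    finally show ?thesis .
  qed
  also have "\<dots> = (\<Sum>h\<in>H. r h * d (source h) (sink h))
      + (\<Sum>h\<in>H. r h * (d' (source (\<phi> h)) (source h) + d' (sink h) (sink (\<phi> h))))"
    unfolding sum.distrib[symmetric] using geodesic by (intro sum.cong) (simp_all add: algebra_simps)
  finally show ?thesis by simp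
qed

text \<open>For an irreducible core, independence yields a minimum-cost code that obeys the bound,
  and \<open>C\<close> costs at least as much. Otherwise a reducible pair is merged and the
  induction hypothesis is applied to the extended code over a larger vertex set, which is why
  everything but \<open>cores\<close> is generalised.\<close>

theorem metric_cost_bound:
  assumes cores: independent_cores
    and "finite V" "pmetric V d" "session_set V H" "coding_solution V (complete_edges V) H r C"
  shows "(\<Sum>h\<in>H. r h * d (source h) (sink h))
    \<le> (\<Sum>(u, v)\<in>arcset (complete_edges V). d u v * coding_flow C (u, v))"
  using assms(2-)
proof (induction "card (endpoints ` H)" arbitrary: V d H r C rule: less_induct)
  case less
  note V = less.prems(1) and d = less.prems(2) and H = less.prems(3) and sol = less.prems(4)
  let ?E = "complete_edges V" and ?w = "metric_weight d"
  note graph = finite_graph_complete[OF V]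
  interpret coded_network V ?E H r C
    using graph H sol by unfold_locales
  have HV: "source h \<in> V" "sink h \<in> V" if "h \<in> H" for h
    using H that by (auto simp: session_set_def)
  show ?case
  proof (cases "irreducible_core V ?E H ?w")
    case True
    have "network_instance V ?E H ?w"
      unfolding network_instance_def
    proof (intro conjI ballI)
      fix e assume "e \<in> ?E"
      then obtain u v where "e = {u, v}" "u \<in> V" "v \<in> V"
        by (auto simp: complete_edges_def card_2_iff)
      then show "0 \<le> ?w e"
        using metric_weight_doubleton[OF d] pmetric_nonneg[OF d] by simp
    qed (use graph H in auto)
    then have "independent_sessions V ?E H r ?w"
      using cores True rate_nonneg connected_demands unfolding independent_cores_def by blast
    then obtain C' where C': "min_cost_coding_solution V ?E H r ?w C'"
      and ind: "\<And>i j e a t. i \<in> H \<Longrightarrow> j \<in> H \<Longrightarrow> i \<noteq> j \<Longrightarrow> e \<in> ?E \<Longrightarrow> a \<in> arcs_of e \<Longrightarrow> t < rounds C' \<Longrightarrow>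
        cond_mi (Pr C') (symbol C' a t) (message C' i) (messages C' (H - {i})) *
        cond_mi (Pr C') (symbol C' a t) (message C' j) (messages C' (H - {j})) = 0"
      unfolding independent_sessions_def by blast
    interpret C': coded_network V ?E H r C'
      using graph H C' by unfold_locales (auto simp: min_cost_coding_solution_def)
    have cost: "coding_cost ?E ?w D = (\<Sum>(u, v)\<in>arcset ?E. d u v * coding_flow D (u, v))" for D
      unfolding coding_cost_def sum_edge_flow[OF graph]
    proof (intro sum.cong refl, clarify)
      fix u v assume "{u, v} \<in> ?E"
      then show "?w {u, v} * coding_flow D (u, v) = d u v * coding_flow D (u, v)"
        using arcset_complete[of u v V] metric_weight_doubleton[OF d] by simp
    qed
    have "(\<Sum>h\<in>H. r h * d (source h) (sink h)) \<le> coding_cost ?E ?w C'"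
      unfolding cost using ind by (rule C'.independent_cost_bound[OF d])
    also have "\<dots> \<le> coding_cost ?E ?w C"
      using C' sol unfolding min_cost_coding_solution_def by blast
    finally show ?thesis by (simp only: cost)
  next
    case False
    then obtain h1 h2 where h: "h1 \<in> H" "h2 \<in> H" "h1 \<noteq> h2" "reducible V ?E ?w h1 h2"
      unfolding irreducible_core_def by blast
    obtain s1 t1 s2 t2 where st: "h1 = (s1, t1)" "h2 = (s2, t2)"
      by (cases h1; cases h2) blast
    have V4: "s1 \<in> V" "t1 \<in> V" "s2 \<in> V" "t2 \<in> V"
      using HV[OF h(1)] HV[OF h(2)] by (simp_all add: st)
    have ends: "endpoints h1 \<noteq> endpoints h2"
      unfolding endpoints_eq_iff using h(3,4) by (auto simp: st reducible_def Let_def)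
    have "d s1 t1 + d s2 t2 \<le> d s1 t2 + d s2 t1 \<or> d s1 t1 + d s2 t2 \<le> d s1 s2 + d t1 t2"
      using h(4) V4 by (simp add: st reducible_def Let_def wdist_metric[OF V d])
    then show ?thesis
    proof
      assume "d s1 t1 + d s2 t2 \<le> d s1 t2 + d s2 t1"
      then show ?thesis
        using merge_pairs[OF V d sol H h(1,2) ends, of s1 t1 s2 t2] less.hyps
        by (simp add: st endpoints_def)
    next
      \<comment> \<open>Exchanging \<open>s2\<close> and \<open>t2\<close> turns this into the first
        kind. \<open>merge_pairs\<close> fixes only the unordered endpoints of \<open>h2\<close>, so
        it applies with either orientation.\<close>
      assume "d s1 t1 + d s2 t2 \<le> d s1 s2 + d t1 t2"
      then have "d s1 t1 + d t2 s2 \<le> d s1 s2 + d t2 t1"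
        using pmetric_sym[OF d] V4 by metis
      then show ?thesis
        using merge_pairs[OF V d sol H h(1,2) ends, of s1 t1 t2 s2] less.hyps
        by (simp add: st endpoints_def insert_commute)
    qed
  qed
qed

section \<open>Duality\<close>

definition meets_demands ::
  "'j set \<Rightarrow> ('j \<Rightarrow> 'h) \<Rightarrow> 'h set \<Rightarrow> ('h \<Rightarrow> real) \<Rightarrow> ('j \<Rightarrow> real) \<Rightarrow> bool" where
  "meets_demands J f H r x \<longleftrightarrow>
     (\<forall>j\<in>J. 0 \<le> x j) \<and> (\<forall>h\<in>H. (\<Sum>j | j \<in> J \<and> f j = h. x j) = r h)"

text \<open>A minimiser of the squared excess \<open>\<Sum>e. (max 0 (load e - c e))\<^sup>2\<close> over the compact set of
  feasible \<open>x\<close> supplies the weights \<open>w e = max 0 (load e - c e)\<close>; by its first-order optimality,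
  these weights violate the hypothesis unless they vanish.\<close>

lemma load_duality:
  fixes k :: "'e \<Rightarrow> 'j \<Rightarrow> real" and c :: "'e \<Rightarrow> real" and r :: "'h \<Rightarrow> real"
    and J :: "'j set" and H :: "'h set" and f :: "'j \<Rightarrow> 'h" and E :: "'e set"
  defines "feasible \<equiv> meets_demands J f H r"
  assumes fin: "finite J" "finite E" and f: "f ` J \<subseteq> H"
    and dual: "\<And>w. \<forall>e\<in>E. 0 \<le> w e \<Longrightarrow>
      \<exists>y. feasible y \<and> (\<Sum>e\<in>E. w e * (\<Sum>j\<in>J. k e j * y j)) \<le> (\<Sum>e\<in>E. w e * c e)"
  shows "\<exists>x. feasible x \<and> (\<forall>e\<in>E. (\<Sum>j\<in>J. k e j * x j) \<le> c e)"
proof -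
  note feasible_def = meets_demands_def[of J f H r, folded feasible_def]
  define l where "l x e = (\<Sum>j\<in>J. k e j * x j)" for x e
  \<comment> \<open>\<open>feasible\<close> says nothing about coordinates outside \<open>J\<close>.
    Pinning them to 0 makes the set a closed part of a product of compact sets, hence
    compact.\<close>
  define K where "K = {x. (\<forall>j. x j \<in> (if j \<in> J then {0..r (f j)} else {0})) \<and>
    (\<forall>h\<in>H. (\<Sum>j | j \<in> J \<and> f j = h. x j) = r h)}"
  have K_feasible: "feasible x" if "x \<in> K" for x
    using that by (auto simp: K_def feasible_def split: if_splits)
  have feasible_K: "(\<lambda>j. if j \<in> J then x j else 0) \<in> K" if "feasible x" for x
  proof -
    have "x j \<le> r (f j)" if j: "j \<in> J" for j
    proof -
      have "x j \<le> (\<Sum>i | i \<in> J \<and> f i = f j. x i)"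
        using fin j \<open>feasible x\<close> by (intro member_le_sum) (auto simp: feasible_def)
      then show ?thesis using \<open>feasible x\<close> f j by (auto simp: feasible_def)
    qed
    moreover have "(\<Sum>j | j \<in> J \<and> f j = h. if j \<in> J then x j else 0) = (\<Sum>j | j \<in> J \<and> f j = h. x j)" for h
      by (intro sum.cong) auto
    ultimately show ?thesis using that by (auto simp: K_def feasible_def)
  qed
  have compact: "compact K"
  proof -
    define B where "B j = (if j \<in> J then {0..r (f j)} else {0})" for j
    have "compactin (product_topology (\<lambda>_. euclidean) UNIV) (PiE UNIV B)"
      unfolding compactin_PiE by (rule disjI2) (simp add: B_def)
    then have "compact (PiE UNIV B)"
      by (simp add: euclidean_product_topology)
    moreover have "closed {x. \<forall>h\<in>H. (\<Sum>j | j \<in> J \<and> f j = h. x j) = r h}"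
    proof -
      have "closed (\<Inter>h\<in>H. {x. (\<Sum>j | j \<in> J \<and> f j = h. x j) = r h})"
        by (intro closed_INT ballI closed_Collect_eq continuous_on_sum continuous_on_const
            continuous_on_product_coordinates)
      also have "(\<Inter>h\<in>H. {x. (\<Sum>j | j \<in> J \<and> f j = h. x j) = r h})
          = {x. \<forall>h\<in>H. (\<Sum>j | j \<in> J \<and> f j = h. x j) = r h}"
        by blast
      finally show ?thesis .
    qed
    ultimately have "compact (PiE UNIV B \<inter> {x. \<forall>h\<in>H. (\<Sum>j | j \<in> J \<and> f j = h. x j) = r h})"
      by (rule compact_Int_closed)
    also have "\<dots> = K" by (auto simp: K_def B_def PiE_def Pi_def)
    finally show ?thesis .
  qed
  have nonempty: "K \<noteq> {}"
    using dual[of "\<lambda>_. 0"] feasible_K by auto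
  have cont: "continuous_on K (\<lambda>x. \<Sum>e\<in>E. (max 0 (l x e - c e))\<^sup>2)"
    unfolding l_def
    by (intro continuous_intros) (rule continuous_on_subset[OF continuous_on_product_coordinates], simp)
  obtain x where x: "x \<in> K"
    and min: "\<And>y. y \<in> K \<Longrightarrow> (\<Sum>e\<in>E. (max 0 (l x e - c e))\<^sup>2) \<le> (\<Sum>e\<in>E. (max 0 (l y e - c e))\<^sup>2)"
    using continuous_attains_inf[OF compact nonempty cont] by blast
  define w where "w e = max 0 (l x e - c e)" for e
  obtain y' where y': "feasible y'" "(\<Sum>e\<in>E. w e * l y' e) \<le> (\<Sum>e\<in>E. w e * c e)"
    using dual[of w] by (auto simp: w_def l_def)
  define y where "y = (\<lambda>j. if j \<in> J then y' j else 0)"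
  have y: "y \<in> K" unfolding y_def using y'(1) by (rule feasible_K)
  have "l y = l y'" by (auto simp: l_def y_def)
  define b where "b e = l y e - l x e" for e
  define B where "B = (\<Sum>e\<in>E. (b e)\<^sup>2)"
  have B: "0 \<le> B" by (simp add: B_def sum_nonneg)
  have deriv: "0 \<le> 2 * t * (\<Sum>e\<in>E. w e * b e) + t\<^sup>2 * B" if t: "0 < t" "t \<le> 1" for t
  proof -
    define z where "z j = x j + t * (y j - x j)" for j
    have "z j = (1 - t) * x j + t * y j" for j by (simp add: z_def algebra_simps)
    note z = this
    have KD: "j \<in> J \<Longrightarrow> 0 \<le> u j \<and> u j \<le> r (f j)" "j \<notin> J \<Longrightarrow> u j = 0" if "u \<in> K" for u j
      using that by (auto simp: K_def split: if_splits)
    have sums: "(\<Sum>j | j \<in> J \<and> f j = h. u j) = r h" if "u \<in> K" "h \<in> H" for u h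
      using that by (simp add: K_def)
    have "z j \<in> (if j \<in> J then {0..r (f j)} else {0})" for j
    proof (cases "j \<in> J")
      case True
      then show ?thesis
        unfolding z using KD(1)[OF x True] KD(1)[OF y True] t
          convex_bound_le[of "x j" "r (f j)" "y j" "1 - t" t] by simp
    next
      case False
      then show ?thesis unfolding z using KD(2)[OF x False] KD(2)[OF y False] by simp
    qed
    moreover have "(\<Sum>j | j \<in> J \<and> f j = h. z j) = r h" if "h \<in> H" for h
    proof -
      have "(\<Sum>j | j \<in> J \<and> f j = h. z j) = (1 - t) * r h + t * r h"
        unfolding z sum.distrib sum_distrib_left[symmetric] sums[OF x that] sums[OF y that] ..
      then show ?thesis by (simp add: algebra_simps)
    qed
    ultimately have "z \<in> K" unfolding K_def by blast
    have lz: "l z e = l x e + t * b e" for e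
      by (simp add: l_def z_def b_def algebra_simps sum.distrib sum_subtractf sum_distrib_left)
    have "(max 0 (l z e - c e))\<^sup>2 \<le> (w e)\<^sup>2 + 2 * t * (w e * b e) + t\<^sup>2 * (b e)\<^sup>2" for e
    proof -
      \<comment> \<open>Replacing the excess at \<open>x\<close> by its positive part
        \<open>w e\<close> only increases the sum. The resulting quadratic upper bound in
        \<open>t\<close> takes the place of a derivative.\<close>
      have "max 0 (l z e - c e) \<le> \<bar>w e + t * b e\<bar>"
        unfolding lz w_def by (auto simp: max_def)
      then have "(max 0 (l z e - c e))\<^sup>2 \<le> \<bar>w e + t * b e\<bar>\<^sup>2"
        by (intro power_mono) auto
      then show ?thesis by (simp add: power2_eq_square algebra_simps)
    qed
    then have "(\<Sum>e\<in>E. (max 0 (l z e - c e))\<^sup>2) \<le> (\<Sum>e\<in>E. (w e)\<^sup>2 + 2 * t * (w e * b e) + t\<^sup>2 * (b e)\<^sup>2)"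
      by (intro sum_mono)
    also have "\<dots> = (\<Sum>e\<in>E. (w e)\<^sup>2) + (2 * t * (\<Sum>e\<in>E. w e * b e) + t\<^sup>2 * B)"
      by (simp add: sum.distrib sum_distrib_left B_def)
    finally show ?thesis
      using min[OF \<open>z \<in> K\<close>] by (simp add: w_def)
  qed
  have "0 \<le> (\<Sum>e\<in>E. w e * b e)"
  proof (rule ccontr)
    define D where "D = - (\<Sum>e\<in>E. w e * b e)"
    assume "\<not> 0 \<le> (\<Sum>e\<in>E. w e * b e)"
    then have D: "0 < D" by (simp add: D_def)
    \<comment> \<open>So small that the quadratic term \<open>t\<^sup>2 * B\<close> is at most
      \<open>t * D\<close>, half of the linear decrease \<open>2 * t * D\<close>; adding 1 covers
      \<open>B = 0\<close>.\<close>
    define t where "t = min 1 (D / (B + 1))"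
    have t: "0 < t" "t \<le> 1" using D B by (auto simp: t_def)
    have "t * B \<le> D"
    proof -
      have "t * B \<le> D / (B + 1) * B"
        using B by (intro mult_right_mono) (auto simp: t_def)
      also have "\<dots> \<le> D" using B D by (simp add: field_simps)
      finally show ?thesis .
    qed
    then have "t * (t * B) \<le> t * D" using t by (intro mult_left_mono) auto
    moreover have "0 < t * D" using t D by simp
    ultimately show False
      using deriv[OF t] by (simp add: D_def power2_eq_square algebra_simps)
  qed
  then have "(\<Sum>e\<in>E. w e * l x e) \<le> (\<Sum>e\<in>E. w e * l y e)"
    by (simp add: b_def algebra_simps sum_subtractf)
  also have "\<dots> \<le> (\<Sum>e\<in>E. w e * c e)"
    using y'(2) \<open>l y = l y'\<close> by simp
  finally have "(\<Sum>e\<in>E. w e * (l x e - c e)) \<le> 0"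
    by (simp add: algebra_simps sum_subtractf)
  moreover have "w e * (l x e - c e) = (w e)\<^sup>2" for e
    by (simp add: w_def max_def power2_eq_square)
  ultimately have "(\<Sum>e\<in>E. (w e)\<^sup>2) = 0"
    by (simp add: antisym sum_nonneg)
  then have "\<forall>e\<in>E. w e = 0"
    using fin by (simp add: sum_nonneg_eq_0_iff)
  then have "\<forall>e\<in>E. l x e \<le> c e"
    by (auto simp: w_def max_def split: if_splits)
  then show ?thesis
    using K_feasible[OF x] by (auto simp: l_def)
qed

section \<open>Shortest walks\<close>

definition wlen :: "(edge \<Rightarrow> real) \<Rightarrow> arc list \<Rightarrow> real" where
  "wlen w p = (\<Sum>a\<leftarrow>p. w {fst a, snd a})"

lemma wlen_simps [simp]:
  "wlen w [] = 0" "wlen w (a # p) = w {fst a, snd a} + wlen w p" "wlen w (p @ q) = wlen w p + wlen w q"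
  by (simp_all add: wlen_def)

lemma walk_append: "walk E u p v \<Longrightarrow> walk E v q z \<Longrightarrow> walk E u (p @ q) z"
  by (induction p arbitrary: u) auto

lemma walk_rev: "walk E u p v \<Longrightarrow> walk E v (rev (map prod.swap p)) u"
proof (induction p arbitrary: u)
  case (Cons a p)
  then have "walk E (snd a) [prod.swap a] u"
    by (cases a) (auto simp: insert_commute)
  moreover have "walk E v (rev (map prod.swap p)) (snd a)"
    using Cons by simp
  ultimately show ?case
    using walk_append by fastforce
qed simp

lemma wlen_rev: "wlen w (rev (map prod.swap p)) = wlen w p"
  by (induction p) (auto simp: insert_commute)

lemma wlen_nonneg: "walk E u p v \<Longrightarrow> \<forall>e\<in>E. 0 \<le> w e \<Longrightarrow> 0 \<le> wlen w p"
  by (induction p arbitrary: u) auto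

lemma reachable_iff_walk:
  assumes "finite_graph V E" "u \<in> V"
  shows "u \<rightarrow>\<^sup>*\<^bsub>bidirected V E\<^esub> v \<longleftrightarrow> (\<exists>p. walk E u p v)"
  using wf_digraph.reachable_awalk[OF wf_bidirected[OF assms(1)], of u v] awalk_iff_walk[OF assms(1)] assms(2)
  by simp

text \<open>Simple paths are finite in number, as the compactness argument of
  \<open>load_duality\<close> requires, and they include a shortest walk between any two connected
  vertices.\<close>

definition simple_paths :: "vertex set \<Rightarrow> edge set \<Rightarrow> vertex \<Rightarrow> vertex \<Rightarrow> arc list set" where
  "simple_paths V E u v = {p. pre_digraph.apath (bidirected V E) u p v}"

locale weighted_graph =
  fixes V :: "vertex set" and E :: "edge set" and w :: "edge \<Rightarrow> real"
  assumes graph: "finite_graph V E" and weight: "\<forall>e\<in>E. 0 \<le> w e"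
begin

sublocale fin_digraph "bidirected V E"
proof -
  interpret wf_digraph "bidirected V E" using graph by (rule wf_bidirected)
  show "fin_digraph (bidirected V E)"
  proof
    show "finite (verts (bidirected V E))" using graph by (simp add: bidirected_def finite_graph_def)
    show "finite (arcs (bidirected V E))" using finite_arcset[OF graph] by simp
  qed
qed

lemma finite_simple_paths: "finite (simple_paths V E u v)"
  unfolding simple_paths_def by (rule apaths_finite)

lemma simple_path_walk: "p \<in> simple_paths V E u v \<Longrightarrow> walk E u p v"
  unfolding simple_paths_def using awalkI_apath awalk_iff_walk[OF graph] by blast

lemma awalk_cost_wlen: "awalk_cost (\<lambda>a. w {fst a, snd a}) p = wlen w p"
  by (induction p) auto

lemma shortest_path:
  assumes "u \<in> V" "walk E u q v"
  shows "\<exists>p\<in>simple_paths V E u v. \<forall>q. walk E u q v \<longrightarrow> wlen w p \<le> wlen w q"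
proof -
  let ?c = "\<lambda>a. w {fst a, snd a}"
  have reach: "u \<rightarrow>\<^sup>*\<^bsub>bidirected V E\<^esub> v"
    using assms by (auto simp: reachable_iff_walk[OF graph])
  have nonneg: "0 \<le> ?c a" if "a \<in> arcs (bidirected V E)" for a
    using that weight by (cases a) auto
  obtain p where p: "apath u p v" "\<mu> ?c u v = awalk_cost ?c p"
    using min_cost_awalk[OF reach, of ?c] nonneg by blast
  have "wlen w p \<le> wlen w q" if "walk E u q v" for q
    using min_cost_le_walk_cost[of u q v ?c] that assms p(2) awalk_iff_walk[OF graph]
    by (simp add: awalk_cost_wlen)
  then show ?thesis
    using p(1) by (auto simp: simple_paths_def)
qed

definition sp :: "vertex \<Rightarrow> vertex \<Rightarrow> arc list" where
  "sp u v = (SOME p. p \<in> simple_paths V E u v \<and> (\<forall>q. walk E u q v \<longrightarrow> wlen w p \<le> wlen w q))"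

lemma sp:
  assumes "u \<in> V" "walk E u q v"
  shows "sp u v \<in> simple_paths V E u v" "walk E u q v \<Longrightarrow> wlen w (sp u v) \<le> wlen w q"
proof -
  have *: "sp u v \<in> simple_paths V E u v \<and> (\<forall>q. walk E u q v \<longrightarrow> wlen w (sp u v) \<le> wlen w q)"
    unfolding sp_def by (rule someI_ex) (use shortest_path[OF assms] in blast)
  then show "sp u v \<in> simple_paths V E u v" by blast
  show "walk E u q v \<Longrightarrow> wlen w (sp u v) \<le> wlen w q" using * by blast
qed

text \<open>Vertices in different components get a finite distance that bounds all others.\<close>

definition far :: real where
  "far = (\<Sum>(u, v)\<in>{(u, v) \<in> V \<times> V. \<exists>p. walk E u p v}. wlen w (sp u v))"

definition dist_w :: "vertex \<Rightarrow> vertex \<Rightarrow> real" where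
  "dist_w u v = (if \<exists>p. walk E u p v then wlen w (sp u v) else far)"

lemma sp_nonneg: "u \<in> V \<Longrightarrow> walk E u q v \<Longrightarrow> 0 \<le> wlen w (sp u v)"
  using sp(1) simple_path_walk wlen_nonneg weight by blast

lemma sp_le_far:
  assumes "u \<in> V" "v \<in> V" "walk E u q v"
  shows "wlen w (sp u v) \<le> far"
proof -
  let ?I = "{(u, v) \<in> V \<times> V. \<exists>p. walk E u p v}"
  have "finite ?I"
    by (rule finite_subset[of _ "V \<times> V"]) (use graph in \<open>auto simp: finite_graph_def\<close>)
  then have "(\<lambda>(u, v). wlen w (sp u v)) (u, v) \<le> far"
    unfolding far_def using assms sp_nonneg by (intro member_le_sum) auto
  then show ?thesis by simp
qed

lemma far_nonneg: "0 \<le> far"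
  unfolding far_def using sp_nonneg by (intro sum_nonneg) auto

lemma dist_w_le: "u \<in> V \<Longrightarrow> walk E u q v \<Longrightarrow> dist_w u v \<le> wlen w q"
  unfolding dist_w_def using sp(2) by auto

lemma dist_w_arc: "(u, v) \<in> arcset E \<Longrightarrow> dist_w u v \<le> w {u, v}"
  using dist_w_le[of u "[(u, v)]" v] arcset_in_verts[OF graph, of u v] by simp

lemma dist_w_nonneg: "u \<in> V \<Longrightarrow> 0 \<le> dist_w u v"
  unfolding dist_w_def using sp_nonneg far_nonneg by auto

lemma dist_w_le_far: "u \<in> V \<Longrightarrow> v \<in> V \<Longrightarrow> dist_w u v \<le> far"
  unfolding dist_w_def using sp_le_far by auto

text \<open>Reversing a walk gives symmetry, and concatenation gives the triangle inequality. If one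
  of the two legs joins different components, it alone has length \<open>far\<close>, which bounds
  every distance.\<close>

lemma pmetric_dist_w: "pmetric V dist_w"
  unfolding pmetric_def
proof (intro conjI ballI)
  fix u assume "u \<in> V"
  then show "dist_w u u = 0"
    using dist_w_le[of u "[]" u] dist_w_nonneg[of u u] by simp
next
  have le: "dist_w v u \<le> dist_w u v" if uv: "u \<in> V" "v \<in> V" for u v
  proof (cases "\<exists>p. walk E u p v")
    case True
    then have "walk E u (sp u v) v" using sp(1)[OF uv(1)] simple_path_walk by blast
    then have "dist_w v u \<le> wlen w (rev (map prod.swap (sp u v)))"
      using uv walk_rev by (intro dist_w_le)
    then show ?thesis using True by (simp add: wlen_rev dist_w_def)
  next
    case False
    then show ?thesis using dist_w_le_far[OF uv(2,1)] by (simp add: dist_w_def)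
  qed
  fix u v assume "u \<in> V" "v \<in> V"
  then show "dist_w u v = dist_w v u" using le by (simp add: antisym)
next
  fix u v z assume V: "u \<in> V" "v \<in> V" "z \<in> V"
  show "dist_w u z \<le> dist_w u v + dist_w v z"
  proof (cases "(\<exists>p. walk E u p v) \<and> (\<exists>p. walk E v p z)")
    case True
    then have "walk E u (sp u v @ sp v z) z"
      using sp(1)[OF V(1), of _ v] sp(1)[OF V(2), of _ z] simple_path_walk walk_append by metis
    then have "dist_w u z \<le> wlen w (sp u v @ sp v z)"
      by (rule dist_w_le[OF V(1)])
    also have "\<dots> = dist_w u v + dist_w v z"
      using True by (simp add: dist_w_def)
    finally show ?thesis .
  next
    case False
    then have "dist_w u v = far \<or> dist_w v z = far" by (auto simp: dist_w_def)
    then show ?thesis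
      using dist_w_le_far[OF V(1,3)] dist_w_nonneg[OF V(1), of v] dist_w_nonneg[OF V(2), of z] by auto
  qed
qed

lemma sum_count_wlen:
  assumes "walk E u p v"
  shows "(\<Sum>e\<in>E. w e * (\<Sum>a\<in>arcs_of e. real (count_list p a))) = wlen w p"
proof -
  have "(\<Sum>a\<in>arcset E. w {fst a, snd a} * real (count_list p a)) = wlen w p"
    using assms
  proof (induction p arbitrary: u)
    case (Cons a p)
    then have a: "a \<in> arcset E" and p: "walk E (snd a) p v" by auto
    have "(\<Sum>b\<in>arcset E. w {fst b, snd b} * real (count_list (a # p) b))
      = (\<Sum>b\<in>arcset E. (if b = a then w {fst a, snd a} else 0) + w {fst b, snd b} * real (count_list p b))"
      by (intro sum.cong) (auto simp: algebra_simps)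
    also have "\<dots> = w {fst a, snd a} + (\<Sum>b\<in>arcset E. w {fst b, snd b} * real (count_list p b))"
      unfolding sum.distrib using finite_arcset[OF graph] a by (subst sum.delta) auto
    finally show ?case using Cons.IH[OF p] by simp
  qed simp
  moreover have "(\<Sum>e\<in>E. w e * edge_flow (\<lambda>a. real (count_list p a)) e)
      = (\<Sum>a\<in>arcset E. w {fst a, snd a} * real (count_list p a))"
    unfolding sum_edge_flow[OF graph] by (simp add: case_prod_unfold)
  ultimately show ?thesis
    by (simp add: edge_flow_def)
qed

end

section \<open>Routing and coding from path flows\<close>

text \<open>Summation by parts: flow conservation is multiplied by the potential
  \<open>\<pi>\<close> and summed over the vertices. Choosing \<open>\<pi>\<close> as a distance
  gives weak duality, as an indicator it gives reachability.\<close>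

lemma routing_potential:
  assumes graph: "finite_graph V E" and sessions: "session_set V H"
    and g: "routing_solution V E H r g" and h: "h \<in> H"
  shows "(\<Sum>a\<in>arcset E. g h a * (\<pi> (snd a) - \<pi> (fst a))) = r h * (\<pi> (sink h) - \<pi> (source h))"
proof -
  have V: "finite V" using graph by (simp add: finite_graph_def)
  have A: "finite (arcset E)" "fst ` arcset E \<subseteq> V" "snd ` arcset E \<subseteq> V"
    using finite_arcset[OF graph] arcset_in_verts[OF graph] by auto
  have group: "(\<Sum>v\<in>V. \<pi> v * (\<Sum>a | a \<in> arcset E \<and> f a = v. g h a)) = (\<Sum>a\<in>arcset E. g h a * \<pi> (f a))"
    if "f ` arcset E \<subseteq> V" for f
  proof -
    have "(\<Sum>v\<in>V. \<pi> v * (\<Sum>a | a \<in> arcset E \<and> f a = v. g h a))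
        = (\<Sum>v\<in>V. \<Sum>a | a \<in> arcset E \<and> f a = v. g h a * \<pi> (f a))"
      unfolding sum_distrib_left by (intro sum.cong) auto
    then show ?thesis by (simp only: sum.group[OF A(1) V that])
  qed
  have "(\<Sum>v\<in>V. \<pi> v * ((\<Sum>a | a \<in> arcset E \<and> fst a = v. g h a) - (\<Sum>a | a \<in> arcset E \<and> snd a = v. g h a)))
      = (\<Sum>v\<in>V. \<pi> v * (r h * (of_bool (v = source h) - of_bool (v = sink h))))"
  proof (intro sum.cong refl)
    fix v assume "v \<in> V"
    then have "(\<Sum>a | a \<in> arcset E \<and> fst a = v. g h a) - (\<Sum>a | a \<in> arcset E \<and> snd a = v. g h a)
        = r h * (of_bool (v = source h) - of_bool (v = sink h))"
      using g h unfolding routing_solution_def arcs_bidirected by blast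
    then show "\<pi> v * ((\<Sum>a | a \<in> arcset E \<and> fst a = v. g h a) - (\<Sum>a | a \<in> arcset E \<and> snd a = v. g h a))
        = \<pi> v * (r h * (of_bool (v = source h) - of_bool (v = sink h)))"
      by (simp only:)
  qed
  also have "\<dots> = (\<Sum>v\<in>V. if v = source h then r h * \<pi> v else 0) - (\<Sum>v\<in>V. if v = sink h then r h * \<pi> v else 0)"
    unfolding sum_subtractf[symmetric] by (intro sum.cong) (auto simp: algebra_simps)
  also have "\<dots> = r h * \<pi> (source h) - r h * \<pi> (sink h)"
    using V sessions h by (subst (1 2) sum.delta) (auto simp: session_set_def)
  finally have "(\<Sum>a\<in>arcset E. g h a * \<pi> (fst a)) - (\<Sum>a\<in>arcset E. g h a * \<pi> (snd a))
      = r h * \<pi> (source h) - r h * \<pi> (sink h)"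
    unfolding right_diff_distrib sum_subtractf group[OF A(2)] group[OF A(3)] .
  then show ?thesis
    by (simp only: right_diff_distrib sum_subtractf)
qed

lemma routing_nonneg:
  "routing_solution V E H r g \<Longrightarrow> h \<in> H \<Longrightarrow> a \<in> arcset E \<Longrightarrow> 0 \<le> g h a"
  unfolding routing_solution_def arcs_bidirected by blast

text \<open>The indicator of being unreachable from the source does not increase along any arc, so a
  flow cannot reach a sink where it equals 1.\<close>

lemma routing_connected_demands:
  assumes graph: "finite_graph V E" and sessions: "session_set V H"
    and g: "routing_solution V E H r g"
  shows "connected_demands V E H r"
  unfolding connected_demands_def
proof (intro ballI impI, rule ccontr)
  fix h assume h: "h \<in> H" "0 < r h"
  have s: "source h \<in> V" using sessions h by (auto simp: session_set_def)
  assume "\<not> source h \<rightarrow>\<^sup>*\<^bsub>bidirected V E\<^esub> sink h"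
  then have unreach: "\<nexists>p. walk E (source h) p (sink h)"
    by (simp add: reachable_iff_walk[OF graph s])
  define \<pi> :: "vertex \<Rightarrow> real" where "\<pi> v = of_bool (\<nexists>p. walk E (source h) p v)" for v
  have "\<pi> (snd a) \<le> \<pi> (fst a)" if "a \<in> arcset E" for a
  proof -
    have "walk E (source h) (p @ [a]) (snd a)" if "walk E (source h) p (fst a)" for p
      using that \<open>a \<in> arcset E\<close> by (intro walk_append) auto
    then show ?thesis by (auto simp: \<pi>_def)
  qed
  then have "(\<Sum>a\<in>arcset E. g h a * (\<pi> (snd a) - \<pi> (fst a))) \<le> 0"
    using routing_nonneg[OF g h(1)] by (intro sum_nonpos mult_nonneg_nonpos) auto
  moreover have "\<pi> (source h) = 0" "\<pi> (sink h) = 1"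
    using unreach by (auto simp: \<pi>_def intro: exI[of _ "[]"])
  ultimately show False
    using routing_potential[OF graph sessions g h(1), of \<pi>] h(2) by simp
qed

section \<open>Weak duality for routing and for coding\<close>

context weighted_graph
begin

text \<open>The potential is the distance from the source; along an arc it grows by at most the
  weight of its edge.\<close>

lemma routing_dual:
  assumes sessions: "session_set V H" and g: "routing_solution V E H r g"
    and cap: "within_capacity E c (\<lambda>a. \<Sum>h\<in>H. g h a)"
  shows "(\<Sum>h\<in>H. r h * dist_w (source h) (sink h)) \<le> (\<Sum>e\<in>E. w e * c e)"
proof -
  have HV: "source h \<in> V" "sink h \<in> V" if "h \<in> H" for h
    using sessions that by (auto simp: session_set_def)
  have "r h * dist_w (source h) (sink h) \<le> (\<Sum>a\<in>arcset E. w {fst a, snd a} * g h a)" if h: "h \<in> H" for h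
  proof -
    have "r h * dist_w (source h) (sink h)
        = (\<Sum>a\<in>arcset E. g h a * (dist_w (source h) (snd a) - dist_w (source h) (fst a)))"
      using routing_potential[OF graph sessions g h, of "dist_w (source h)"]
        pmetric_refl[OF pmetric_dist_w HV(1)[OF h]] by simp
    also have "\<dots> \<le> (\<Sum>a\<in>arcset E. g h a * w {fst a, snd a})"
    proof (intro sum_mono mult_left_mono)
      fix a assume a: "a \<in> arcset E"
      then have "fst a \<in> V" "snd a \<in> V"
        using arcset_in_verts[OF graph, of "fst a" "snd a"] by auto
      then show "dist_w (source h) (snd a) - dist_w (source h) (fst a) \<le> w {fst a, snd a}"
        using pmetric_triangle[OF pmetric_dist_w HV(1)[OF h], of "fst a" "snd a"]
          dist_w_arc[of "fst a" "snd a"] a by auto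
      show "0 \<le> g h a" using routing_nonneg[OF g h a] .
    qed
    finally show ?thesis by (simp add: mult.commute)
  qed
  then have "(\<Sum>h\<in>H. r h * dist_w (source h) (sink h)) \<le> (\<Sum>h\<in>H. \<Sum>a\<in>arcset E. w {fst a, snd a} * g h a)"
    by (rule sum_mono)
  also have "\<dots> = (\<Sum>a\<in>arcset E. w {fst a, snd a} * (\<Sum>h\<in>H. g h a))"
    by (subst sum.swap) (simp only: sum_distrib_left)
  also have "\<dots> = (\<Sum>e\<in>E. w e * edge_flow (\<lambda>a. \<Sum>h\<in>H. g h a) e)"
    unfolding sum_edge_flow[OF graph] by (simp add: case_prod_unfold)
  also have "\<dots> \<le> (\<Sum>e\<in>E. w e * c e)"
    using weight cap by (intro sum_mono mult_left_mono) (auto simp: within_capacity_def)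
  finally show ?thesis .
qed

text \<open>With the identity for \<open>\<phi>\<close> the extension only moves the code to the
  complete graph on the same vertices, and relocation costs nothing. Replacing weights by distances
  can only lower the cost of the arcs of \<open>E\<close>.\<close>

lemma coding_dual:
  assumes cores: independent_cores and sessions: "session_set V H"
    and C: "coding_solution V E H r C" and cap: "within_capacity E c (coding_flow C)"
  shows "(\<Sum>h\<in>H. r h * dist_w (source h) (sink h)) \<le> (\<Sum>e\<in>E. w e * c e)"
proof -
  have HV: "source h \<in> V" "sink h \<in> V" if "h \<in> H" for h
    using sessions that by (auto simp: session_set_def)
  have V: "finite V" using graph by (simp add: finite_graph_def)
  interpret code_extension V E H r C V "\<lambda>h. h"
    using graph sessions C V by unfold_locales (auto simp: session_set_def)
  have "(\<Sum>h\<in>H. r h * dist_w (source h) (sink h)) = (\<Sum>h\<in>H. extended_rate h * dist_w (source h) (sink h))"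
  proof (intro sum.cong refl)
    fix h assume "h \<in> H"
    then have "{h' \<in> H. h' = h} = {h}" by auto
    then show "r h * dist_w (source h) (sink h) = extended_rate h * dist_w (source h) (sink h)"
      by (simp add: extended_rate_def)
  qed
  also have "\<dots> \<le> (\<Sum>(u, v)\<in>arcset (complete_edges V). dist_w u v * coding_flow extended (u, v))"
    using metric_cost_bound[OF cores V pmetric_dist_w sessions] extended_coding_solution by simp
  also have "\<dots> \<le> (\<Sum>(u, v)\<in>arcset E. dist_w u v * coding_flow C (u, v))"
  proof -
    have "(\<Sum>h\<in>H. r h * (dist_w (source h) (source h) + dist_w (sink h) (sink h))) = 0"
      using HV pmetric_refl[OF pmetric_dist_w] by simp
    then show ?thesis using extended_cost[OF pmetric_dist_w] by simp
  qed
  also have "\<dots> \<le> (\<Sum>(u, v)\<in>arcset E. w {u, v} * coding_flow C (u, v))"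
  proof (intro sum_mono, clarify)
    fix u v assume "{u, v} \<in> E"
    then show "dist_w u v * coding_flow C (u, v) \<le> w {u, v} * coding_flow C (u, v)"
      using dist_w_arc[of u v] coding_flow_nonneg[of "(u, v)"] by (intro mult_right_mono) auto
  qed
  also have "\<dots> = (\<Sum>e\<in>E. w e * edge_flow (coding_flow C) e)"
    by (rule sum_edge_flow[OF graph, symmetric])
  also have "\<dots> \<le> (\<Sum>e\<in>E. w e * c e)"
    using weight cap by (intro sum_mono mult_left_mono) (auto simp: within_capacity_def)
  finally show ?thesis .
qed

end

definition crossings :: "edge \<Rightarrow> session \<times> arc list \<Rightarrow> real" where
  "crossings e j = (\<Sum>a\<in>arcs_of e. real (count_list (snd j) a))"

definition session_paths :: "vertex set \<Rightarrow> edge set \<Rightarrow> session set \<Rightarrow> (session \<times> arc list) set" where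
  "session_paths V E H = (SIGMA h:H. simple_paths V E (source h) (sink h))"

lemma finite_graph_weighted_graph: "finite_graph V E \<Longrightarrow> weighted_graph V E (\<lambda>_. 0)"
  by unfold_locales auto

lemma finite_session_paths:
  "finite_graph V E \<Longrightarrow> finite H \<Longrightarrow> finite (session_paths V E H)"
  unfolding session_paths_def
  by (intro finite_SigmaI weighted_graph.finite_simple_paths[OF finite_graph_weighted_graph])

lemma session_paths_walk:
  "finite_graph V E \<Longrightarrow> (h, p) \<in> session_paths V E H \<Longrightarrow> h \<in> H \<and> walk E (source h) p (sink h)"
  unfolding session_paths_def
  using weighted_graph.simple_path_walk[OF finite_graph_weighted_graph] by blast

text \<open>For given weights, sending each demand along one shortest path costs exactly the
  left-hand side of \<open>dual\<close>. This is the response to a weight vector that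
  \<open>load_duality\<close> asks for.\<close>

lemma path_flow_if_dual:
  assumes graph: "finite_graph V E" and sessions: "session_set V H" and r: "\<forall>h\<in>H. 0 \<le> r h"
    and conn: "connected_demands V E H r"
    and dual: "\<And>w. \<forall>e\<in>E. 0 \<le> w e \<Longrightarrow>
      (\<Sum>h\<in>H. r h * weighted_graph.dist_w V E w (source h) (sink h)) \<le> (\<Sum>e\<in>E. w e * c e)"
  shows "\<exists>x. meets_demands (session_paths V E H) fst H r x \<and>
    (\<forall>e\<in>E. (\<Sum>j\<in>session_paths V E H. crossings e j * x j) \<le> c e)"
proof (rule load_duality)
  have finH: "finite H" using sessions by (simp add: session_set_def)
  then show "finite (session_paths V E H)" using graph by (intro finite_session_paths)
  show "finite E" using graph by (rule finite_graph_edges)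
  show "fst ` session_paths V E H \<subseteq> H" by (auto simp: session_paths_def)
  fix w :: "edge \<Rightarrow> real" assume w: "\<forall>e\<in>E. 0 \<le> w e"
  interpret weighted_graph V E w using graph w by unfold_locales
  define q where "q h = sp (source h) (sink h)" for h
  define y where "y j = (if snd j = q (fst j) then r (fst j) else 0)" for j
  let ?J = "session_paths V E H"
  \<comment> \<open>The endpoints of a session of rate zero may lie in different components, where
    \<open>sp\<close> is an arbitrary choice and \<open>dist_w\<close> is
    \<open>far\<close>.\<close>
  have reach: "q h \<in> simple_paths V E (source h) (sink h) \<and> dist_w (source h) (sink h) = wlen w (q h)"
    if h: "h \<in> H" "r h \<noteq> 0" for h
  proof -
    have s: "source h \<in> V" using sessions h by (auto simp: session_set_def)
    moreover have "0 < r h" using r h by force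
    ultimately obtain p where "walk E (source h) p (sink h)"
      using conn h reachable_iff_walk[OF graph s] unfolding connected_demands_def by blast
    then show ?thesis using sp(1)[OF s] by (auto simp: q_def dist_w_def)
  qed
  have sum_y: "(\<Sum>p\<in>simple_paths V E (source h) (sink h). y (h, p) * F p) = r h * F (q h)"
    if h: "h \<in> H" for h F
  proof (cases "r h = 0")
    case True
    then have "y (h, p) = 0" for p by (simp add: y_def)
    then show ?thesis using True by simp
  next
    case False
    have "(\<Sum>p\<in>simple_paths V E (source h) (sink h). y (h, p) * F p)
        = (\<Sum>p\<in>simple_paths V E (source h) (sink h). if p = q h then r h * F (q h) else 0)"
      by (intro sum.cong) (auto simp: y_def)
    then show ?thesis
      using reach[OF h False] finite_simple_paths by (simp add: sum.delta)
  qed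
  have "meets_demands ?J fst H r y"
    unfolding meets_demands_def
  proof (intro conjI ballI)
    fix j assume "j \<in> ?J"
    then show "0 \<le> y j" using r by (auto simp: y_def session_paths_def)
  next
    fix h assume h: "h \<in> H"
    have "{j \<in> ?J. fst j = h} = Pair h ` simple_paths V E (source h) (sink h)"
      using h by (auto simp: session_paths_def)
    then have "(\<Sum>j | j \<in> ?J \<and> fst j = h. y j) = (\<Sum>p\<in>simple_paths V E (source h) (sink h). y (h, p))"
      by (simp add: sum.reindex inj_on_def)
    then show "(\<Sum>j | j \<in> ?J \<and> fst j = h. y j) = r h"
      using sum_y[OF h, of "\<lambda>_. 1"] by simp
  qed
  moreover have "(\<Sum>e\<in>E. w e * (\<Sum>j\<in>?J. crossings e j * y j)) \<le> (\<Sum>e\<in>E. w e * c e)"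
  proof -
    have "(\<Sum>e\<in>E. w e * (\<Sum>j\<in>?J. crossings e j * y j)) = (\<Sum>j\<in>?J. y j * (\<Sum>e\<in>E. w e * crossings e j))"
      unfolding sum_distrib_left by (subst sum.swap) (simp only: mult_ac)
    also have "\<dots> = (\<Sum>j\<in>?J. y j * wlen w (snd j))"
    proof (intro sum.cong refl)
      fix j assume j: "j \<in> ?J"
      then have "walk E (source (fst j)) (snd j) (sink (fst j))"
        using session_paths_walk[OF graph, of "fst j" "snd j"] by simp
      then show "y j * (\<Sum>e\<in>E. w e * crossings e j) = y j * wlen w (snd j)"
        unfolding crossings_def by (simp only: sum_count_wlen)
    qed
    also have "\<dots> = (\<Sum>h\<in>H. \<Sum>p\<in>simple_paths V E (source h) (sink h). y (h, p) * wlen w p)"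
      unfolding session_paths_def using finH finite_simple_paths
      by (subst sum.Sigma) (auto simp: case_prod_unfold)
    also have "\<dots> = (\<Sum>h\<in>H. r h * wlen w (q h))"
      using sum_y by simp
    also have "\<dots> = (\<Sum>h\<in>H. r h * dist_w (source h) (sink h))"
    proof (intro sum.cong refl)
      fix h assume "h \<in> H"
      then show "r h * wlen w (q h) = r h * dist_w (source h) (sink h)"
        using reach[of h] by (cases "r h = 0") auto
    qed
    also have "\<dots> \<le> (\<Sum>e\<in>E. w e * c e)" using w by (rule dual)
    finally show ?thesis .
  qed
  ultimately show "\<exists>y. meets_demands ?J fst H r y \<and>
      (\<Sum>e\<in>E. w e * (\<Sum>j\<in>?J. crossings e j * y j)) \<le> (\<Sum>e\<in>E. w e * c e)"
    by blast
qed

context path_family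
begin

lemma sum_count_arcs:
  "(\<Sum>a\<in>arcs_of e. \<Sum>j\<in>J. real (count_list (snd j) a) * x j) = (\<Sum>j\<in>J. crossings e j * x j)"
  unfolding crossings_def sum_distrib_right by (rule sum.swap)

lemma edge_flow_le_crossings:
  assumes f: "\<And>a. f a \<le> (\<Sum>j | j \<in> J \<and> a \<in> set (snd j). x j)"
  shows "edge_flow f e \<le> (\<Sum>j\<in>J. crossings e j * x j)"
proof -
  have "f a \<le> (\<Sum>j\<in>J. real (count_list (snd j) a) * x j)" for a
  proof -
    have "(\<Sum>j | j \<in> J \<and> a \<in> set (snd j). x j) = (\<Sum>j\<in>J. of_bool (a \<in> set (snd j)) * x j)"
      using finJ by (intro sum.mono_neutral_cong_left) auto
    also have "\<dots> \<le> (\<Sum>j\<in>J. real (count_list (snd j) a) * x j)"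
    proof (intro sum_mono mult_right_mono)
      fix j assume "j \<in> J"
      then show "0 \<le> x j" by (rule x)
      show "of_bool (a \<in> set (snd j)) \<le> real (count_list (snd j) a)"
        using count_list_0_iff[of "snd j" a] by (cases "count_list (snd j) a") auto
    qed
    finally show ?thesis using f[of a] by linarith
  qed
  then show ?thesis
    unfolding edge_flow_def sum_count_arcs[symmetric] by (rule sum_mono)
qed

lemma path_coding_achievable:
  assumes "\<forall>e\<in>E. (\<Sum>j\<in>J. crossings e j * x j) \<le> c e"
  shows "coding_achievable V E H c r"
proof -
  obtain C where C: "coding_solution V E H r C"
    and flow: "\<forall>a. coding_flow C a \<le> (\<Sum>j | j \<in> J \<and> a \<in> set (snd j). x j)"
    using path_code by blast
  have "edge_flow (coding_flow C) e \<le> c e" if "e \<in> E" for e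
  proof -
    have "edge_flow (coding_flow C) e \<le> (\<Sum>j\<in>J. crossings e j * x j)"
      using flow by (intro edge_flow_le_crossings) blast
    also have "\<dots> \<le> c e" using assms that by blast
    finally show ?thesis .
  qed
  then show ?thesis
    using C unfolding coding_achievable_def within_capacity_def by blast
qed

lemma walk_divergence:
  assumes "walk E s p t" "finite (arcset E)"
  shows "(\<Sum>a | a \<in> arcset E \<and> fst a = v. real (count_list p a))
    - (\<Sum>a | a \<in> arcset E \<and> snd a = v. real (count_list p a)) = of_bool (v = s) - of_bool (v = t)"
  using assms(1)
proof (induction p arbitrary: s)
  case (Cons b p)
  then have b: "b \<in> arcset E" "fst b = s" and p: "walk E (snd b) p t" by auto
  have split: "(\<Sum>a | a \<in> arcset E \<and> f a = v. real (count_list (b # p) a))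
      = of_bool (v = f b) + (\<Sum>a | a \<in> arcset E \<and> f a = v. real (count_list p a))" for f
  proof -
    have "(\<Sum>a | a \<in> arcset E \<and> f a = v. real (count_list (b # p) a))
      = (\<Sum>a | a \<in> arcset E \<and> f a = v. (if a = b then 1 else 0) + real (count_list p a))"
      by (intro sum.cong) auto
    also have "\<dots> = of_bool (v = f b) + (\<Sum>a | a \<in> arcset E \<and> f a = v. real (count_list p a))"
      unfolding sum.distrib using assms(2) b(1) by (subst sum.delta) auto
    finally show ?thesis .
  qed
  show ?case
    unfolding split using Cons.IH[OF p] b(2) by simp
qed simp

lemma path_routing_achievable:
  assumes cap: "\<forall>e\<in>E. (\<Sum>j\<in>J. crossings e j * x j) \<le> c e"
  shows "routing_achievable V E H c r"
proof -
  define g where "g h a = (\<Sum>j | j \<in> J \<and> fst j = h. real (count_list (snd j) a) * x j)" for h a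
  note finA = finite_arcset[OF graph]
  have finH: "finite H" using sessions by (simp add: session_set_def)
  have "routing_solution V E H r g"
    unfolding routing_solution_def arcs_bidirected
  proof (intro conjI ballI)
    show "0 \<le> g h a" for h a
      unfolding g_def using x by (intro sum_nonneg) auto
    fix h and v :: vertex assume h: "h \<in> H"
    have swap: "(\<Sum>a | a \<in> arcset E \<and> f a = v. g h a)
        = (\<Sum>j | j \<in> J \<and> fst j = h. x j * (\<Sum>a | a \<in> arcset E \<and> f a = v. real (count_list (snd j) a)))" for f
      unfolding g_def sum_distrib_left by (subst sum.swap) (simp only: mult.commute)
    have "(\<Sum>a | a \<in> arcset E \<and> fst a = v. g h a) - (\<Sum>a | a \<in> arcset E \<and> snd a = v. g h a)
        = (\<Sum>j | j \<in> J \<and> fst j = h. x j * (of_bool (v = source h) - of_bool (v = sink h)))"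
      unfolding swap sum_subtractf[symmetric] right_diff_distrib[symmetric]
    proof (intro sum.cong refl)
      fix j assume "j \<in> {j \<in> J. fst j = h}"
      then have "walk E (source h) (snd j) (sink h)" using J[of "fst j" "snd j"] by auto
      then show "x j * ((\<Sum>a | a \<in> arcset E \<and> fst a = v. real (count_list (snd j) a))
          - (\<Sum>a | a \<in> arcset E \<and> snd a = v. real (count_list (snd j) a)))
        = x j * (of_bool (v = source h) - of_bool (v = sink h))"
        using walk_divergence[OF _ finA] by simp
    qed
    also have "\<dots> = r h * (of_bool (v = source h) - of_bool (v = sink h))"
      using rate[OF h] by (simp only: sum_distrib_right[symmetric])
    finally show "(\<Sum>a | a \<in> arcset E \<and> fst a = v. g h a) - (\<Sum>a | a \<in> arcset E \<and> snd a = v. g h a)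
      = r h * (of_bool (v = source h) - of_bool (v = sink h))" .
  qed
  moreover have "within_capacity E c (\<lambda>a. \<Sum>h\<in>H. g h a)"
    unfolding within_capacity_def
  proof
    fix e assume e: "e \<in> E"
    have "(\<Sum>h\<in>H. g h a) = (\<Sum>j\<in>J. real (count_list (snd j) a) * x j)" for a
      unfolding g_def using finJ finH J by (intro sum.group) auto
    then have "edge_flow (\<lambda>a. \<Sum>h\<in>H. g h a) e = (\<Sum>j\<in>J. crossings e j * x j)"
      by (simp only: edge_flow_def sum_count_arcs)
    then show "edge_flow (\<lambda>a. \<Sum>h\<in>H. g h a) e \<le> c e"
      using cap e by simp
  qed
  ultimately show ?thesis
    unfolding routing_achievable_def by blast
qed

end

section \<open>The two implications\<close>

lemma path_family_if_meets_demands: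
  assumes "finite_graph V E" "session_set V H" "meets_demands (session_paths V E H) fst H r x"
  shows "path_family V E H r (session_paths V E H) x"
  using assms finite_session_paths[of V E H] session_paths_walk[of V E]
  by unfold_locales (auto simp: meets_demands_def session_set_def)

text \<open>Either kind of solution yields the dual inequality for all weights, and this yields a
  path flow, from which either kind can be built. Passing from routing to coding in this way also
  avoids decomposing a multicommodity flow, which may contain cycles, into paths.\<close>

lemma conjecture_if_independent_cores:
  assumes cores: independent_cores
  shows multiple_unicast_conjecture
  unfolding multiple_unicast_conjecture_def
proof (intro allI impI)
  fix V E H and c :: "edge \<Rightarrow> real" and r :: "session \<Rightarrow> real"
  assume graph: "finite_graph V E" and sessions: "session_set V H" and r: "\<forall>h\<in>H. 0 \<le> r h"
  show "coding_achievable V E H c r \<longleftrightarrow> routing_achievable V E H c r"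
  proof
    assume "coding_achievable V E H c r"
    then obtain C where C: "coding_solution V E H r C" "within_capacity E c (coding_flow C)"
      by (auto simp: coding_achievable_def)
    interpret coded_network V E H r C using graph sessions C by unfold_locales
    have "(\<Sum>h\<in>H. r h * weighted_graph.dist_w V E w (source h) (sink h)) \<le> (\<Sum>e\<in>E. w e * c e)"
      if "\<forall>e\<in>E. 0 \<le> w e" for w
    proof -
      interpret weighted_graph V E w using graph that by unfold_locales
      show ?thesis using cores sessions C by (rule coding_dual)
    qed
    then obtain x where x: "meets_demands (session_paths V E H) fst H r x"
      and cap: "\<forall>e\<in>E. (\<Sum>j\<in>session_paths V E H. crossings e j * x j) \<le> c e"
      using path_flow_if_dual[OF graph sessions r connected_demands, of c] by blast
    show "routing_achievable V E H c r"
      by (rule path_family.path_routing_achievable[OF path_family_if_meets_demands[OF graph sessions x] cap])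
  next
    assume "routing_achievable V E H c r"
    then obtain g where g: "routing_solution V E H r g" "within_capacity E c (\<lambda>a. \<Sum>h\<in>H. g h a)"
      unfolding routing_achievable_def by blast
    have "(\<Sum>h\<in>H. r h * weighted_graph.dist_w V E w (source h) (sink h)) \<le> (\<Sum>e\<in>E. w e * c e)"
      if "\<forall>e\<in>E. 0 \<le> w e" for w
    proof -
      interpret weighted_graph V E w using graph that by unfold_locales
      show ?thesis using sessions g by (rule routing_dual)
    qed
    then obtain x where x: "meets_demands (session_paths V E H) fst H r x"
      and cap: "\<forall>e\<in>E. (\<Sum>j\<in>session_paths V E H. crossings e j * x j) \<le> c e"
      using path_flow_if_dual[OF graph sessions r routing_connected_demands[OF graph sessions g(1)], of c] by blast
    show "coding_achievable V E H c r"
      by (rule path_family.path_coding_achievable[OF path_family_if_meets_demands[OF graph sessions x] cap])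
  qed
qed

text \<open>Sending every message along a shortest path is a minimum-cost solution if coding does not
  help, and none of its symbols mixes messages.\<close>

lemma independent_sessions_if_conjecture:
  assumes conj: multiple_unicast_conjecture
    and inst: "network_instance V E H w" and r: "\<forall>h\<in>H. 0 \<le> r h" and conn: "connected_demands V E H r"
  shows "independent_sessions V E H r w"
proof -
  have graph: "finite_graph V E" and sessions: "session_set V H" and weight: "\<forall>e\<in>E. 0 \<le> w e"
    using inst by (auto simp: network_instance_def)
  interpret weighted_graph V E w using graph weight by unfold_locales
  define q where "q h = sp (source h) (sink h)" for h
  \<comment> \<open>Only positive demands are known to be connected; the remaining sessions get no
    path.\<close>
  define H' where "H' = {h \<in> H. 0 < r h}"
  define J where "J = (\<lambda>h. (h, q h)) ` H'"
  define x where "x j = r (fst j)" for j :: "session \<times> arc list"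
  have H': "finite H'" "H' \<subseteq> H"
    using sessions by (auto simp: H'_def session_set_def)
  have r0: "r h = 0" if "h \<in> H - H'" for h
    using r that by (force simp: H'_def)
  have q: "walk E (source h) (q h) (sink h)" "dist_w (source h) (sink h) = wlen w (q h)" if h: "h \<in> H'" for h
  proof -
    have s: "source h \<in> V" using sessions h by (auto simp: session_set_def H'_def)
    obtain p where "walk E (source h) p (sink h)"
      using conn h reachable_iff_walk[OF graph s] unfolding connected_demands_def H'_def by blast
    then show "walk E (source h) (q h) (sink h)" "dist_w (source h) (sink h) = wlen w (q h)"
      using sp(1)[OF s] simple_path_walk by (auto simp: q_def dist_w_def)
  qed
  interpret path_family V E H r J x
  proof
    show "finite J" using H' by (simp add: J_def)
    show "(h, p) \<in> J \<Longrightarrow> h \<in> H \<and> walk E (source h) p (sink h)" for h p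
      using H' q by (auto simp: J_def)
    show "j \<in> J \<Longrightarrow> 0 \<le> x j" for j
      using H' r by (auto simp: J_def x_def)
    show "r h = (\<Sum>j | j \<in> J \<and> fst j = h. x j)" if "h \<in> H" for h
    proof (cases "h \<in> H'")
      case True
      then have "{j \<in> J. fst j = h} = {(h, q h)}" by (auto simp: J_def)
      then show ?thesis by (simp add: x_def)
    next
      case False
      then have "{j \<in> J. fst j = h} = {}" by (auto simp: J_def)
      then show ?thesis using r0 that False by (simp only: sum.empty) simp
    qed
  qed (rule graph sessions)+
  obtain C where C: "coding_solution V E H r C"
    and flow: "\<forall>a. coding_flow C a \<le> (\<Sum>j | j \<in> J \<and> a \<in> set (snd j). x j)"
    and ind: "(\<forall>i\<in>H. \<forall>j\<in>H. i \<noteq> j \<longrightarrow> (\<forall>e\<in>E. \<forall>a\<in>arcs_of e. \<forall>t<rounds C.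
      cond_mi (Pr C) (symbol C a t) (message C i) (messages C (H - {i})) *
      cond_mi (Pr C) (symbol C a t) (message C j) (messages C (H - {j})) = 0))"
    using path_code by blast
  have "coding_cost E w C \<le> (\<Sum>h\<in>H. r h * dist_w (source h) (sink h))"
  proof -
    have "coding_cost E w C \<le> (\<Sum>e\<in>E. w e * (\<Sum>j\<in>J. crossings e j * x j))"
      unfolding coding_cost_def using weight edge_flow_le_crossings[OF flow[rule_format]]
      by (intro sum_mono mult_left_mono) auto
    also have "\<dots> = (\<Sum>j\<in>J. x j * (\<Sum>e\<in>E. w e * crossings e j))"
      unfolding sum_distrib_left by (subst sum.swap) (simp only: mult_ac)
    also have "\<dots> = (\<Sum>h\<in>H'. r h * (\<Sum>e\<in>E. w e * crossings e (h, q h)))"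
      unfolding J_def by (subst sum.reindex) (auto simp: inj_on_def x_def)
    also have "\<dots> = (\<Sum>h\<in>H'. r h * dist_w (source h) (sink h))"
      using sum_count_wlen[OF q(1)] q(2) by (intro sum.cong) (auto simp: crossings_def)
    also have "\<dots> = (\<Sum>h\<in>H. r h * dist_w (source h) (sink h))"
      using H' r0 sessions by (intro sum.mono_neutral_left) (auto simp: session_set_def)
    finally show ?thesis .
  qed
  moreover have "(\<Sum>h\<in>H. r h * dist_w (source h) (sink h)) \<le> coding_cost E w C'"
    if C': "coding_solution V E H r C'" for C'
  proof -
    interpret C': coded_network V E H r C' using graph sessions C' by unfold_locales
    \<comment> \<open>With its own edge flow as capacities, \<open>C'\<close> is feasible. The
      conjecture then gives a routing with no larger load on any edge, whose cost weak duality
      bounds from below.\<close>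
    let ?c = "edge_flow (coding_flow C')"
    have "coding_achievable V E H ?c r"
      using C' by (auto simp: coding_achievable_def within_capacity_def)
    moreover have "\<forall>e\<in>E. 0 \<le> ?c e"
      unfolding edge_flow_def using arcs_of_subset C'.coding_flow_nonneg by (intro ballI sum_nonneg) blast
    ultimately have "routing_achievable V E H ?c r"
      using conj graph sessions r unfolding multiple_unicast_conjecture_def by blast
    then obtain g where "routing_solution V E H r g" "within_capacity E ?c (\<lambda>a. \<Sum>h\<in>H. g h a)"
      unfolding routing_achievable_def by blast
    then show ?thesis
      unfolding coding_cost_def by (rule routing_dual[OF sessions])
  qed
  ultimately have "min_cost_coding_solution V E H r w C"
    unfolding min_cost_coding_solution_def using C order_trans by blast
  then show ?thesis
    unfolding independent_sessions_def using ind by blast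
qed

theorem mainTheorem2:
  shows "multiple_unicast_conjecture \<longleftrightarrow>
    (\<forall>V E H w r.
       network_instance V E H w \<longrightarrow> (\<forall>h\<in>H. 0 \<le> r h) \<longrightarrow> connected_demands V E H r \<longrightarrow>
       irreducible_core V E H w \<longrightarrow> independent_sessions V E H r w)"
  using independent_sessions_if_conjecture conjecture_if_independent_cores
  unfolding independent_cores_def by blast

end
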